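(* Let $\mathcal{G}$ be an open subset of $(-\pi,\pi)$ and let $\mathcal{G}^\ast:=\{x\in(-\pi,\pi)\mid\exists\mathcal{H}\in Ext_\mathcal{G}[x\in\mathcal{H}]\}$ be its co-perfect hull. Then $(\mathcal{G}^\ast)^+=\mathcal{G}^\ast$. Moreover: (i) if $(-\pi,\pi)\subseteq\mathcal{G}^\ast$, then $\mathcal{G}$ is eventually full in $(-\pi,\pi)$ and $[-\pi,\pi]\setminus\mathcal{G}$ is almost-enumerable; (ii) for all $x$ in $(-\pi,\pi)$, if $x\notin\mathcal{G}^\ast$, then $\forall n\,\neg\forall z\in(x-\frac{1}{2^n},x)\cup(x,x+\frac{1}{2^n})[z\in\mathcal{G}^\ast]$.
   Context: Setting: intuitionistic mathematics (intuitionistic logic; disjunction and existential quantification are read constructively; generalized inductive definitions, with the corresponding induction principles, and countable choice are accepted). A real number $x$ is an infinite sequence of pairs $x(n)=(x'(n),x''(n))$ of rationals such that $x'(n)\le x'(n+1)\le x''(n+1)\le x''(n)$ for all $n$ and $\forall m\exists n[x''(n)-x'(n)<\frac{1}{2^m}]$; $\mathcal{R}$ is the set of real numbers. $x<y$ means $\exists n[x''(n)<y'(n)]$; $x\;\#_\mathcal{R}\;y$ (apartness) means $x<y$ or $y<x$; $x\le y$ means $\neg(y<x)$; $x=y$ means $\neg(x\;\#_\mathcal{R}\;y)$. $\mathcal{N}$ is the set of infinite sequences of natural numbers. $\mathcal{G}\subseteq\mathcal{R}$ is open iff for each $x\in\mathcal{G}$ there is $n$ with $(x-\frac{1}{2^n},x+\frac{1}{2^n})\subseteq\mathcal{G}$.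 The co-derivative extension of an open $\mathcal{G}\subseteq\mathcal{R}$ is $$\mathcal{G}^+:=\{x\in\mathcal{R}\mid\exists n\in\mathbb{N}\,\exists y\in\mathcal{R}[|x-y|<\tfrac{1}{2^n}\wedge\forall z[(|x-z|<\tfrac{1}{2^n}\wedge z\;\#_\mathcal{R}\;y)\rightarrow z\in\mathcal{G}]]\}.$$ $Ext_\mathcal{G}$ is the smallest collection $\mathcal{E}$ of subsets of $\mathcal{R}$ such that $\mathcal{G}\in\mathcal{E}$; $\mathcal{H}\in\mathcal{E}$ implies $\mathcal{H}^+\in\mathcal{E}$; and for every infinite sequence $\mathcal{H}_0,\mathcal{H}_1,\ldots$ of elements of $\mathcal{E}$, $\bigcup_{n\in\mathbb{N}}\mathcal{H}_n\in\mathcal{E}$. An open $\mathcal{G}\subseteq(a,b)$ is eventually full in $(a,b)$ iff $(a,b)\in Ext_\mathcal{G}$. $[-\pi,\pi]\setminus\mathcal{G}=\{x\in[-\pi,\pi]\mid x\notin\mathcal{G}\}$. $\mathcal{X}\subseteq\mathcal{R}$ is almost-enumerable iff there is a function $f:\mathbb{N}\to\mathcal{R}$ such that $\forall x\in\mathcal{X}\,\forall\gamma\in\mathcal{N}\,\exists n[|f(n)-x|<\frac{1}{2^{\gamma(n)}}]$. The following axiom is accepted (Fan Theorem): every set $B$ of finite binary sequences such that every infinite binary sequence has an initial part in $B$ has a finite subset with the same property. *)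

theory Defs
  imports Complex_Main
begin

section \<open>Intuitionistic truth values\<close>

text \<open>
  HOL is classical, so the intuitionistic statement is interpreted in the standard semantics of
  intuitionistic higher-order logic with truth values in an arbitrary complete Heyting algebra.
  A formula denotes a truth value, bold connectives and quantifiers are the Heyting-valued ones,
  and \<open>\<Turnstile> \<phi>\<close> says that \<open>\<phi>\<close> holds in the model. Excluded middle and its relatives fail in
  such models in general; the instance \<open>bool\<close> is the classical reading.

  The (decidable) domains of natural numbers, rationals, pairs of rationals and finite sequences are
  the HOL types. A function from \<open>nat\<close> to such a domain is an internal one, that is, a
  Heyting-valued relation together with the statement that it is total and single-valued.
  Sets of reals and reals themselves can be glued along truth values, so for sequences of these
  every internal function is given by a HOL function on \<open>nat\<close>.
\<close>

class complete_heyting_algebra = complete_lattice +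
  assumes inf_Sup_frame: "inf a (Sup B) = (SUP b\<in>B. inf a b)"

instance bool :: complete_heyting_algebra
  by standard auto

abbreviation hconj :: "'o::complete_heyting_algebra \<Rightarrow> 'o \<Rightarrow> 'o" (infixr "\<^bold>\<and>" 35) where
  "p \<^bold>\<and> q \<equiv> inf p q"

abbreviation hdisj :: "'o::complete_heyting_algebra \<Rightarrow> 'o \<Rightarrow> 'o" (infixr "\<^bold>\<or>" 30) where
  "p \<^bold>\<or> q \<equiv> sup p q"

definition himp :: "'o::complete_heyting_algebra \<Rightarrow> 'o \<Rightarrow> 'o" (infixr "\<^bold>\<longrightarrow>" 25) where
  "(p \<^bold>\<longrightarrow> q) = Sup {r. inf r p \<le> q}"

definition hiff :: "'o::complete_heyting_algebra \<Rightarrow> 'o \<Rightarrow> 'o" (infix "\<^bold>\<longleftrightarrow>" 25) where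
  "(p \<^bold>\<longleftrightarrow> q) = ((p \<^bold>\<longrightarrow> q) \<^bold>\<and> (q \<^bold>\<longrightarrow> p))"

definition hneg :: "'o::complete_heyting_algebra \<Rightarrow> 'o" ("\<^bold>\<not> _" [40] 40) where
  "(\<^bold>\<not> p) = (p \<^bold>\<longrightarrow> bot)"

abbreviation hall :: "('a \<Rightarrow> 'o::complete_heyting_algebra) \<Rightarrow> 'o" (binder "\<^bold>\<forall>" 10) where
  "hall \<phi> \<equiv> Inf (range \<phi>)"

abbreviation hex :: "('a \<Rightarrow> 'o::complete_heyting_algebra) \<Rightarrow> 'o" (binder "\<^bold>\<exists>" 10) where
  "hex \<phi> \<equiv> Sup (range \<phi>)"

definition decided :: "bool \<Rightarrow> 'o::complete_heyting_algebra" ("\<langle>_\<rangle>") where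
  "\<langle>b\<rangle> = (if b then top else bot)"

definition valid :: "'o::complete_heyting_algebra \<Rightarrow> bool" ("\<Turnstile> _" [5] 5) where
  "(\<Turnstile> p) \<longleftrightarrow> p = top"

lemma le_himp_iff: "r \<le> (p \<^bold>\<longrightarrow> q) \<longleftrightarrow> inf r p \<le> q"
proof
  assume "r \<le> (p \<^bold>\<longrightarrow> q)"
  then have "inf r p \<le> inf p (Sup {r. inf r p \<le> q})"
    by (simp add: himp_def le_infI1)
  also have "\<dots> \<le> q"
    unfolding inf_Sup_frame by (auto intro!: SUP_least simp: inf_commute)
  finally show "inf r p \<le> q" .
qed (auto simp: himp_def intro: Sup_upper)


section \<open>Infinite sequences and real numbers\<close>

type_synonym ('o, 'a) seq_name = "nat \<Rightarrow> 'a \<Rightarrow> 'o"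

definition is_seq :: "('o::complete_heyting_algebra, 'a) seq_name \<Rightarrow> 'o" where
  "is_seq \<alpha> = ((\<^bold>\<forall>n. \<^bold>\<exists>a. \<alpha> n a) \<^bold>\<and> (\<^bold>\<forall>n a b. (\<alpha> n a \<^bold>\<and> \<alpha> n b) \<^bold>\<longrightarrow> \<langle>a = b\<rangle>))"

type_synonym 'o real_name = "('o, rat \<times> rat) seq_name"

text \<open>\<open>x n (a, b)\<close> is the truth value of \<open>x'(n) = a\<close> and \<open>x''(n) = b\<close>.\<close>

definition is_real :: "'o::complete_heyting_algebra real_name \<Rightarrow> 'o" where
  "is_real x =
    (is_seq x
     \<^bold>\<and> (\<^bold>\<forall>n. \<^bold>\<exists>p q. x n p \<^bold>\<and> x (Suc n) q \<^bold>\<and> \<langle>fst p \<le> fst q \<and> fst q \<le> snd q \<and> snd q \<le> snd p\<rangle>)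
     \<^bold>\<and> (\<^bold>\<forall>m. \<^bold>\<exists>n p. x n p \<^bold>\<and> \<langle>snd p - fst p < 1 / 2 ^ (m::nat)\<rangle>))"

abbreviation hall_real :: "('o::complete_heyting_algebra real_name \<Rightarrow> 'o) \<Rightarrow> 'o"
    (binder "\<^bold>\<forall>\<^sub>R" 10) where
  "\<^bold>\<forall>\<^sub>R x. \<phi> x \<equiv> \<^bold>\<forall>x. is_real x \<^bold>\<longrightarrow> \<phi> x"

abbreviation hex_real :: "('o::complete_heyting_algebra real_name \<Rightarrow> 'o) \<Rightarrow> 'o"
    (binder "\<^bold>\<exists>\<^sub>R" 10) where
  "\<^bold>\<exists>\<^sub>R x. \<phi> x \<equiv> \<^bold>\<exists>x. is_real x \<^bold>\<and> \<phi> x"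

definition rless :: "'o::complete_heyting_algebra real_name \<Rightarrow> 'o real_name \<Rightarrow> 'o"
    (infix "\<^bold><" 50) where
  "(x \<^bold>< y) = (\<^bold>\<exists>n p q. x n p \<^bold>\<and> y n q \<^bold>\<and> \<langle>snd p < fst q\<rangle>)"

definition apart :: "'o::complete_heyting_algebra real_name \<Rightarrow> 'o real_name \<Rightarrow> 'o"
    (infix "\<^bold>#" 50) where
  "(x \<^bold># y) = ((x \<^bold>< y) \<^bold>\<or> (y \<^bold>< x))"

definition rle :: "'o::complete_heyting_algebra real_name \<Rightarrow> 'o real_name \<Rightarrow> 'o"
    (infix "\<^bold>\<le>" 50) where
  "(x \<^bold>\<le> y) = (\<^bold>\<not> (y \<^bold>< x))"

definition rconst :: "rat \<Rightarrow> 'o::complete_heyting_algebra real_name" where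
  "rconst r = (\<lambda>n p. \<langle>p = (r, r)\<rangle>)"

definition rneg :: "'o::complete_heyting_algebra real_name \<Rightarrow> 'o real_name" where
  "rneg x = (\<lambda>n c. \<^bold>\<exists>p. x n p \<^bold>\<and> \<langle>c = (- snd p, - fst p)\<rangle>)"

definition radd :: "'o::complete_heyting_algebra real_name \<Rightarrow> 'o real_name \<Rightarrow> 'o real_name"
    (infixl "\<^bold>+" 65) where
  "x \<^bold>+ y = (\<lambda>n c. \<^bold>\<exists>p q. x n p \<^bold>\<and> y n q \<^bold>\<and> \<langle>c = (fst p + fst q, snd p + snd q)\<rangle>)"

definition rminus :: "'o::complete_heyting_algebra real_name \<Rightarrow> 'o real_name \<Rightarrow> 'o real_name"
    (infixl "\<^bold>-" 65) where
  "x \<^bold>- y = x \<^bold>+ rneg y"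

definition rabs :: "'o::complete_heyting_algebra real_name \<Rightarrow> 'o real_name" where
  "rabs x = (\<lambda>n c. \<^bold>\<exists>p. x n p \<^bold>\<and>
     \<langle>c = (max 0 (max (fst p) (- snd p)), max (- fst p) (snd p))\<rangle>)"

definition dyadic :: "nat \<Rightarrow> 'o::complete_heyting_algebra real_name" where
  "dyadic n = rconst (1 / 2 ^ n)"

text \<open>The number \<open>\<pi>\<close>, given by its dyadic approximations from below and above.\<close>

definition rpi :: "'o::complete_heyting_algebra real_name" where
  "rpi = (\<lambda>n p. \<langle>p = (of_int \<lfloor>2 ^ n * pi\<rfloor> / 2 ^ n, of_int (\<lfloor>2 ^ n * pi\<rfloor> + 1) / 2 ^ n)\<rangle>)"


section \<open>Sets of real numbers\<close>

type_synonym 'o real_set = "'o real_name \<Rightarrow> 'o"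

text \<open>
  Identity of the sequences themselves, which is finer than equality of real numbers; it is the
  identity that every Heyting-valued predicate on sequences has to respect.
\<close>

definition same_seq :: "('o::complete_heyting_algebra, 'a) seq_name \<Rightarrow> ('o, 'a) seq_name \<Rightarrow> 'o" where
  "same_seq \<alpha> \<beta> = (\<^bold>\<forall>n a. \<alpha> n a \<^bold>\<longleftrightarrow> \<beta> n a)"

definition is_set :: "'o::complete_heyting_algebra real_set \<Rightarrow> 'o" where
  "is_set X = (\<^bold>\<forall>\<^sub>R x. \<^bold>\<forall>\<^sub>R y. (same_seq x y \<^bold>\<and> X x) \<^bold>\<longrightarrow> X y)"

abbreviation hall_set :: "('o::complete_heyting_algebra real_set \<Rightarrow> 'o) \<Rightarrow> 'o"
    (binder "\<^bold>\<forall>\<^sub>S" 10) where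
  "\<^bold>\<forall>\<^sub>S X. \<phi> X \<equiv> \<^bold>\<forall>X. is_set X \<^bold>\<longrightarrow> \<phi> X"

abbreviation hex_set :: "('o::complete_heyting_algebra real_set \<Rightarrow> 'o) \<Rightarrow> 'o"
    (binder "\<^bold>\<exists>\<^sub>S" 10) where
  "\<^bold>\<exists>\<^sub>S X. \<phi> X \<equiv> \<^bold>\<exists>X. is_set X \<^bold>\<and> \<phi> X"

definition subset_of :: "'o::complete_heyting_algebra real_set \<Rightarrow> 'o real_set \<Rightarrow> 'o"
    (infix "\<^bold>\<subseteq>" 50) where
  "(X \<^bold>\<subseteq> Y) = (\<^bold>\<forall>\<^sub>R x. X x \<^bold>\<longrightarrow> Y x)"

definition set_eq :: "'o::complete_heyting_algebra real_set \<Rightarrow> 'o real_set \<Rightarrow> 'o"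
    (infix "\<^bold>=" 50) where
  "(X \<^bold>= Y) = (\<^bold>\<forall>\<^sub>R x. X x \<^bold>\<longleftrightarrow> Y x)"

definition set_union :: "'o::complete_heyting_algebra real_set \<Rightarrow> 'o real_set \<Rightarrow> 'o real_set"
    (infixl "\<^bold>\<union>" 65) where
  "X \<^bold>\<union> Y = (\<lambda>x. X x \<^bold>\<or> Y x)"

definition set_minus :: "'o::complete_heyting_algebra real_set \<Rightarrow> 'o real_set \<Rightarrow> 'o real_set"
    (infixl "\<^bold>\<setminus>" 65) where
  "X \<^bold>\<setminus> Y = (\<lambda>x. X x \<^bold>\<and> (\<^bold>\<not> Y x))"

definition Union_seq :: "(nat \<Rightarrow> 'o::complete_heyting_algebra real_set) \<Rightarrow> 'o real_set" where
  "Union_seq H = (\<lambda>x. \<^bold>\<exists>n. H n x)"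

definition open_interval ::
    "'o::complete_heyting_algebra real_name \<Rightarrow> 'o real_name \<Rightarrow> 'o real_set" where
  "open_interval a b = (\<lambda>x. (a \<^bold>< x) \<^bold>\<and> (x \<^bold>< b))"

definition closed_interval ::
    "'o::complete_heyting_algebra real_name \<Rightarrow> 'o real_name \<Rightarrow> 'o real_set" where
  "closed_interval a b = (\<lambda>x. (a \<^bold>\<le> x) \<^bold>\<and> (x \<^bold>\<le> b))"

definition is_open :: "'o::complete_heyting_algebra real_set \<Rightarrow> 'o" where
  "is_open G = (\<^bold>\<forall>\<^sub>R x. G x \<^bold>\<longrightarrow>
     (\<^bold>\<exists>n. open_interval (x \<^bold>- dyadic n) (x \<^bold>+ dyadic n) \<^bold>\<subseteq> G))"


section \<open>Co-derivative extensions\<close>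

definition coderiv :: "'o::complete_heyting_algebra real_set \<Rightarrow> 'o real_set" where
  "coderiv G = (\<lambda>x. \<^bold>\<exists>n. \<^bold>\<exists>\<^sub>R y. (rabs (x \<^bold>- y) \<^bold>< dyadic n) \<^bold>\<and>
     (\<^bold>\<forall>\<^sub>R z. ((rabs (x \<^bold>- z) \<^bold>< dyadic n) \<^bold>\<and> (z \<^bold># y)) \<^bold>\<longrightarrow> G z))"

definition is_collection :: "('o::complete_heyting_algebra real_set \<Rightarrow> 'o) \<Rightarrow> 'o" where
  "is_collection E = (\<^bold>\<forall>\<^sub>S X. \<^bold>\<forall>\<^sub>S Y. ((X \<^bold>= Y) \<^bold>\<and> E X) \<^bold>\<longrightarrow> E Y)"

definition ext_closed ::
    "'o::complete_heyting_algebra real_set \<Rightarrow> ('o real_set \<Rightarrow> 'o) \<Rightarrow> 'o" where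
  "ext_closed G E =
    (E G
     \<^bold>\<and> (\<^bold>\<forall>\<^sub>S H. E H \<^bold>\<longrightarrow> E (coderiv H))
     \<^bold>\<and> (\<^bold>\<forall>H. (\<^bold>\<forall>n. is_set (H n) \<^bold>\<and> E (H n)) \<^bold>\<longrightarrow> E (Union_seq H)))"

text \<open>
  The smallest collection is the intersection of all collections with the closure properties. This
  yields the induction principle of the generalized inductive definition.
\<close>

definition Ext :: "'o::complete_heyting_algebra real_set \<Rightarrow> 'o real_set \<Rightarrow> 'o" where
  "Ext G H = (\<^bold>\<forall>E. (is_collection E \<^bold>\<and> ext_closed G E) \<^bold>\<longrightarrow> E H)"

definition eventually_full ::
    "'o::complete_heyting_algebra real_name \<Rightarrow> 'o real_name \<Rightarrow> 'o real_set \<Rightarrow> 'o" where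
  "eventually_full a b G =
    (is_open G \<^bold>\<and> (G \<^bold>\<subseteq> open_interval a b) \<^bold>\<and> Ext G (open_interval a b))"

definition coperfect_hull :: "'o::complete_heyting_algebra real_set \<Rightarrow> 'o real_set" where
  "coperfect_hull G =
    (\<lambda>x. open_interval (rneg rpi) rpi x \<^bold>\<and> (\<^bold>\<exists>\<^sub>S H. Ext G H \<^bold>\<and> H x))"

definition is_real_seq :: "(nat \<Rightarrow> 'o::complete_heyting_algebra real_name) \<Rightarrow> 'o" where
  "is_real_seq f = (\<^bold>\<forall>n. is_real (f n))"

definition almost_enumerable :: "'o::complete_heyting_algebra real_set \<Rightarrow> 'o" where
  "almost_enumerable X =
    (\<^bold>\<exists>f. is_real_seq f \<^bold>\<and>
      (\<^bold>\<forall>\<^sub>R x. X x \<^bold>\<longrightarrow>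
        (\<^bold>\<forall>\<gamma>. is_seq \<gamma> \<^bold>\<longrightarrow> (\<^bold>\<exists>n k. \<gamma> n k \<^bold>\<and> (rabs (f n \<^bold>- x) \<^bold>< dyadic k)))))"


section \<open>The axioms accepted on top of intuitionistic logic\<close>

text \<open>
  Choice along the natural numbers for a domain \<open>D\<close> with identity \<open>I\<close>, for every relation \<open>R\<close>
  that respects \<open>I\<close>. It is used for sets of reals and for sequences of reals; choice of reals, of
  natural numbers and of sequences of these are special cases.
\<close>

definition countable_choice ::
    "('a \<Rightarrow> 'o::complete_heyting_algebra) \<Rightarrow> ('a \<Rightarrow> 'a \<Rightarrow> 'o) \<Rightarrow> 'o" where
  "countable_choice D I =
    (\<^bold>\<forall>R :: nat \<Rightarrow> 'a \<Rightarrow> 'o.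
      ((\<^bold>\<forall>n a b. (D a \<^bold>\<and> D b \<^bold>\<and> I a b \<^bold>\<and> R n a) \<^bold>\<longrightarrow> R n b)
       \<^bold>\<and> (\<^bold>\<forall>n. \<^bold>\<exists>a. D a \<^bold>\<and> R n a))
      \<^bold>\<longrightarrow> (\<^bold>\<exists>f. \<^bold>\<forall>n. D (f n) \<^bold>\<and> R n (f n)))"

definition countable_choice_sets :: "'o::complete_heyting_algebra itself \<Rightarrow> 'o" where
  "countable_choice_sets _ = countable_choice is_set set_eq"

definition countable_choice_real_seqs :: "'o::complete_heyting_algebra itself \<Rightarrow> 'o" where
  "countable_choice_real_seqs _ = countable_choice is_real_seq (\<lambda>f g. \<^bold>\<forall>n. same_seq (f n) (g n))"

definition is_bar :: "(bool list \<Rightarrow> 'o::complete_heyting_algebra) \<Rightarrow> 'o" where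
  "is_bar B = (\<^bold>\<forall>\<alpha>. is_seq \<alpha> \<^bold>\<longrightarrow> (\<^bold>\<exists>s. (\<^bold>\<forall>i. \<langle>i < length s\<rangle> \<^bold>\<longrightarrow> \<alpha> i (s ! i)) \<^bold>\<and> B s))"

text \<open>A finite set of finite binary sequences is given by a list of its elements.\<close>

definition fan_theorem :: "'o::complete_heyting_algebra itself \<Rightarrow> 'o" where
  "fan_theorem _ =
    (\<^bold>\<forall>B :: bool list \<Rightarrow> 'o. is_bar B \<^bold>\<longrightarrow>
      (\<^bold>\<exists>F :: bool list list. (\<^bold>\<forall>s. \<langle>s \<in> set F\<rangle> \<^bold>\<longrightarrow> B s) \<^bold>\<and> is_bar (\<lambda>s. \<langle>s \<in> set F\<rangle>)))"

end

theory Submission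
  imports Defs "HOL-Library.Nat_Bijection"
begin

text \<open>
  Truth values are handled by forcing: \<open>w \<le> \<phi>\<close> is read as "\<open>\<phi>\<close> holds at stage \<open>w\<close>", and the
  introduction and elimination rules of intuitionistic logic become rules about this relation. In this
  reading the argument is the following constructive one.

  The point is to replace information about points by information about intervals. Call a property of
  sets of real numbers a \<open>\<sigma>\<close>-ideal if it passes to subsets and countable unions. If every point of a
  closed rational interval has a neighbourhood in such an ideal, then by the fan theorem finitely many of
  these neighbourhoods suffice, and the interval belongs to the ideal (lemma \<open>compactness\<close>). Exhausting
  by closed intervals gives the same for open intervals with real end points and for punctured balls
  (\<open>open_interval_in_ideal\<close>, \<open>punctured_in_ideal\<close>). Two ideals are used.

  The first consists of the sets contained in a single element of \<open>Ext G\<close>; it is closed under countable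
  unions by countable choice (\<open>sigma_ideal_covered\<close>). All elements of \<open>Ext G\<close> are open subsets of the
  interval (\<open>Ext_open_bounded\<close>), so every point of the hull has a neighbourhood in this ideal. Hence
  a punctured ball in the hull is contained in one element \<open>H\<close> of \<open>Ext G\<close>, and the points that its
  co-derivative extension adds belong to \<open>coderiv H\<close>. This shows that the hull is a fixed point of the
  co-derivative extension. Part (ii) is a special case: a point all of whose punctured neighbours are in
  the hull is itself in the hull. If the hull contains the whole interval, the interval is contained in,
  and therefore equal to, one element of \<open>Ext G\<close>, and \<open>G\<close> is eventually full.

  The second ideal consists of the sets \<open>S\<close> for which \<open>S\<close> without \<open>G\<close> is almost-enumerable. By induction
  every point of every element of \<open>Ext G\<close> has a neighbourhood in it (\<open>Ext_locally_enumerable\<close>). If the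
  open interval is an element of \<open>Ext G\<close>, it consequently belongs to the ideal, and adding the two end
  points preserves almost-enumerability.
\<close>

section \<open>Forcing\<close>

lemma hallI: "(\<And>x. w \<le> \<phi> x) \<Longrightarrow> (w::'o::complete_heyting_algebra) \<le> (\<^bold>\<forall>x. \<phi> x)"
  by (rule INF_greatest)

lemma hallD: "(w::'o::complete_heyting_algebra) \<le> (\<^bold>\<forall>x. \<phi> x) \<Longrightarrow> w \<le> \<phi> a"
  by (rule order_trans[OF _ INF_lower[OF UNIV_I]])

lemma himpI: "(\<And>v. v \<le> w \<Longrightarrow> v \<le> p \<Longrightarrow> v \<le> q) \<Longrightarrow> w \<le> (p \<^bold>\<longrightarrow> q)"
  by (simp add: le_himp_iff)

lemma himpD: "w \<le> (p \<^bold>\<longrightarrow> q) \<Longrightarrow> w \<le> p \<Longrightarrow> w \<le> q"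
  using le_himp_iff[of w p q] by (simp add: inf.absorb1)

lemma hnegI: "(\<And>v. v \<le> w \<Longrightarrow> v \<le> p \<Longrightarrow> v \<le> bot) \<Longrightarrow> w \<le> (\<^bold>\<not> p)"
  unfolding hneg_def by (rule himpI)

lemma hnegE: "w \<le> (\<^bold>\<not> p) \<Longrightarrow> w \<le> p \<Longrightarrow> w \<le> q"
  unfolding hneg_def by (rule order_trans[OF himpD bot_least])

lemma hexI: "(w::'o::complete_heyting_algebra) \<le> \<phi> a \<Longrightarrow> w \<le> (\<^bold>\<exists>x. \<phi> x)"
  by (rule order_trans[OF _ SUP_upper[OF UNIV_I]])

text \<open>
  A witness of an existential statement exists only locally, on truth values \<open>v\<close> that together cover
  \<open>w\<close>. By the frame law it is enough to reach the fixed goal \<open>\<psi>\<close> from each of them. All case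
  distinctions below take this form: the goal stays, and the stage \<open>w\<close> shrinks.
\<close>

lemma hexE:
  fixes w :: "'o::complete_heyting_algebra"
  assumes "w \<le> (\<^bold>\<exists>x. \<phi> x)" and "\<And>x v. v \<le> w \<Longrightarrow> v \<le> \<phi> x \<Longrightarrow> v \<le> \<psi>"
  shows "w \<le> \<psi>"
proof -
  have "w = inf w (\<^bold>\<exists>x. \<phi> x)"
    using assms(1) by (simp add: inf.absorb1)
  also have "\<dots> = (SUP b\<in>range \<phi>. inf w b)"
    by (rule inf_Sup_frame)
  also have "\<dots> \<le> \<psi>"
  proof (rule SUP_least)
    fix b assume "b \<in> range \<phi>"
    then obtain x where "b = \<phi> x" by blast
    then show "inf w b \<le> \<psi>"
      by (intro assms(2)[of "inf w b" x]) simp_all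
  qed
  finally show ?thesis .
qed

lemma hdisjE:
  fixes w :: "'o::complete_heyting_algebra"
  assumes "w \<le> (p \<^bold>\<or> q)" and "\<And>v. v \<le> w \<Longrightarrow> v \<le> p \<Longrightarrow> v \<le> \<psi>"
    and "\<And>v. v \<le> w \<Longrightarrow> v \<le> q \<Longrightarrow> v \<le> \<psi>"
  shows "w \<le> \<psi>"
proof -
  have "w \<le> (\<^bold>\<exists>b. if b then p else q)"
    using assms(1) by (simp add: UNIV_bool sup_commute)
  then show ?thesis
    by (rule hexE) (auto split: if_splits intro: assms(2,3))
qed

lemma hdisjI1: "(w::'o::complete_heyting_algebra) \<le> p \<Longrightarrow> w \<le> (p \<^bold>\<or> q)"
  by (rule le_supI1)

lemma hdisjI2: "(w::'o::complete_heyting_algebra) \<le> q \<Longrightarrow> w \<le> (p \<^bold>\<or> q)"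
  by (rule le_supI2)

lemma hconjI: "(w::'o::complete_heyting_algebra) \<le> p \<Longrightarrow> w \<le> q \<Longrightarrow> w \<le> (p \<^bold>\<and> q)"
  by simp

lemma le_decided: "b \<Longrightarrow> (w::'o::complete_heyting_algebra) \<le> \<langle>b\<rangle>"
  by (simp add: decided_def)

text \<open>
  Outside the degenerate stage \<open>bot\<close>, which forces everything, a decided proposition that is forced is
  simply true. Arithmetic on rational approximations is thereby ordinary arithmetic.
\<close>

lemma decidedE: "(w::'o::complete_heyting_algebra) \<le> \<langle>b\<rangle> \<Longrightarrow> (b \<Longrightarrow> w \<le> \<psi>) \<Longrightarrow> w \<le> \<psi>"
  by (cases b) (auto simp: decided_def bot_unique)

lemma le_decided_iff: "(w::'o::complete_heyting_algebra) \<le> \<langle>b\<rangle> \<longleftrightarrow> b \<or> w = bot"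
  by (cases b) (auto simp: decided_def bot_unique)

lemma boundedD:
  fixes w :: "'o::complete_heyting_algebra"
  assumes "w \<le> (\<^bold>\<forall>x. D x \<^bold>\<longrightarrow> \<phi> x)" and "v \<le> w" and "v \<le> D a"
  shows "v \<le> \<phi> a"
  using himpD[OF order_trans[OF assms(2) hallD[OF assms(1)]] assms(3)] .

lemma boundedI:
  fixes w :: "'o::complete_heyting_algebra"
  assumes "\<And>x v. v \<le> w \<Longrightarrow> v \<le> D x \<Longrightarrow> v \<le> \<phi> x"
  shows "w \<le> (\<^bold>\<forall>x. D x \<^bold>\<longrightarrow> \<phi> x)"
  by (intro hallI himpI) (rule assms)

lemma hiffI:
  assumes "\<And>v. v \<le> w \<Longrightarrow> v \<le> p \<Longrightarrow> v \<le> q" and "\<And>v. v \<le> w \<Longrightarrow> v \<le> q \<Longrightarrow> v \<le> p"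
  shows "w \<le> (p \<^bold>\<longleftrightarrow> q)"
  unfolding hiff_def by (intro hconjI himpI) (fact assms)+

section \<open>Real numbers as cuts\<close>

lemma is_seq_total: "w \<le> is_seq \<alpha> \<Longrightarrow> w \<le> (\<^bold>\<exists>a. \<alpha> n a)"
  unfolding is_seq_def le_inf_iff by (elim conjE) (rule hallD)

lemma is_seq_unique:
  assumes "w \<le> is_seq \<alpha>" "w \<le> \<alpha> n a" "w \<le> \<alpha> n b"
  shows "w \<le> \<langle>a = b\<rangle>"
proof -
  have "w \<le> (\<^bold>\<forall>n a b. (\<alpha> n a \<^bold>\<and> \<alpha> n b) \<^bold>\<longrightarrow> \<langle>a = b\<rangle>)"
    using assms(1) by (simp only: is_seq_def le_inf_iff)
  from himpD[OF hallD[OF hallD[OF hallD[OF this]]] hconjI[OF assms(2,3)]] show ?thesis .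
qed

lemma is_seqI:
  assumes "\<And>n. w \<le> (\<^bold>\<exists>a. \<alpha> n a)"
    and "\<And>n a b v. v \<le> w \<Longrightarrow> v \<le> \<alpha> n a \<Longrightarrow> v \<le> \<alpha> n b \<Longrightarrow> v \<le> \<langle>a = b\<rangle>"
  shows "w \<le> is_seq \<alpha>"
  unfolding is_seq_def
  by (intro hconjI hallI himpI, rule assms(1), unfold le_inf_iff, elim conjE, rule assms(2))

lemma is_real_seq: "w \<le> is_real x \<Longrightarrow> w \<le> is_seq x"
  by (simp add: is_real_def)

lemma is_real_unique:
  "w \<le> is_real x \<Longrightarrow> w \<le> x n p \<Longrightarrow> w \<le> x n q \<Longrightarrow> (p = q \<Longrightarrow> w \<le> \<psi>) \<Longrightarrow> w \<le> \<psi>"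
  by (rule decidedE[OF is_seq_unique[OF is_real_seq]])

lemma is_real_step:
  assumes "w \<le> is_real x"
  shows "w \<le> (\<^bold>\<exists>p q. x n p \<^bold>\<and> x (Suc n) q \<^bold>\<and>
    \<langle>fst p \<le> fst q \<and> fst q \<le> snd q \<and> snd q \<le> snd p\<rangle>)"
  using assms unfolding is_real_def le_inf_iff by (elim conjE) (rule hallD)

text \<open>
  Successive approximations are nested by one step only, and each step introduces new local witnesses;
  uniqueness of the values glues the steps. This makes approximations at different indices
  comparable, which the definition of \<open>x \<^bold>< y\<close> with its single index requires.
\<close>

lemma is_real_refine:
  assumes "w \<le> is_real x" and "w \<le> x n p" and "n \<le> k"
  shows "w \<le> (\<^bold>\<exists>q. x k q \<^bold>\<and> \<langle>fst p \<le> fst q \<and> fst q \<le> snd q \<and> snd q \<le> snd p\<rangle>)"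
  using assms(3,1,2)
proof (induction k arbitrary: w rule: dec_induct)
  case base
  show ?case
  proof (rule hexE[OF is_real_step[OF base(1), of n]], erule hexE, simp only: le_inf_iff, elim conjE decidedE)
    fix p' q v u
    assume vw: "v \<le> w" "u \<le> v" and u: "u \<le> x n p'"
      and le: "fst p' \<le> fst q" "fst q \<le> snd q" "snd q \<le> snd p'"
    have uw: "u \<le> w" using vw by order
    show "u \<le> (\<^bold>\<exists>q. x n q \<^bold>\<and> \<langle>fst p \<le> fst q \<and> fst q \<le> snd q \<and> snd q \<le> snd p\<rangle>)"
    proof (rule is_real_unique[OF order_trans[OF uw base(1)] u order_trans[OF uw base(2)]])
      assume "p' = p"
      then show ?thesis
        using le u by (intro hexI[of _ _ p]) (simp add: le_decided)
    qed
  qed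
next
  case (step k)
  show ?case
  proof (rule hexE[OF step.IH[OF step.prems]], simp only: le_inf_iff, elim conjE decidedE)
    fix q v
    assume vw: "v \<le> w" and v: "v \<le> x k q"
      and le: "fst p \<le> fst q" "fst q \<le> snd q" "snd q \<le> snd p"
    note xr = order_trans[OF vw step.prems(1)]
    show "v \<le> (\<^bold>\<exists>q. x (Suc k) q \<^bold>\<and> \<langle>fst p \<le> fst q \<and> fst q \<le> snd q \<and> snd q \<le> snd p\<rangle>)"
    proof (rule hexE[OF is_real_step[OF xr, of k]], erule hexE, simp only: le_inf_iff, elim conjE decidedE)
      fix q1 q2 u t
      assume ut: "u \<le> v" "t \<le> u" and t: "t \<le> x k q1" "t \<le> x (Suc k) q2"
        and le2: "fst q1 \<le> fst q2" "fst q2 \<le> snd q2" "snd q2 \<le> snd q1"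
      have tv: "t \<le> v" using ut by order
      show "t \<le> (\<^bold>\<exists>q. x (Suc k) q \<^bold>\<and> \<langle>fst p \<le> fst q \<and> fst q \<le> snd q \<and> snd q \<le> snd p\<rangle>)"
      proof (rule is_real_unique[OF order_trans[OF tv xr] t(1) order_trans[OF tv v]])
        assume "q1 = q"
        then show ?thesis
          using le le2 t by (intro hexI[of _ _ q2]) (simp add: le_decided)
      qed
    qed
  qed
qed

text \<open>
  From here on a real number is used only through the rationals strictly below it, \<open>low r x\<close>, and
  strictly above it, \<open>upp x r\<close>.
\<close>

definition low :: "rat \<Rightarrow> 'o::complete_heyting_algebra real_name \<Rightarrow> 'o" where
  "low r x = (\<^bold>\<exists>n p. x n p \<^bold>\<and> \<langle>r < fst p\<rangle>)"

definition upp :: "'o::complete_heyting_algebra real_name \<Rightarrow> rat \<Rightarrow> 'o" where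
  "upp x r = (\<^bold>\<exists>n p. x n p \<^bold>\<and> \<langle>snd p < r\<rangle>)"

definition ivl :: "rat \<Rightarrow> rat \<Rightarrow> 'o::complete_heyting_algebra real_set" where
  "ivl p q = (\<lambda>z. low p z \<^bold>\<and> upp z q)"

text \<open>
  The distance of \<open>x\<close> and \<open>z\<close> is less than \<open>e\<close>: the first conjunct bounds \<open>x - z\<close>, the second
  \<open>z - x\<close>.
\<close>

definition near :: "'o::complete_heyting_algebra real_name \<Rightarrow> 'o real_name \<Rightarrow> rat \<Rightarrow> 'o" where
  "near x z e = ((\<^bold>\<exists>b c. upp x b \<^bold>\<and> low c z \<^bold>\<and> \<langle>b - c < e\<rangle>) \<^bold>\<and>
                 (\<^bold>\<exists>a d. low a x \<^bold>\<and> upp z d \<^bold>\<and> \<langle>d - a < e\<rangle>))"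

lemma lowI: "w \<le> x n p \<Longrightarrow> r < fst p \<Longrightarrow> w \<le> low r x"
  unfolding low_def by (rule hexI[of _ _ n], rule hexI[of _ _ p]) (simp add: le_decided)

lemma uppI: "w \<le> x n p \<Longrightarrow> snd p < r \<Longrightarrow> w \<le> upp x r"
  unfolding upp_def by (rule hexI[of _ _ n], rule hexI[of _ _ p]) (simp add: le_decided)

lemma lowE:
  assumes "w \<le> low r x" and "\<And>v n p. v \<le> w \<Longrightarrow> v \<le> x n p \<Longrightarrow> r < fst p \<Longrightarrow> v \<le> \<psi>"
  shows "w \<le> \<psi>"
  using assms(1) unfolding low_def
  by - (elim hexE, simp only: le_inf_iff, elim conjE decidedE, meson assms(2) order_trans)

lemma uppE:
  assumes "w \<le> upp x r" and "\<And>v n p. v \<le> w \<Longrightarrow> v \<le> x n p \<Longrightarrow> snd p < r \<Longrightarrow> v \<le> \<psi>"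
  shows "w \<le> \<psi>"
  using assms(1) unfolding upp_def
  by - (elim hexE, simp only: le_inf_iff, elim conjE decidedE, meson assms(2) order_trans)

lemma low_mono: "w \<le> low r x \<Longrightarrow> r' \<le> r \<Longrightarrow> w \<le> low r' x"
  by (erule lowE, erule lowI) simp

lemma upp_mono: "w \<le> upp x r \<Longrightarrow> r \<le> r' \<Longrightarrow> w \<le> upp x r'"
  by (erule uppE, erule uppI) simp

lemma low_openE:
  assumes "w \<le> low r x" and "\<And>v r'. v \<le> w \<Longrightarrow> v \<le> low r' x \<Longrightarrow> r < r' \<Longrightarrow> v \<le> \<psi>"
  shows "w \<le> \<psi>"
proof (rule lowE[OF assms(1)])
  fix v n p assume v: "v \<le> w" "v \<le> x n p" "r < fst p"
  obtain r' where "r < r'" "r' < fst p" using dense[OF v(3)] by blast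
  then show "v \<le> \<psi>" using v by (intro assms(2)) (auto intro: lowI)
qed

lemma upp_openE:
  assumes "w \<le> upp x r" and "\<And>v r'. v \<le> w \<Longrightarrow> v \<le> upp x r' \<Longrightarrow> r' < r \<Longrightarrow> v \<le> \<psi>"
  shows "w \<le> \<psi>"
proof (rule uppE[OF assms(1)])
  fix v n p assume v: "v \<le> w" "v \<le> x n p" "snd p < r"
  obtain r' where "snd p < r'" "r' < r" using dense[OF v(3)] by blast
  then show "v \<le> \<psi>" using v by (intro assms(2)) (auto intro: uppI)
qed

lemma is_real_refineE:
  assumes "w \<le> is_real x" and "w \<le> x n p" and "n \<le> k"
    and "\<And>v q. v \<le> w \<Longrightarrow> v \<le> x k q \<Longrightarrow> fst p \<le> fst q \<Longrightarrow> fst q \<le> snd q \<Longrightarrow> snd q \<le> snd p \<Longrightarrow> v \<le> \<psi>"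
  shows "w \<le> \<psi>"
  using is_real_refine[OF assms(1-3)]
  by (rule hexE, simp only: le_inf_iff, elim conjE decidedE, intro assms(4))

lemma ivl_indexE:
  assumes "w \<le> is_real x" and "w \<le> ivl p q x"
    and "\<And>v n r. v \<le> w \<Longrightarrow> N \<le> n \<Longrightarrow> v \<le> x n r \<Longrightarrow> p < fst r \<Longrightarrow> fst r \<le> snd r \<Longrightarrow> snd r < q \<Longrightarrow> v \<le> \<psi>"
  shows "w \<le> \<psi>"
proof -
  have lu: "w \<le> low p x" "w \<le> upp x q" using assms(2) by (simp_all add: ivl_def)
  show ?thesis
  proof (rule lowE[OF lu(1)])
    fix v n r assume v: "v \<le> w" "v \<le> x n r" "p < fst r"
    show "v \<le> \<psi>"
    proof (rule uppE[OF order_trans[OF v(1) lu(2)]])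
      fix u m s assume u: "u \<le> v" "u \<le> x m s" "snd s < q"
      define k where "k = max N (max n m)"
      have uw: "u \<le> w" using u(1) v(1) by (rule order_trans)
      note xu = order_trans[OF uw assms(1)]
      show "u \<le> \<psi>"
      proof (rule is_real_refineE[OF xu order_trans[OF u(1) v(2)], of k])
        show "n \<le> k" by (simp add: k_def)
        fix t r' assume t: "t \<le> u" "t \<le> x k r'" "fst r \<le> fst r'" "fst r' \<le> snd r'" "snd r' \<le> snd r"
        show "t \<le> \<psi>"
        proof (rule is_real_refineE[OF order_trans[OF t(1) xu] order_trans[OF t(1) u(2)], of k])
          show "m \<le> k" by (simp add: k_def)
          fix t' s' assume t': "t' \<le> t" "t' \<le> x k s'" "fst s \<le> fst s'" "fst s' \<le> snd s'" "snd s' \<le> snd s"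
          have t'u: "t' \<le> u" using t'(1) t(1) by (rule order_trans)
          show "t' \<le> \<psi>"
          proof (rule is_real_unique[OF order_trans[OF t'u xu] t'(2) order_trans[OF t'(1) t(2)]])
            assume "s' = r'"
            then show ?thesis
              using v u t t' by (intro assms(3)[of t' k r'] order_trans[OF t'u uw]) (auto simp: k_def)
          qed
        qed
      qed
    qed
  qed
qed

lemma rat_arch_pow_inv:
  assumes "0 < (e::rat)" and "c < 1"
  shows "\<exists>n. c ^ n < e"
proof -
  have "0 < real_of_rat e" "real_of_rat c < 1" using assms by simp_all
  then obtain n where "real_of_rat c ^ n < real_of_rat e" using real_arch_pow_inv by blast
  then have "c ^ n < e" by (simp flip: of_rat_power add: of_rat_less)
  then show ?thesis ..
qed

lemma locatedE:
  assumes "w \<le> is_real x" and "0 < e"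
    and "\<And>v p q. v \<le> w \<Longrightarrow> v \<le> ivl p q x \<Longrightarrow> q - p < e \<Longrightarrow> v \<le> \<psi>"
  shows "w \<le> \<psi>"
proof -
  obtain m where m: "1 / 2 ^ m < e / 3"
    using rat_arch_pow_inv[of "e / 3" "1 / 2"] assms(2) by (auto simp: power_one_over)
  have "w \<le> (\<^bold>\<forall>m. \<^bold>\<exists>n p. x n p \<^bold>\<and> \<langle>snd p - fst p < 1 / 2 ^ (m::nat)\<rangle>)"
    using assms(1) by (simp only: is_real_def le_inf_iff)
  note A = hallD[OF this, of m]
  show ?thesis
  proof (rule hexE[OF A], erule hexE, simp only: le_inf_iff, elim conjE decidedE)
    fix n v p u assume *: "v \<le> w" "u \<le> v" "u \<le> x n p" "snd p - fst p < 1 / 2 ^ m"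
    show "u \<le> \<psi>"
    proof (rule assms(3)[of u "fst p - e / 3" "snd p + e / 3"])
      show "u \<le> w" using *(2,1) by (rule order_trans)
      show "u \<le> ivl (fst p - e / 3) (snd p + e / 3) x"
        using assms(2) *(3) by (auto simp: ivl_def intro: lowI uppI)
    qed (use * m in simp)
  qed
qed

lemma low_uppE:
  assumes "w \<le> is_real x" and "w \<le> low r x" and "w \<le> upp x s" and "r < s \<Longrightarrow> w \<le> \<psi>"
  shows "w \<le> \<psi>"
proof -
  have *: "w \<le> ivl r s x" using assms by (simp add: ivl_def)
  have "w \<le> \<langle>r < s\<rangle>"
    by (rule ivl_indexE[OF assms(1) *, of 0]) (rule le_decided, simp)
  then show ?thesis using assms(4) by (rule decidedE)
qed

text \<open>
  The constructive substitute for trichotomy: an approximation of \<open>x\<close> shorter than \<open>s - r\<close> cannot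
  contain both \<open>r\<close> and \<open>s\<close> in its interior.
\<close>

lemma cotransE:
  assumes "w \<le> is_real x" and "r < s"
    and "\<And>v. v \<le> w \<Longrightarrow> v \<le> low r x \<Longrightarrow> v \<le> \<psi>"
    and "\<And>v. v \<le> w \<Longrightarrow> v \<le> upp x s \<Longrightarrow> v \<le> \<psi>"
  shows "w \<le> \<psi>"
proof (rule locatedE[OF assms(1), of "s - r"])
  fix v p q assume v: "v \<le> w" "v \<le> ivl p q x" "q - p < s - r"
  show "v \<le> \<psi>"
  proof (cases "r \<le> p")
    case True
    then show ?thesis using v by (intro assms(3)) (auto simp: ivl_def intro: low_mono)
  next
    case False
    then show ?thesis using v by (intro assms(4)) (auto simp: ivl_def intro: upp_mono)
  qed
qed (use assms(2) in simp)

lemma rlessE: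
  assumes "w \<le> (x \<^bold>< y)" and "\<And>v r. v \<le> w \<Longrightarrow> v \<le> upp x r \<Longrightarrow> v \<le> low r y \<Longrightarrow> v \<le> \<psi>"
  shows "w \<le> \<psi>"
  using assms(1) unfolding rless_def
proof (rule hexE, elim hexE, simp only: le_inf_iff, elim conjE decidedE)
  fix n v p u q t
  assume *: "v \<le> w" "u \<le> v" "t \<le> u" "t \<le> x n p" "t \<le> y n q" "snd p < fst q"
  obtain r where "snd p < r" "r < fst q" using dense[OF *(6)] by blast
  then show "t \<le> \<psi>"
    using * by (intro assms(2)[of t r]) (auto intro: uppI lowI)
qed

lemma rlessI:
  assumes "w \<le> is_real x" and "w \<le> is_real y" and "w \<le> upp x r" and "w \<le> low r y"
  shows "w \<le> (x \<^bold>< y)"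
proof (rule uppE[OF assms(3)])
  fix v n p assume v: "v \<le> w" "v \<le> x n p" "snd p < r"
  show "v \<le> (x \<^bold>< y)"
  proof (rule lowE[OF order_trans[OF v(1) assms(4)]])
    fix u m q assume u: "u \<le> v" "u \<le> y m q" "r < fst q"
    define k where "k = max n m"
    have uw: "u \<le> w" using u(1) v(1) by (rule order_trans)
    show "u \<le> (x \<^bold>< y)"
    proof (rule is_real_refineE[OF order_trans[OF uw assms(1)] order_trans[OF u(1) v(2)], of k])
      show "n \<le> k" by (simp add: k_def)
      fix t p' assume t: "t \<le> u" "t \<le> x k p'" "snd p' \<le> snd p"
      have tw: "t \<le> w" using t(1) uw by (rule order_trans)
      show "t \<le> (x \<^bold>< y)"
      proof (rule is_real_refineE[OF order_trans[OF tw assms(2)] order_trans[OF t(1) u(2)], of k])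
        show "m \<le> k" by (simp add: k_def)
        fix s q' assume s: "s \<le> t" "s \<le> y k q'" "fst q \<le> fst q'"
        show "s \<le> (x \<^bold>< y)"
          unfolding rless_def
          using order_trans[OF s(1) t(2)] s v u t
          by (intro hexI[of _ _ k] hexI[of _ _ p'] hexI[of _ _ q']) (auto simp: le_decided)
      qed
    qed
  qed
qed

lemma nearI:
  assumes "w \<le> ivl a b x" and "w \<le> ivl c d z" and "b - c < e" and "d - a < e"
  shows "w \<le> near x z e"
  using assms unfolding near_def ivl_def
  by (intro hconjI, intro hexI[of _ _ b] hexI[of _ _ c], simp add: le_decided,
      intro hexI[of _ _ a] hexI[of _ _ d], simp add: le_decided)

lemma nearE:
  assumes "w \<le> near x z e"
    and "\<And>v a b c d. v \<le> w \<Longrightarrow> v \<le> ivl a b x \<Longrightarrow> v \<le> ivl c d z \<Longrightarrow> b - c < e \<Longrightarrow> d - a < e \<Longrightarrow> v \<le> \<psi>"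
  shows "w \<le> \<psi>"
proof -
  have n: "w \<le> (\<^bold>\<exists>b c. upp x b \<^bold>\<and> low c z \<^bold>\<and> \<langle>b - c < e\<rangle>)"
    "w \<le> (\<^bold>\<exists>a d. low a x \<^bold>\<and> upp z d \<^bold>\<and> \<langle>d - a < e\<rangle>)"
    using assms(1) by (simp_all only: near_def le_inf_iff)
  show ?thesis
  proof (rule hexE[OF n(1)], erule hexE, simp only: le_inf_iff, elim conjE decidedE)
    fix b v c u assume u: "v \<le> w" "u \<le> v" "u \<le> upp x b" "u \<le> low c z" "b - c < e"
    have uw: "u \<le> w" using u(2,1) by (rule order_trans)
    show "u \<le> \<psi>"
    proof (rule hexE[OF order_trans[OF uw n(2)]], erule hexE, simp only: le_inf_iff, elim conjE decidedE)
      fix a t d s assume s: "t \<le> u" "s \<le> t" "s \<le> low a x" "s \<le> upp z d" "d - a < e"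
      have su: "s \<le> u" using s(2,1) by (rule order_trans)
      show "s \<le> \<psi>"
        using s u order_trans[OF su uw] order_trans[OF su u(3)] order_trans[OF su u(4)]
        by (intro assms(2)[of s a b c d]) (simp_all add: ivl_def)
    qed
  qed
qed

lemma ivlD: "w \<le> ivl p q x \<Longrightarrow> w \<le> low p x" "w \<le> ivl p q x \<Longrightarrow> w \<le> upp x q"
  by (simp_all add: ivl_def)

lemma ivlI: "w \<le> low p x \<Longrightarrow> w \<le> upp x q \<Longrightarrow> w \<le> ivl p q x"
  by (simp add: ivl_def)

lemma ivl_mono: "w \<le> ivl p q x \<Longrightarrow> p' \<le> p \<Longrightarrow> q \<le> q' \<Longrightarrow> w \<le> ivl p' q' x"
  by (auto simp: ivl_def intro: low_mono upp_mono)

lemma ivl_openE: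
  assumes "w \<le> ivl p q x"
    and "\<And>v p' q'. v \<le> w \<Longrightarrow> v \<le> ivl p' q' x \<Longrightarrow> p < p' \<Longrightarrow> q' < q \<Longrightarrow> v \<le> \<psi>"
  shows "w \<le> \<psi>"
proof (rule low_openE[OF ivlD(1)[OF assms(1)]])
  fix v p' assume v: "v \<le> w" "v \<le> low p' x" "p < p'"
  show "v \<le> \<psi>"
  proof (rule upp_openE[OF order_trans[OF v(1) ivlD(2)[OF assms(1)]]])
    fix u q' assume u: "u \<le> v" "u \<le> upp x q'" "q' < q"
    show "u \<le> \<psi>"
      using v(3) u order_trans[OF u(1) v(1)] order_trans[OF u(1) v(2)]
      by (intro assms(2)[of u p' q'] ivlI)
  qed
qed

lemma near_mono: "w \<le> near x z e \<Longrightarrow> e \<le> e' \<Longrightarrow> w \<le> near x z e'"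
  by (erule nearE, erule nearI) auto

lemma near_sym: "w \<le> near x z e \<Longrightarrow> w \<le> near z x e"
  by (erule nearE, erule nearI) auto

lemma near_ivl: "w \<le> ivl p q x \<Longrightarrow> w \<le> ivl p q z \<Longrightarrow> q - p < e \<Longrightarrow> w \<le> near x z e"
  by (erule nearI)

lemma near_refl: "w \<le> is_real x \<Longrightarrow> 0 < e \<Longrightarrow> w \<le> near x x e"
  by (erule locatedE, assumption) (rule near_ivl)

lemma near_shift:
  assumes "w \<le> is_real x" and "w \<le> near x y e" and "w \<le> ivl p q x" and "w \<le> ivl p q x'"
    and "q - p \<le> d"
  shows "w \<le> near x' y (e + d)"
proof (rule nearE[OF assms(2)])
  fix v a b c s assume v: "v \<le> w" "v \<le> ivl a b x" "v \<le> ivl c s y" "b - c < e" "s - a < e"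
  note pq = order_trans[OF v(1) assms(3)] order_trans[OF v(1) assms(4)]
  show "v \<le> near x' y (e + d)"
  proof (rule low_uppE[OF order_trans[OF v(1) assms(1)] ivlD(1)[OF pq(1)] ivlD(2)[OF v(2)]])
    assume "p < b"
    show ?thesis
    proof (rule low_uppE[OF order_trans[OF v(1) assms(1)] ivlD(1)[OF v(2)] ivlD(2)[OF pq(1)]])
      assume "a < q"
      then show ?thesis
        using \<open>p < b\<close> assms(5) v(4,5) by (intro nearI[OF pq(2) v(3)]) auto
    qed
  qed
qed

lemma near_indexE:
  assumes "w \<le> is_real x" and "w \<le> is_real z" and "w \<le> near x z e"
    and "\<And>v n p q. v \<le> w \<Longrightarrow> v \<le> x n p \<Longrightarrow> v \<le> z n q \<Longrightarrow> snd q - fst p < e \<Longrightarrow> snd p - fst q < e \<Longrightarrow> v \<le> \<psi>"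
  shows "w \<le> \<psi>"
proof (rule nearE[OF assms(3)])
  fix v a b c d assume v: "v \<le> w" "v \<le> ivl a b x" "v \<le> ivl c d z" "b - c < e" "d - a < e"
  show "v \<le> \<psi>"
  proof (rule ivl_indexE[OF order_trans[OF v(1) assms(1)] v(2), of 0])
    fix u n p assume u: "u \<le> v" "u \<le> x n p" "a < fst p" "snd p < b"
    have uw: "u \<le> w" using u(1) v(1) by (rule order_trans)
    show "u \<le> \<psi>"
    proof (rule ivl_indexE[OF order_trans[OF uw assms(2)] order_trans[OF u(1) v(3)], of n])
      fix t m q assume t: "t \<le> u" "n \<le> m" "t \<le> z m q" "c < fst q" "snd q < d"
      have tw: "t \<le> w" using t(1) uw by (rule order_trans)
      show "t \<le> \<psi>"
      proof (rule is_real_refineE[OF order_trans[OF tw assms(1)] order_trans[OF t(1) u(2)] t(2)])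
        fix s p' assume s: "s \<le> t" "s \<le> x m p'" "fst p \<le> fst p'" "snd p' \<le> snd p"
        show "s \<le> \<psi>"
          using order_trans[OF s(1) tw] order_trans[OF s(1) t(3)] s u(3,4) t(4,5) v(4,5)
          by (intro assms(4)[of s m p' q]) auto
      qed
    qed
  qed
qed

lemma nearI_index:
  assumes "w \<le> x n p" and "w \<le> z n q" and "snd q - fst p < e" and "snd p - fst q < e"
  shows "w \<le> near x z e"
proof -
  define d where "d = min (e - (snd q - fst p)) (e - (snd p - fst q)) / 3"
  have "0 < d" using assms(3,4) by (simp add: d_def)
  moreover have "3 * d \<le> e - (snd q - fst p)" "3 * d \<le> e - (snd p - fst q)"
    by (simp_all add: d_def)
  ultimately show ?thesis
    by (intro nearI[of w "fst p - d" "snd p + d" x "fst q - d" "snd q + d"])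
      (use assms(1,2) in \<open>auto intro!: ivlI intro: lowI uppI\<close>)
qed

text \<open>
  Prenex form for the nested existential quantifiers in the definitions of the arithmetic operations.
\<close>

lemma hex_conj:
  fixes p :: "'o::complete_heyting_algebra"
  shows "((\<^bold>\<exists>x. \<phi> x) \<^bold>\<and> p) = (\<^bold>\<exists>x. \<phi> x \<^bold>\<and> p)" and "(p \<^bold>\<and> (\<^bold>\<exists>x. \<phi> x)) = (\<^bold>\<exists>x. p \<^bold>\<and> \<phi> x)"
  by (simp_all add: inf_commute[of "Sup _"] inf_Sup_frame image_image inf_commute[of p])

lemma near_iff:
  assumes "w \<le> is_real x" and "w \<le> is_real z"
  shows "w \<le> (rabs (x \<^bold>- z) \<^bold>< dyadic n) \<longleftrightarrow> w \<le> near x z (1 / 2 ^ n)"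
proof
  assume "w \<le> (rabs (x \<^bold>- z) \<^bold>< dyadic n)"
  then show "w \<le> near x z (1 / 2 ^ n)"
    unfolding rless_def rabs_def rminus_def radd_def rneg_def dyadic_def rconst_def hex_conj
    by - ((elim hexE, simp only: le_inf_iff, elim conjE decidedE,
        rule nearI_index[of _ x _ _ z], assumption+); simp)
next
  assume *: "w \<le> near x z (1 / 2 ^ n)"
  show "w \<le> (rabs (x \<^bold>- z) \<^bold>< dyadic n)"
  proof (rule near_indexE[OF assms *])
    fix v k p q
    assume h: "v \<le> w" "v \<le> x k p" "v \<le> z k q" "snd q - fst p < 1 / 2 ^ n" "snd p - fst q < 1 / 2 ^ n"
    define b :: "rat \<times> rat" where "b = (- snd q, - fst q)"
    define a where "a = (fst p + fst b, snd p + snd b)"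
    define c where "c = (max 0 (max (fst a) (- snd a)), max (- fst a) (snd a))"
    show "v \<le> (rabs (x \<^bold>- z) \<^bold>< dyadic n)"
      unfolding rless_def rabs_def rminus_def radd_def rneg_def dyadic_def rconst_def hex_conj
      by (rule hexI[of _ _ k], rule hexI[of _ _ c], rule hexI[of _ _ "(1 / 2 ^ n, 1 / 2 ^ n)"],
          rule hexI[of _ _ a], rule hexI[of _ _ p], rule hexI[of _ _ b], rule hexI[of _ _ q])
        (use h in \<open>simp add: le_decided a_def b_def c_def\<close>)
  qed
qed

lemma ball_near:
  assumes "w \<le> is_real x" and "w \<le> is_real z" and "w \<le> near x z (1 / 2 ^ n)"
  shows "w \<le> open_interval (x \<^bold>- dyadic n) (x \<^bold>+ dyadic n) z"
proof (rule near_indexE[OF assms])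
  fix v k p q
  assume h: "v \<le> w" "v \<le> x k p" "v \<le> z k q" "snd q - fst p < 1 / 2 ^ n" "snd p - fst q < 1 / 2 ^ n"
  define e :: "rat \<times> rat" where "e = (1 / 2 ^ n, 1 / 2 ^ n)"
  define e' :: "rat \<times> rat" where "e' = (- snd e, - fst e)"
  define a where "a = (fst p + fst e', snd p + snd e')"
  define b where "b = (fst p + fst e, snd p + snd e)"
  have "v \<le> ((x \<^bold>- dyadic n) \<^bold>< z)"
    unfolding rless_def rminus_def radd_def rneg_def dyadic_def rconst_def hex_conj
    by (rule hexI[of _ _ k], rule hexI[of _ _ a], rule hexI[of _ _ q],
        rule hexI[of _ _ p], rule hexI[of _ _ e'], rule hexI[of _ _ e])
      (use h in \<open>simp add: le_decided a_def e'_def e_def\<close>)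
  moreover have "v \<le> (z \<^bold>< (x \<^bold>+ dyadic n))"
    unfolding rless_def radd_def dyadic_def rconst_def hex_conj
    by (rule hexI[of _ _ k], rule hexI[of _ _ q], rule hexI[of _ _ b],
        rule hexI[of _ _ p], rule hexI[of _ _ e])
      (use h in \<open>simp add: le_decided b_def e_def\<close>)
  ultimately show "v \<le> open_interval (x \<^bold>- dyadic n) (x \<^bold>+ dyadic n) z"
    by (simp add: open_interval_def)
qed

text \<open>
  Two approximations of length below \<open>e / 2\<close> either are disjoint or lie within an interval shorter
  than \<open>e\<close>.
\<close>

lemma near_or_apartE:
  assumes "w \<le> is_real x" and "w \<le> is_real y" and "0 < e"
    and "\<And>v. v \<le> w \<Longrightarrow> v \<le> near x y e \<Longrightarrow> v \<le> \<psi>"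
    and "\<And>v. v \<le> w \<Longrightarrow> v \<le> (x \<^bold># y) \<Longrightarrow> v \<le> \<psi>"
  shows "w \<le> \<psi>"
proof (rule locatedE[OF assms(1), of "e / 2"])
  fix v a b assume v: "v \<le> w" "v \<le> ivl a b x" "b - a < e / 2"
  note vx = order_trans[OF v(1) assms(1)] order_trans[OF v(1) assms(2)]
  show "v \<le> \<psi>"
  proof (rule locatedE[OF vx(2), of "e / 2"])
    fix u c d assume u: "u \<le> v" "u \<le> ivl c d y" "d - c < e / 2"
    have uw: "u \<le> w" using u(1) v(1) by (rule order_trans)
    note ux = order_trans[OF u(1) vx(1)] order_trans[OF u(1) vx(2)]
    note ab = order_trans[OF u(1) v(2)]
    consider "b < c" | "d < a" | "c \<le> b" "a \<le> d" by linarith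
    then show "u \<le> \<psi>"
    proof cases
      case 1
      then have "u \<le> (x \<^bold>< y)"
        using ivlD(2)[OF ab] ivlD(1)[OF u(2)] by (intro rlessI[OF ux, of c]) (auto intro: upp_mono)
      then show ?thesis by (intro assms(5)[OF uw]) (simp add: apart_def le_supI1)
    next
      case 2
      then have "u \<le> (y \<^bold>< x)"
        using ivlD(1)[OF ab] ivlD(2)[OF u(2)] by (intro rlessI[OF ux(2,1), of a]) (auto intro: upp_mono)
      then show ?thesis by (intro assms(5)[OF uw]) (simp add: apart_def le_supI2)
    next
      case 3
      then show ?thesis
        using v(3) u(3) by (intro assms(4)[OF uw] nearI[OF ab u(2)]) auto
    qed
  qed (use assms(3) in simp)
qed (use assms(3) in simp)

lemma apartE:
  assumes "w \<le> (x \<^bold># y)"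
    and "\<And>v r. v \<le> w \<Longrightarrow> v \<le> upp x r \<Longrightarrow> v \<le> low r y \<Longrightarrow> v \<le> \<psi>"
    and "\<And>v r. v \<le> w \<Longrightarrow> v \<le> upp y r \<Longrightarrow> v \<le> low r x \<Longrightarrow> v \<le> \<psi>"
  shows "w \<le> \<psi>"
proof (rule hdisjE[OF assms(1)[unfolded apart_def]])
  fix v assume v: "v \<le> w" "v \<le> (x \<^bold>< y)"
  show "v \<le> \<psi>" by (rule rlessE[OF v(2)], rule assms(2)[OF order_trans[OF _ v(1)]])
next
  fix v assume v: "v \<le> w" "v \<le> (y \<^bold>< x)"
  show "v \<le> \<psi>" by (rule rlessE[OF v(2)], rule assms(3)[OF order_trans[OF _ v(1)]])
qed

lemma apartI1:
  "w \<le> is_real x \<Longrightarrow> w \<le> is_real y \<Longrightarrow> w \<le> upp x r \<Longrightarrow> w \<le> low r y \<Longrightarrow> w \<le> (x \<^bold># y)"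
  by (simp add: apart_def rlessI le_supI1)

lemma apartI2:
  "w \<le> is_real x \<Longrightarrow> w \<le> is_real y \<Longrightarrow> w \<le> upp y r \<Longrightarrow> w \<le> low r x \<Longrightarrow> w \<le> (x \<^bold># y)"
  by (simp add: apart_def rlessI le_supI2)

lemma same_seqD:
  assumes "w \<le> same_seq \<alpha> \<beta>" and "w \<le> \<alpha> n a"
  shows "w \<le> \<beta> n a"
proof -
  note hallD[OF assms(1)[unfolded same_seq_def], of n]
  from hallD[OF this, of a] show ?thesis using assms(2) unfolding hiff_def by (auto intro: himpD)
qed

lemma same_seq_low:
  assumes "w \<le> same_seq x y" and "w \<le> low r x" shows "w \<le> low r y"
proof (rule lowE[OF assms(2)])
  fix v n p assume v: "v \<le> w" "v \<le> x n p" "r < fst p"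
  show "v \<le> low r y" using same_seqD[OF order_trans[OF v(1) assms(1)] v(2)] v(3) by (rule lowI)
qed

lemma same_seq_upp:
  assumes "w \<le> same_seq x y" and "w \<le> upp x r" shows "w \<le> upp y r"
proof (rule uppE[OF assms(2)])
  fix v n p assume v: "v \<le> w" "v \<le> x n p" "snd p < r"
  show "v \<le> upp y r" using same_seqD[OF order_trans[OF v(1) assms(1)] v(2)] v(3) by (rule uppI)
qed

lemma same_seq_ivl: "w \<le> same_seq x y \<Longrightarrow> w \<le> ivl p q x \<Longrightarrow> w \<le> ivl p q y"
  by (simp add: ivl_def same_seq_low same_seq_upp)

lemma same_seq_near:
  assumes "w \<le> same_seq x y" and "w \<le> near x z e" shows "w \<le> near y z e"
  by (rule nearE[OF assms(2)], rule nearI[OF same_seq_ivl[OF order_trans[OF _ assms(1)]]])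

lemma is_real_rconst: "w \<le> is_real (rconst r)"
proof -
  have "top \<le> is_real (rconst r :: 'a real_name)"
    unfolding is_real_def is_seq_def
    apply (intro hconjI hallI himpI)
    subgoal by (rule hexI[of _ _ "(r, r)"]) (simp add: rconst_def decided_def)
    subgoal by (simp add: rconst_def decided_def split: if_splits)
    subgoal by (rule hexI[of _ _ "(r, r)"], rule hexI[of _ _ "(r, r)"]) (simp add: rconst_def decided_def)
    subgoal by (rule hexI[of _ _ 0], rule hexI[of _ _ "(r, r)"]) (simp add: rconst_def decided_def)
    done
  then show ?thesis using order_trans[OF top_greatest] by blast
qed

lemma ivl_rconst: "p < r \<Longrightarrow> r < q \<Longrightarrow> w \<le> ivl p q (rconst r)"
  by (intro ivlI lowI[of _ _ 0 "(r, r)"] uppI[of _ _ 0 "(r, r)"]) (simp_all add: rconst_def decided_def)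

lemma is_real_rpi: "w \<le> is_real rpi"
proof -
  define f :: "nat \<Rightarrow> rat" where "f n = of_int \<lfloor>2 ^ n * pi\<rfloor> / 2 ^ n" for n
  define g :: "nat \<Rightarrow> rat" where "g n = of_int (\<lfloor>2 ^ n * pi\<rfloor> + 1) / 2 ^ n" for n
  have g: "g n = f n + 1 / 2 ^ n" for n by (simp add: f_def g_def add_divide_distrib)
  have fl: "2 * \<lfloor>2 ^ n * pi\<rfloor> \<le> \<lfloor>2 ^ Suc n * pi\<rfloor>" "\<lfloor>2 ^ Suc n * pi\<rfloor> + 1 \<le> 2 * (\<lfloor>2 ^ n * pi\<rfloor> + 1)" for n
    by (simp_all add: le_floor_iff) linarith+
  have f_step: "f n \<le> f (Suc n)" for n
  proof -
    have "rat_of_int (2 * \<lfloor>2 ^ n * pi\<rfloor>) \<le> of_int \<lfloor>2 ^ Suc n * pi\<rfloor>"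
      using fl(1)[of n] by (simp only: of_int_le_iff)
    then show ?thesis by (simp add: f_def field_simps)
  qed
  have g_step: "g (Suc n) \<le> g n" for n
  proof -
    have "rat_of_int (\<lfloor>2 ^ Suc n * pi\<rfloor> + 1) \<le> of_int (2 * (\<lfloor>2 ^ n * pi\<rfloor> + 1))"
      using fl(2)[of n] by (simp only: of_int_le_iff)
    then have "2 ^ n * rat_of_int (\<lfloor>2 ^ Suc n * pi\<rfloor> + 1) \<le> 2 ^ n * of_int (2 * (\<lfloor>2 ^ n * pi\<rfloor> + 1))"
      by (intro mult_left_mono) simp_all
    then show ?thesis by (simp add: g_def field_simps)
  qed
  have rpi: "rpi = (\<lambda>n p. \<langle>p = (f n, g n)\<rangle> :: 'a)" by (simp add: rpi_def f_def g_def)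
  have "top \<le> is_real (rpi :: 'a real_name)"
    unfolding is_real_def is_seq_def
    apply (intro hconjI hallI himpI)
    subgoal for n by (rule hexI[of _ _ "(f n, g n)"]) (simp add: rpi decided_def)
    subgoal by (simp add: rpi decided_def split: if_splits)
    subgoal for n
      using f_step[of n] g_step[of n]
      by (intro hexI[of _ _ "(f n, g n)"] hexI[of _ _ "(f (Suc n), g (Suc n))"]) (simp add: rpi decided_def g)
    subgoal for m
      by (rule hexI[of _ _ "Suc m"], rule hexI[of _ _ "(f (Suc m), g (Suc m))"])
        (simp add: rpi decided_def g field_simps)
    done
  then show ?thesis using order_trans[OF top_greatest] by blast
qed

lemma is_real_rneg:
  assumes "w \<le> is_real x" shows "w \<le> is_real (rneg x)"
  unfolding is_real_def
proof (intro hconjI is_seqI hallI)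
  have neg: "v \<le> x n p \<Longrightarrow> v \<le> rneg x n (- snd p, - fst p)" for v n p
    unfolding rneg_def by (rule hexI[of _ _ p]) (simp add: le_decided)
  {
    fix n show "w \<le> (\<^bold>\<exists>c. rneg x n c)"
      by (rule hexE[OF is_seq_total[OF is_real_seq[OF assms], of n]]) (rule hexI, rule neg)
  next
    fix n a b v assume *: "v \<le> w" "v \<le> rneg x n a" "v \<le> rneg x n b"
    from *(2) show "v \<le> \<langle>a = b\<rangle>"
      unfolding rneg_def
    proof (rule hexE, simp only: le_inf_iff, elim conjE decidedE)
      fix p u assume u: "u \<le> v" "u \<le> x n p" "a = (- snd p, - fst p)"
      from order_trans[OF u(1) *(3)] show "u \<le> \<langle>a = b\<rangle>"
        unfolding rneg_def
      proof (rule hexE, simp only: le_inf_iff, elim conjE decidedE)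
        fix q t assume t: "t \<le> u" "t \<le> x n q" "b = (- snd q, - fst q)"
        have "t \<le> w" using t(1) u(1) *(1) by order
        from this assms have "t \<le> is_real x" by (rule order_trans)
        then show "t \<le> \<langle>a = b\<rangle>"
          using order_trans[OF t(1) u(2)] t(2)
          by (rule is_real_unique) (simp add: le_decided u(3) t(3))
      qed
    qed
  next
    fix n show "w \<le> (\<^bold>\<exists>p q. rneg x n p \<^bold>\<and> rneg x (Suc n) q \<^bold>\<and>
        \<langle>fst p \<le> fst q \<and> fst q \<le> snd q \<and> snd q \<le> snd p\<rangle>)"
    proof (rule hexE[OF is_real_step[OF assms, of n]], erule hexE, simp only: le_inf_iff, elim conjE decidedE)
      fix p v q u assume "u \<le> x n p" "u \<le> x (Suc n) q" "fst p \<le> fst q" "fst q \<le> snd q" "snd q \<le> snd p"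
      then show "u \<le> (\<^bold>\<exists>p q. rneg x n p \<^bold>\<and> rneg x (Suc n) q \<^bold>\<and>
          \<langle>fst p \<le> fst q \<and> fst q \<le> snd q \<and> snd q \<le> snd p\<rangle>)"
        by (intro hexI[of _ _ "(- snd p, - fst p)"] hexI[of _ _ "(- snd q, - fst q)"] hconjI neg le_decided) auto
    qed
  next
    fix m
    have "w \<le> (\<^bold>\<forall>m. \<^bold>\<exists>n p. x n p \<^bold>\<and> \<langle>snd p - fst p < 1 / 2 ^ (m::nat)\<rangle>)"
      using assms by (simp only: is_real_def le_inf_iff)
    note A = hallD[OF this, of m]
    show "w \<le> (\<^bold>\<exists>n p. rneg x n p \<^bold>\<and> \<langle>snd p - fst p < 1 / 2 ^ m\<rangle>)"
    proof (rule hexE[OF A], erule hexE, simp only: le_inf_iff, elim conjE decidedE)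
      fix n v p u assume "u \<le> x n p" "snd p - fst p < 1 / 2 ^ m"
      then show "u \<le> (\<^bold>\<exists>n p. rneg x n p \<^bold>\<and> \<langle>snd p - fst p < 1 / 2 ^ m\<rangle>)"
        by (intro hexI[of _ _ n] hexI[of _ _ "(- snd p, - fst p)"] hconjI neg le_decided) auto
    qed
  }
qed

section \<open>Ideals of sets of real numbers\<close>

lemma subset_ofI:
  "(\<And>v x. v \<le> w \<Longrightarrow> v \<le> is_real x \<Longrightarrow> v \<le> X x \<Longrightarrow> v \<le> Y x) \<Longrightarrow> w \<le> (X \<^bold>\<subseteq> Y)"
  unfolding subset_of_def by (rule boundedI, rule himpI) (meson order_trans)

lemma subset_ofD:
  "w \<le> (X \<^bold>\<subseteq> Y) \<Longrightarrow> v \<le> w \<Longrightarrow> v \<le> is_real x \<Longrightarrow> v \<le> X x \<Longrightarrow> v \<le> Y x"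
  unfolding subset_of_def
  by (rule himpD, rule boundedD[where a = x and \<phi> = "\<lambda>x. X x \<^bold>\<longrightarrow> Y x"])

text \<open>
  Both parts of the theorem that pass from points to a whole interval concern a property \<open>J\<close> of sets
  that is inherited by subsets and by countable unions. The stage \<open>w\<close> is kept as a parameter, because
  one of the two is known to be an ideal only at stages where \<open>G\<close> is a set of real numbers.
\<close>

definition sigma_ideal :: "'o::complete_heyting_algebra \<Rightarrow> ('o real_set \<Rightarrow> 'o) \<Rightarrow> bool" where
  "sigma_ideal w J \<longleftrightarrow> w \<le> J (\<lambda>_. bot)
    \<and> (\<forall>v S T. v \<le> w \<longrightarrow> v \<le> (S \<^bold>\<subseteq> T) \<longrightarrow> v \<le> J T \<longrightarrow> v \<le> J S)
    \<and> (\<forall>v S. v \<le> w \<longrightarrow> (\<forall>n. v \<le> J (S n)) \<longrightarrow> v \<le> J (Union_seq S))"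

lemma sigma_ideal_empty: "sigma_ideal w J \<Longrightarrow> v \<le> w \<Longrightarrow> v \<le> J (\<lambda>_. bot)"
  by (simp add: sigma_ideal_def order_trans[of v w])

lemma sigma_ideal_mono:
  assumes "sigma_ideal w J" and "v \<le> w" and "v \<le> J T" and "v \<le> (S \<^bold>\<subseteq> T)"
  shows "v \<le> J S"
proof -
  have "\<forall>v S T. v \<le> w \<longrightarrow> v \<le> (S \<^bold>\<subseteq> T) \<longrightarrow> v \<le> J T \<longrightarrow> v \<le> J S"
    using assms(1) unfolding sigma_ideal_def by (elim conjE)
  from this[rule_format, OF assms(2,4,3)] show ?thesis .
qed

lemma sigma_ideal_Union:
  assumes "sigma_ideal w J" and "v \<le> w" and "\<And>n. v \<le> J (S n)"
  shows "v \<le> J (Union_seq S)"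
proof -
  have "\<forall>v S. v \<le> w \<longrightarrow> (\<forall>n. v \<le> J (S n)) \<longrightarrow> v \<le> J (Union_seq S)"
    using assms(1) unfolding sigma_ideal_def by (elim conjE)
  from this[rule_format, OF assms(2,3)] show ?thesis .
qed

lemma sigma_ideal_Un:
  assumes "sigma_ideal w J" and "v \<le> w" and "v \<le> J A" and "v \<le> J B"
  shows "v \<le> J (A \<^bold>\<union> B)"
proof (rule sigma_ideal_mono[OF assms(1,2)])
  show "v \<le> J (Union_seq (\<lambda>n. if n = 0 then A else B))"
    using assms(3,4) by (intro sigma_ideal_Union[OF assms(1,2)]) auto
  show "v \<le> ((A \<^bold>\<union> B) \<^bold>\<subseteq> Union_seq (\<lambda>n. if n = 0 then A else B))"
  proof (rule subset_ofI)
    fix u x assume "u \<le> v" "u \<le> is_real x" "u \<le> (A \<^bold>\<union> B) x"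
    from this(3)[unfolded set_union_def]
    show "u \<le> Union_seq (\<lambda>n. if n = 0 then A else B) x"
      unfolding Union_seq_def
      by (rule hdisjE) (rule hexI[of _ _ 0], simp, rule hexI[of _ _ "Suc 0"], simp)
  qed
qed

lemma sigma_ideal_le:
  assumes "sigma_ideal w J" and "v \<le> w"
  shows "sigma_ideal v J"
  unfolding sigma_ideal_def
proof (intro conjI allI impI)
  show "v \<le> J (\<lambda>_. bot)" using assms by (rule sigma_ideal_empty)
next
  fix u S T assume "u \<le> v" "u \<le> (S \<^bold>\<subseteq> T)" "u \<le> J T"
  then show "u \<le> J S" by - (rule sigma_ideal_mono[OF assms(1) order_trans[OF _ assms(2)]])
next
  fix u and S :: "nat \<Rightarrow> _" assume "u \<le> v" "\<forall>n. u \<le> J (S n)"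
  then show "u \<le> J (Union_seq S)" by - (rule sigma_ideal_Union[OF assms(1) order_trans[OF _ assms(2)]], simp_all)
qed

text \<open>
  The points with a rational neighbourhood in \<open>J\<close>. For \<open>J = (\<lambda>S. S \<^bold>\<subseteq> H)\<close> these are the inner points
  of \<open>H\<close>.
\<close>

definition locally :: "('o::complete_heyting_algebra real_set \<Rightarrow> 'o) \<Rightarrow> 'o real_set" where
  "locally J = (\<lambda>x. \<^bold>\<exists>a b. ivl a b x \<^bold>\<and> J (ivl a b))"

lemma locallyI: "w \<le> ivl a b x \<Longrightarrow> w \<le> J (ivl a b) \<Longrightarrow> w \<le> locally J x"
  unfolding locally_def by (rule hexI[of _ _ a], rule hexI[of _ _ b]) simp

lemma locallyE:
  assumes "w \<le> locally J x"
    and "\<And>v a b. v \<le> w \<Longrightarrow> v \<le> ivl a b x \<Longrightarrow> v \<le> J (ivl a b) \<Longrightarrow> v \<le> \<psi>"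
  shows "w \<le> \<psi>"
proof (rule hexE[OF assms(1)[unfolded locally_def]], erule hexE, simp only: le_inf_iff, elim conjE)
  fix a v b u assume "v \<le> w" "u \<le> v" "u \<le> ivl a b x" "u \<le> J (ivl a b)"
  then show "u \<le> \<psi>" by (intro assms(2)[of u a b] order_trans[of u v w])
qed

text \<open>
  The closed interval, described negatively: its elements cannot in general be compared with the end
  points, but by cotransitivity they lie above every rational smaller than \<open>p\<close> and below every
  rational larger than \<open>q\<close>.
\<close>

definition cl :: "rat \<Rightarrow> rat \<Rightarrow> 'o::complete_heyting_algebra real_set" where
  "cl p q = (\<lambda>z. (\<^bold>\<not> upp z p) \<^bold>\<and> (\<^bold>\<not> low q z))"

lemma cl_low:
  assumes "w \<le> is_real x" and "w \<le> cl p q x" and "r < p"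
  shows "w \<le> low r x"
proof (rule cotransE[OF assms(1,3)])
  fix v assume v: "v \<le> w" "v \<le> upp x p"
  have "v \<le> (\<^bold>\<not> upp x p)" using order_trans[OF v(1) assms(2)] by (simp add: cl_def)
  then show "v \<le> low r x" using v(2) by (rule hnegE)
qed

lemma cl_upp:
  assumes "w \<le> is_real x" and "w \<le> cl p q x" and "q < r"
  shows "w \<le> upp x r"
proof (rule cotransE[OF assms(1,3)])
  fix v assume v: "v \<le> w" "v \<le> low q x"
  have "v \<le> (\<^bold>\<not> low q x)" using order_trans[OF v(1) assms(2)] by (simp add: cl_def)
  then show "v \<le> upp x r" using v(2) by (rule hnegE)
qed

section \<open>Compactness\<close>

text \<open>
  Binary sequences code points of an interval by repeatedly keeping its left or its right two thirds. The
  two parts overlap, so that by cotransitivity every real number of the interval lies in one of them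
  locally.
\<close>

fun piece :: "rat \<times> rat \<Rightarrow> bool list \<Rightarrow> rat \<times> rat" where
  "piece (a, b) [] = (a, b)"
| "piece (a, b) (False # s) = piece (a, (a + 2 * b) / 3) s"
| "piece (a, b) (True # s) = piece ((2 * a + b) / 3, b) s"

lemma piece_append: "piece I (s @ t) = piece (piece I s) t"
  by (induction I s rule: piece.induct) auto

lemma piece_width: "snd (piece I s) - fst (piece I s) = (2 / 3) ^ length s * (snd I - fst I)"
  by (induction I s rule: piece.induct) (auto simp: field_simps)

lemma piece_bounds:
  "fst I < snd I \<Longrightarrow> fst I \<le> fst (piece I s) \<and> fst (piece I s) < snd (piece I s) \<and> snd (piece I s) \<le> snd I"
proof (induction I s rule: piece.induct)
  case (2 a b s)
  have "fst (a, (a + 2 * b) / 3) < snd (a, (a + 2 * b) / 3)" "(a + 2 * b) / 3 \<le> b" using 2 by auto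
  then show ?case using 2(1) by (auto simp del: fst_conv snd_conv) (auto simp: field_simps)
next
  case (3 a b s)
  have "fst ((2 * a + b) / 3, b) < snd ((2 * a + b) / 3, b)" "a \<le> (2 * a + b) / 3" using 3 by auto
  then show ?case using 3(1) by (auto simp del: fst_conv snd_conv) (auto simp: field_simps)
qed auto

definition branch :: "('o::complete_heyting_algebra, bool) seq_name \<Rightarrow> bool list \<Rightarrow> 'o" where
  "branch \<alpha> s = (\<^bold>\<forall>i. \<langle>i < length s\<rangle> \<^bold>\<longrightarrow> \<alpha> i (s ! i))"

lemma branchD: "w \<le> branch \<alpha> s \<Longrightarrow> i < length s \<Longrightarrow> w \<le> \<alpha> i (s ! i)"
  unfolding branch_def by (erule boundedD) (simp_all add: le_decided)

lemma branchI: "(\<And>i. i < length s \<Longrightarrow> w \<le> \<alpha> i (s ! i)) \<Longrightarrow> w \<le> branch \<alpha> s"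
  unfolding branch_def by (intro boundedI) (erule decidedE, blast intro: order_trans)

lemma branch_uniqueE:
  assumes "w \<le> is_seq \<alpha>" and "w \<le> branch \<alpha> s" and "w \<le> branch \<alpha> t" and "length s \<le> length t"
    and "s = take (length s) t \<Longrightarrow> w \<le> \<psi>"
  shows "w \<le> \<psi>"
proof (cases "s = take (length s) t")
  case False
  then obtain i where i: "i < length s" "s ! i \<noteq> t ! i"
    using assms(4) by (auto simp: list_eq_iff_nth_eq)
  have "w \<le> \<langle>s ! i = t ! i\<rangle>"
    using assms(1) branchD[OF assms(2) i(1)]
    by (rule is_seq_unique) (rule branchD[OF assms(3)], use i(1) assms(4) in simp)
  then show ?thesis by (rule decidedE) (use i in simp)
qed (use assms(5) in simp)

lemma branch_existsE:
  assumes "w \<le> is_seq \<alpha>"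
    and "\<And>v s. v \<le> w \<Longrightarrow> v \<le> branch \<alpha> s \<Longrightarrow> length s = n \<Longrightarrow> v \<le> \<psi>"
  shows "w \<le> \<psi>"
  using assms
proof (induction n arbitrary: \<psi>)
  case 0
  show ?case by (rule 0(2)[OF order_refl, of "[]"]) (rule branchI, simp_all)
next
  case (Suc n)
  show ?case
  proof (rule Suc.IH[OF Suc.prems(1)])
    fix v s assume v: "v \<le> w" "v \<le> branch \<alpha> s" "length s = n"
    show "v \<le> \<psi>"
    proof (rule hexE[OF is_seq_total[OF order_trans[OF v(1) Suc.prems(1)], of n]])
      fix b u assume u: "u \<le> v" "u \<le> \<alpha> n b"
      show "u \<le> \<psi>"
      proof (rule Suc.prems(2))
        show "u \<le> w" using u(1) v(1) by (rule order_trans)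
        show "u \<le> branch \<alpha> (s @ [b])"
        proof (rule branchI)
          fix i assume "i < length (s @ [b])"
          then consider "i < length s" | "i = length s" by fastforce
          then show "u \<le> \<alpha> i ((s @ [b]) ! i)"
            by cases (use u v branchD[OF order_trans[OF u(1) v(2)]] in \<open>auto simp: nth_append\<close>)
        qed
      qed (simp add: v(3))
    qed
  qed
qed

text \<open>
  The point coded by an internal binary sequence. Its approximations are read off from the initial parts
  of the sequence as a relation, so that no choice is involved.
\<close>

definition branch_real :: "rat \<times> rat \<Rightarrow> ('o::complete_heyting_algebra, bool) seq_name \<Rightarrow> 'o real_name" where
  "branch_real I \<alpha> = (\<lambda>n c. \<^bold>\<exists>s. branch \<alpha> s \<^bold>\<and> \<langle>length s = n \<and> c = piece I s\<rangle>)"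

lemma branch_realI: "w \<le> branch \<alpha> s \<Longrightarrow> length s = n \<Longrightarrow> w \<le> branch_real I \<alpha> n (piece I s)"
  unfolding branch_real_def by (rule hexI[of _ _ s]) (simp add: le_decided)

lemma branch_realE:
  assumes "w \<le> branch_real I \<alpha> n c"
    and "\<And>v s. v \<le> w \<Longrightarrow> v \<le> branch \<alpha> s \<Longrightarrow> length s = n \<Longrightarrow> c = piece I s \<Longrightarrow> v \<le> \<psi>"
  shows "w \<le> \<psi>"
  using assms(1) unfolding branch_real_def
  by - (elim hexE, simp only: le_inf_iff, elim conjE decidedE, rule assms(2))

lemma is_real_branch_real:
  assumes "w \<le> is_seq \<alpha>" and "fst I < snd I"
  shows "w \<le> is_real (branch_real I \<alpha>)"
  unfolding is_real_def
proof (intro hconjI is_seqI hallI)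
  fix n show "w \<le> (\<^bold>\<exists>c. branch_real I \<alpha> n c)"
    by (rule branch_existsE[OF assms(1), of n], rule hexI, rule branch_realI)
next
  fix n a b v assume v: "v \<le> w" "v \<le> branch_real I \<alpha> n a" "v \<le> branch_real I \<alpha> n b"
  show "v \<le> \<langle>a = b\<rangle>"
  proof (rule branch_realE[OF v(2)])
    fix u s assume u: "u \<le> v" "u \<le> branch \<alpha> s" "length s = n" "a = piece I s"
    show "u \<le> \<langle>a = b\<rangle>"
    proof (rule branch_realE[OF order_trans[OF u(1) v(3)]])
      fix t r assume t: "t \<le> u" "t \<le> branch \<alpha> r" "length r = n" "b = piece I r"
      have "t \<le> w" using t(1) u(1) v(1) by order
      from order_trans[OF this assms(1)] order_trans[OF t(1) u(2)] t(2) show "t \<le> \<langle>a = b\<rangle>"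
        by (rule branch_uniqueE) (use u(3,4) t(3,4) in \<open>auto intro: le_decided\<close>)
    qed
  qed
next
  fix n
  show "w \<le> (\<^bold>\<exists>p q. branch_real I \<alpha> n p \<^bold>\<and> branch_real I \<alpha> (Suc n) q \<^bold>\<and>
      \<langle>fst p \<le> fst q \<and> fst q \<le> snd q \<and> snd q \<le> snd p\<rangle>)"
  proof (rule branch_existsE[OF assms(1), of "Suc n"])
    fix v s assume v: "v \<le> w" "v \<le> branch \<alpha> s" "length s = Suc n"
    have "v \<le> branch \<alpha> (take n s)"
      by (rule branchI) (use branchD[OF v(2)] v(3) in auto)
    moreover have "s = take n s @ drop n s" by simp
    then have "piece I s = piece (piece I (take n s)) (drop n s)" by (metis piece_append)
    ultimately show "v \<le> (\<^bold>\<exists>p q. branch_real I \<alpha> n p \<^bold>\<and> branch_real I \<alpha> (Suc n) q \<^bold>\<and>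
        \<langle>fst p \<le> fst q \<and> fst q \<le> snd q \<and> snd q \<le> snd p\<rangle>)"
      using v piece_bounds[OF assms(2), of "take n s"] piece_bounds[of "piece I (take n s)" "drop n s"]
      by (intro hexI[of _ _ "piece I (take n s)"] hexI[of _ _ "piece I s"] hconjI branch_realI le_decided) auto
  qed
next
  fix m
  have "0 < 1 / 2 ^ m / (snd I - fst I)" using assms(2) by simp
  from rat_arch_pow_inv[OF this, of "2 / 3"] obtain n where "(2 / 3) ^ n < 1 / 2 ^ m / (snd I - fst I)" by auto
  then have n: "(2 / 3) ^ n * (snd I - fst I) < 1 / 2 ^ m" using assms(2) by (simp add: field_simps)
  show "w \<le> (\<^bold>\<exists>n p. branch_real I \<alpha> n p \<^bold>\<and> \<langle>snd p - fst p < 1 / 2 ^ m\<rangle>)"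
  proof (rule branch_existsE[OF assms(1), of n])
    fix v s assume v: "v \<le> w" "v \<le> branch \<alpha> s" "length s = n"
    then show "v \<le> (\<^bold>\<exists>n p. branch_real I \<alpha> n p \<^bold>\<and> \<langle>snd p - fst p < 1 / 2 ^ m\<rangle>)"
      using n by (intro hexI[of _ _ n] hexI[of _ _ "piece I s"] hconjI branch_realI le_decided) (simp_all only: piece_width)
  qed
qed

lemma branch_real_cl:
  assumes "a < b"
  shows "w \<le> cl a b (branch_real (a, b) \<alpha>)"
  unfolding cl_def
proof (intro hconjI hnegI)
  fix v assume "v \<le> upp (branch_real (a, b) \<alpha>) a"
  then show "v \<le> bot"
  proof (rule uppE)
    fix u n p assume u: "u \<le> branch_real (a, b) \<alpha> n p" "snd p < a"
    from u(1) show "u \<le> bot"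
    proof (rule branch_realE)
      fix v s assume "p = piece (a, b) s"
      then show "v \<le> bot" using u(2) assms piece_bounds[of "(a, b)" s] by simp
    qed
  qed
next
  fix v assume "v \<le> low b (branch_real (a, b) \<alpha>)"
  then show "v \<le> bot"
  proof (rule lowE)
    fix u n p assume u: "u \<le> branch_real (a, b) \<alpha> n p" "b < fst p"
    from u(1) show "u \<le> bot"
    proof (rule branch_realE)
      fix v s assume "p = piece (a, b) s"
      then show "v \<le> bot" using u(2) assms piece_bounds[of "(a, b)" s] by simp
    qed
  qed
qed

text \<open>
  A finite set of finite sequences is an external object. Whether it is a bar for a sequence given
  externally is decided, so unless the stage is degenerate it is a bar in the ordinary sense.
\<close>

lemma decided_bar:
  assumes "w \<le> is_bar (\<lambda>s. \<langle>s \<in> set F\<rangle>)" and "w \<noteq> bot"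
  shows "\<exists>s\<in>set F. \<forall>i<length s. s ! i = (\<alpha> i :: bool)"
proof (rule ccontr)
  assume none: "\<not> ?thesis"
  have "w \<le> is_seq (\<lambda>n b. \<langle>b = \<alpha> n\<rangle>)"
  proof (rule is_seqI)
    fix n show "w \<le> (\<^bold>\<exists>a. \<langle>a = \<alpha> n\<rangle>)" by (rule hexI[of _ _ "\<alpha> n"]) (simp add: le_decided)
  next
    fix n a b v assume "v \<le> \<langle>a = \<alpha> n\<rangle>" "v \<le> \<langle>b = \<alpha> n\<rangle>"
    then show "v \<le> \<langle>a = b\<rangle>" by (elim decidedE) (simp add: le_decided)
  qed
  from boundedD[where D = is_seq, OF assms(1)[unfolded is_bar_def] order_refl this]
  have "w \<le> (\<^bold>\<exists>s. branch (\<lambda>n b. \<langle>b = \<alpha> n\<rangle>) s \<^bold>\<and> \<langle>s \<in> set F\<rangle>)" by (simp only: branch_def)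
  then have "w \<le> bot"
  proof (rule hexE, simp only: le_inf_iff, elim conjE decidedE)
    fix s v assume s: "v \<le> branch (\<lambda>n b. \<langle>b = \<alpha> n\<rangle>) s" "s \<in> set F"
    then obtain i where i: "i < length s" "s ! i \<noteq> \<alpha> i" using none by blast
    show "v \<le> bot" using branchD[OF s(1) i(1)] by (rule decidedE) (use i in simp)
  qed
  then show False using assms(2) by (simp add: bot_unique)
qed

text \<open>
  Backward induction from the maximal length of the sequences in the bar; a sequence of that length
  extends a member of the bar.
\<close>

lemma finite_bar_induct:
  assumes bar: "\<And>\<alpha>. \<exists>s\<in>set F. \<forall>i<length s. s ! i = (\<alpha> i :: bool)"
    and base: "\<And>s t. s \<in> set F \<Longrightarrow> P (s @ t)"
    and step: "\<And>s. P (s @ [False]) \<Longrightarrow> P (s @ [True]) \<Longrightarrow> P s"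
  shows "P []"
proof -
  define N where "N = Max (length ` set F)"
  have "length s + k = N \<Longrightarrow> P s" for k s
  proof (induction k arbitrary: s)
    case 0
    obtain t where t: "t \<in> set F" "\<forall>i<length t. t ! i = (i < length s \<and> s ! i)"
      using bar[of "\<lambda>i. i < length s \<and> s ! i"] by blast
    have len: "length t \<le> length s" using 0 t(1) by (simp add: N_def)
    then have "take (length t) s = t" using t(2) by (intro nth_equalityI) auto
    then show ?case using base[OF t(1), of "drop (length t) s"] by (metis append_take_drop_id)
  next
    case (Suc k)
    show ?case by (rule step; rule Suc.IH; use Suc.prems in simp)
  qed
  from this[of "[]" N] show ?thesis by simp
qed

text \<open>
  The finite sequences whose piece belongs to \<open>J\<close> form a bar, because the coded point has a neighbourhood
  in \<open>J\<close> which contains all sufficiently small pieces around it. The fan theorem makes the bar finite,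
  and membership in \<open>J\<close> is carried back to the root by binary unions of overlapping pieces.
\<close>

lemma compactness:
  fixes w :: "'o::complete_heyting_algebra"
  assumes fan: "\<Turnstile> fan_theorem TYPE('o)"
    and J: "sigma_ideal w J"
    and loc: "w \<le> (cl a b \<^bold>\<subseteq> locally J)"
  shows "w \<le> J (ivl a b)"
proof (cases "a < b")
  case True
  define B where "B s = J (ivl (fst (piece (a, b) s)) (snd (piece (a, b) s)))" for s
  have "w \<le> is_bar B"
    unfolding is_bar_def branch_def[symmetric]
  proof (rule boundedI)
    fix \<alpha> :: "('o, bool) seq_name" and v assume v: "v \<le> w" "v \<le> is_seq \<alpha>"
    let ?x = "branch_real (a, b) \<alpha>"
    have x: "v \<le> is_real ?x" using v(2) True by (simp add: is_real_branch_real)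
    from subset_ofD[OF loc v(1) x branch_real_cl[OF True]]
    show "v \<le> (\<^bold>\<exists>s. branch \<alpha> s \<^bold>\<and> B s)"
    proof (rule locallyE)
      fix u p q assume u: "u \<le> v" "u \<le> ivl p q ?x" "u \<le> J (ivl p q)"
      show "u \<le> (\<^bold>\<exists>s. branch \<alpha> s \<^bold>\<and> B s)"
      proof (rule ivl_indexE[OF order_trans[OF u(1) x] u(2), of 0])
        fix t n r assume t: "t \<le> u" "t \<le> ?x n r" "p < fst r" "snd r < q"
        from t(2) show "t \<le> (\<^bold>\<exists>s. branch \<alpha> s \<^bold>\<and> B s)"
        proof (rule branch_realE)
          fix v' s assume s: "v' \<le> t" "v' \<le> branch \<alpha> s" "r = piece (a, b) s"
          have v': "v' \<le> u" using s(1) t(1) by (rule order_trans)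
          have "v' \<le> B s" unfolding B_def
          proof (rule sigma_ideal_mono[OF J])
            show "v' \<le> w" using v' u(1) v(1) by order
            show "v' \<le> J (ivl p q)" using v' u(3) by (rule order_trans)
            show "v' \<le> (ivl (fst (piece (a, b) s)) (snd (piece (a, b) s)) \<^bold>\<subseteq> ivl p q)"
              using t(3,4) s(3) by (intro subset_ofI) (auto elim: ivl_mono)
          qed
          then show "v' \<le> (\<^bold>\<exists>s. branch \<alpha> s \<^bold>\<and> B s)"
            using s(2) by (intro hexI[of _ _ s]) simp
        qed
      qed
    qed
  qed
  moreover have "w \<le> fan_theorem TYPE('o)" using fan by (simp add: valid_def)
  ultimately have "w \<le> (\<^bold>\<exists>F. (\<^bold>\<forall>s. \<langle>s \<in> set F\<rangle> \<^bold>\<longrightarrow> B s) \<^bold>\<and> is_bar (\<lambda>s. \<langle>s \<in> set F\<rangle> :: 'o))"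
    unfolding fan_theorem_def by (rule boundedD[rotated 2, OF _ _ order_refl])
  then show ?thesis
  proof (rule hexE, simp only: le_inf_iff, elim conjE)
    fix F v assume v: "v \<le> w" "v \<le> (\<^bold>\<forall>s. \<langle>s \<in> set F\<rangle> \<^bold>\<longrightarrow> B s)" "v \<le> is_bar (\<lambda>s. \<langle>s \<in> set F\<rangle>)"
    show "v \<le> J (ivl a b)"
    proof (cases "v = bot")
      case False
      have "v \<le> B []"
      proof (rule finite_bar_induct[where P = "\<lambda>s. v \<le> B s"])
        show "\<exists>s\<in>set F. \<forall>i<length s. s ! i = \<alpha> i" for \<alpha>
          using v(3) False by (rule decided_bar)
      next
        fix s t assume "s \<in> set F"
        then have "v \<le> B s" by (intro boundedD[OF v(2) order_refl]) (simp add: le_decided)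
        then show "v \<le> B (s @ t)"
          unfolding B_def
        proof (rule sigma_ideal_mono[OF J v(1)], intro subset_ofI)
          fix u x assume "u \<le> ivl (fst (piece (a, b) (s @ t))) (snd (piece (a, b) (s @ t))) x"
          then show "u \<le> ivl (fst (piece (a, b) s)) (snd (piece (a, b) s)) x"
            by (rule ivl_mono)
              (use True piece_bounds[of "(a, b)" s] piece_bounds[of "piece (a, b) s" t]
                in \<open>simp_all add: piece_append\<close>)
        qed
      next
        fix s assume s: "v \<le> B (s @ [False])" "v \<le> B (s @ [True])"
        obtain c d where cd: "piece (a, b) s = (c, d)" by fastforce
        then have "c < d" using True piece_bounds[of "(a, b)" s] by simp
        then have lt: "(2 * c + d) / 3 < (c + 2 * d) / 3" by simp
        have "v \<le> J (ivl c ((c + 2 * d) / 3) \<^bold>\<union> ivl ((2 * c + d) / 3) d)"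
          using s by (intro sigma_ideal_Un[OF J v(1)]) (simp_all add: B_def piece_append cd)
        then have "v \<le> J (ivl c d)"
        proof (rule sigma_ideal_mono[OF J v(1)], intro subset_ofI)
          fix u x assume u: "u \<le> is_real x" "u \<le> ivl c d x"
          from u(1) lt show "u \<le> (ivl c ((c + 2 * d) / 3) \<^bold>\<union> ivl ((2 * c + d) / 3) d) x"
            unfolding set_union_def
          proof (rule cotransE)
            fix t assume t: "t \<le> u" "t \<le> low ((2 * c + d) / 3) x"
            from t(2) ivlD(2)[OF order_trans[OF t(1) u(2)]]
            show "t \<le> (ivl c ((c + 2 * d) / 3) x \<^bold>\<or> ivl ((2 * c + d) / 3) d x)"
              by (intro hdisjI2 ivlI)
          next
            fix t assume t: "t \<le> u" "t \<le> upp x ((c + 2 * d) / 3)"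
            from ivlD(1)[OF order_trans[OF t(1) u(2)]] t(2)
            show "t \<le> (ivl c ((c + 2 * d) / 3) x \<^bold>\<or> ivl ((2 * c + d) / 3) d x)"
              by (intro hdisjI1 ivlI)
          qed
        qed
        then show "v \<le> B s" by (simp add: B_def cd)
      qed
      then show ?thesis by (simp add: B_def)
    qed simp
  qed
next
  case False
  show ?thesis
  proof (rule sigma_ideal_mono[OF J order_refl])
    show "w \<le> J (\<lambda>_. bot)" using J order_refl by (rule sigma_ideal_empty)
    show "w \<le> (ivl a b \<^bold>\<subseteq> (\<lambda>_. bot))"
    proof (rule subset_ofI)
      fix v x assume v: "v \<le> is_real x" "v \<le> ivl a b x"
      from v(1) ivlD[OF v(2)] show "v \<le> bot"
        by (rule low_uppE) (use False in simp)
    qed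
  qed
qed

section \<open>From local to global on intervals\<close>

text \<open>
  A possible lower end of an interval, given by the rationals above it: an upward closed, open and
  located set of rationals. Such ends are closed under taking the larger of two of them, which yields
  the ends of the two halves of a punctured ball without maxima of real numbers. An upper end is
  described by the negatives of the rationals below it.
\<close>

definition lower_end :: "'o::complete_heyting_algebra \<Rightarrow> (rat \<Rightarrow> 'o) \<Rightarrow> bool" where
  "lower_end w L \<longleftrightarrow>
    (\<forall>v p p'. v \<le> w \<longrightarrow> v \<le> L p \<longrightarrow> p \<le> p' \<longrightarrow> v \<le> L p')
    \<and> (\<forall>v p. v \<le> w \<longrightarrow> v \<le> L p \<longrightarrow> v \<le> (\<^bold>\<exists>p'. L p' \<^bold>\<and> \<langle>p' < p\<rangle>))
    \<and> (\<forall>d>0. w \<le> (\<^bold>\<exists>p. L p \<^bold>\<and> (\<^bold>\<forall>p'. L p' \<^bold>\<longrightarrow> \<langle>p < p' + d\<rangle>)))"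

lemma lower_end_mono: "lower_end w L \<Longrightarrow> v \<le> w \<Longrightarrow> v \<le> L p \<Longrightarrow> p \<le> p' \<Longrightarrow> v \<le> L p'"
  unfolding lower_end_def by (elim conjE) simp

lemma lower_end_openE:
  assumes "lower_end w L" and "v \<le> w" and "v \<le> L p"
    and "\<And>u p'. u \<le> v \<Longrightarrow> u \<le> L p' \<Longrightarrow> p' < p \<Longrightarrow> u \<le> \<psi>"
  shows "v \<le> \<psi>"
proof -
  have "v \<le> (\<^bold>\<exists>p'. L p' \<^bold>\<and> \<langle>p' < p\<rangle>)"
    using assms(1-3) unfolding lower_end_def by (elim conjE) simp
  then show ?thesis
    by - (erule hexE, simp only: le_inf_iff, elim conjE decidedE, rule assms(4))
qed

lemma lower_end_locatedE:
  assumes "lower_end w L" and "v \<le> w" and "0 < d"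
    and "\<And>u p. u \<le> v \<Longrightarrow> u \<le> L p \<Longrightarrow> u \<le> (\<^bold>\<forall>p'. L p' \<^bold>\<longrightarrow> \<langle>p < p' + d\<rangle>) \<Longrightarrow> u \<le> \<psi>"
  shows "v \<le> \<psi>"
proof -
  have "w \<le> (\<^bold>\<exists>p. L p \<^bold>\<and> (\<^bold>\<forall>p'. L p' \<^bold>\<longrightarrow> \<langle>p < p' + d\<rangle>))"
    using assms(1,3) unfolding lower_end_def by (elim conjE) simp
  with assms(2) have "v \<le> (\<^bold>\<exists>p. L p \<^bold>\<and> (\<^bold>\<forall>p'. L p' \<^bold>\<longrightarrow> \<langle>p < p' + d\<rangle>))" by (rule order_trans)
  then show ?thesis
  proof (rule hexE)
    fix p u assume u: "u \<le> v" "u \<le> (L p \<^bold>\<and> (\<^bold>\<forall>p'. L p' \<^bold>\<longrightarrow> \<langle>p < p' + d\<rangle>))"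
    then have "u \<le> L p" "u \<le> (\<^bold>\<forall>p'. L p' \<^bold>\<longrightarrow> \<langle>p < p' + d\<rangle>)"
      by (simp_all only: le_inf_iff)
    with u(1) show "u \<le> \<psi>" by (rule assms(4))
  qed
qed

lemma lower_end_upp:
  assumes "w \<le> is_real x"
  shows "lower_end w (\<lambda>p. upp x (p + e))"
  unfolding lower_end_def
proof (intro conjI allI impI)
  fix v p p' assume "v \<le> upp x (p + e)" "p \<le> p'"
  then show "v \<le> upp x (p' + e)" by (rule upp_mono[OF _ add_right_mono])
next
  fix v p assume "v \<le> upp x (p + e)"
  then show "v \<le> (\<^bold>\<exists>p'. upp x (p' + e) \<^bold>\<and> \<langle>p' < p\<rangle>)"
  proof (rule upp_openE)
    fix u r assume "u \<le> upp x r" "r < p + e"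
    then show "u \<le> (\<^bold>\<exists>p'. upp x (p' + e) \<^bold>\<and> \<langle>p' < p\<rangle>)"
      by - (rule hexI[of _ _ "r - e"], simp add: le_decided)
  qed
next
  fix d :: rat assume "0 < d"
  with assms show "w \<le> (\<^bold>\<exists>p. upp x (p + e) \<^bold>\<and> (\<^bold>\<forall>p'. upp x (p' + e) \<^bold>\<longrightarrow> \<langle>p < p' + d\<rangle>))"
  proof (rule locatedE)
    fix v a b assume v: "v \<le> w" "v \<le> ivl a b x" "b - a < d"
    have "v \<le> (\<^bold>\<forall>p'. upp x (p' + e) \<^bold>\<longrightarrow> \<langle>b - e < p' + d\<rangle>)"
    proof (rule boundedI)
      fix p u assume u: "u \<le> v" "u \<le> upp x (p + e)"
      from order_trans[OF u(1) order_trans[OF v(1) assms]] order_trans[OF u(1) ivlD(1)[OF v(2)]] u(2)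
      show "u \<le> \<langle>b - e < p + d\<rangle>"
        by (rule low_uppE) (rule le_decided, use v(3) in simp)
    qed
    then show "v \<le> (\<^bold>\<exists>p. upp x (p + e) \<^bold>\<and> (\<^bold>\<forall>p'. upp x (p' + e) \<^bold>\<longrightarrow> \<langle>p < p' + d\<rangle>))"
      using ivlD(2)[OF v(2)] by - (rule hexI[of _ _ "b - e"], simp)
  qed
qed

lemma lower_end_low:
  assumes "w \<le> is_real x"
  shows "lower_end w (\<lambda>p. low (- p - e) x)"
  unfolding lower_end_def
proof (intro conjI allI impI)
  fix v p p' assume *: "v \<le> low (- p - e) x" "p \<le> p'"
  show "v \<le> low (- p' - e) x" by (rule low_mono[OF *(1)]) (use *(2) in simp)
next
  fix v p assume "v \<le> low (- p - e) x"
  then show "v \<le> (\<^bold>\<exists>p'. low (- p' - e) x \<^bold>\<and> \<langle>p' < p\<rangle>)"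
  proof (rule low_openE)
    fix u r assume "u \<le> low r x" "- p - e < r"
    then show "u \<le> (\<^bold>\<exists>p'. low (- p' - e) x \<^bold>\<and> \<langle>p' < p\<rangle>)"
      by - (rule hexI[of _ _ "- r - e"], simp add: le_decided)
  qed
next
  fix d :: rat assume "0 < d"
  with assms show "w \<le> (\<^bold>\<exists>p. low (- p - e) x \<^bold>\<and> (\<^bold>\<forall>p'. low (- p' - e) x \<^bold>\<longrightarrow> \<langle>p < p' + d\<rangle>))"
  proof (rule locatedE)
    fix v a b assume v: "v \<le> w" "v \<le> ivl a b x" "b - a < d"
    have "v \<le> (\<^bold>\<forall>p'. low (- p' - e) x \<^bold>\<longrightarrow> \<langle>- a - e < p' + d\<rangle>)"
    proof (rule boundedI)
      fix p u assume u: "u \<le> v" "u \<le> low (- p - e) x"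
      from order_trans[OF u(1) order_trans[OF v(1) assms]] u(2) order_trans[OF u(1) ivlD(2)[OF v(2)]]
      show "u \<le> \<langle>- a - e < p + d\<rangle>"
        by (rule low_uppE) (rule le_decided, use v(3) in simp)
    qed
    then show "v \<le> (\<^bold>\<exists>p. low (- p - e) x \<^bold>\<and> (\<^bold>\<forall>p'. low (- p' - e) x \<^bold>\<longrightarrow> \<langle>p < p' + d\<rangle>))"
      using ivlD(1)[OF v(2)] by - (rule hexI[of _ _ "- a - e"], simp)
  qed
qed

lemma lower_end_conj:
  assumes "lower_end w L" and "lower_end w M"
  shows "lower_end w (\<lambda>p. L p \<^bold>\<and> M p)"
  unfolding lower_end_def
proof (intro conjI allI impI)
  fix v p p' assume v: "v \<le> w" "v \<le> (L p \<^bold>\<and> M p)" "p \<le> p'"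
  then have "v \<le> L p" "v \<le> M p" by simp_all
  then show "v \<le> (L p' \<^bold>\<and> M p')"
    using lower_end_mono[OF assms(1) v(1) _ v(3)] lower_end_mono[OF assms(2) v(1) _ v(3)] by simp
next
  fix v p assume v: "v \<le> w" "v \<le> (L p \<^bold>\<and> M p)"
  then have LM: "v \<le> L p" "v \<le> M p" by simp_all
  show "v \<le> (\<^bold>\<exists>p'. (L p' \<^bold>\<and> M p') \<^bold>\<and> \<langle>p' < p\<rangle>)"
  proof (rule lower_end_openE[OF assms(1) v(1) LM(1)])
    fix u a assume u: "u \<le> v" "u \<le> L a" "a < p"
    have uw: "u \<le> w" using u(1) v(1) by (rule order_trans)
    show "u \<le> (\<^bold>\<exists>p'. (L p' \<^bold>\<and> M p') \<^bold>\<and> \<langle>p' < p\<rangle>)"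
    proof (rule lower_end_openE[OF assms(2) uw order_trans[OF u(1) LM(2)]])
      fix t b assume t: "t \<le> u" "t \<le> M b" "b < p"
      have tw: "t \<le> w" using t(1) uw by (rule order_trans)
      have "t \<le> L (max a b)" "t \<le> M (max a b)"
        by (rule lower_end_mono[OF assms(1) tw order_trans[OF t(1) u(2)]], simp)
          (rule lower_end_mono[OF assms(2) tw t(2)], simp)
      then show "t \<le> (\<^bold>\<exists>p'. (L p' \<^bold>\<and> M p') \<^bold>\<and> \<langle>p' < p\<rangle>)"
        using u(3) t(3) by - (rule hexI[of _ _ "max a b"], simp add: le_decided)
    qed
  qed
next
  fix d :: rat assume d: "0 < d"
  show "w \<le> (\<^bold>\<exists>p. (L p \<^bold>\<and> M p) \<^bold>\<and> (\<^bold>\<forall>p'. (L p' \<^bold>\<and> M p') \<^bold>\<longrightarrow> \<langle>p < p' + d\<rangle>))"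
  proof (rule lower_end_locatedE[OF assms(1) order_refl d])
    fix u a assume u: "u \<le> w" "u \<le> L a" "u \<le> (\<^bold>\<forall>p'. L p' \<^bold>\<longrightarrow> \<langle>a < p' + d\<rangle>)"
    show "u \<le> (\<^bold>\<exists>p. (L p \<^bold>\<and> M p) \<^bold>\<and> (\<^bold>\<forall>p'. (L p' \<^bold>\<and> M p') \<^bold>\<longrightarrow> \<langle>p < p' + d\<rangle>))"
    proof (rule lower_end_locatedE[OF assms(2) u(1) d])
      fix t b assume t: "t \<le> u" "t \<le> M b" "t \<le> (\<^bold>\<forall>p'. M p' \<^bold>\<longrightarrow> \<langle>b < p' + d\<rangle>)"
      have tw: "t \<le> w" using t(1) u(1) by (rule order_trans)
      have LM: "t \<le> L (max a b)" "t \<le> M (max a b)"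
        by (rule lower_end_mono[OF assms(1) tw order_trans[OF t(1) u(2)]], simp)
          (rule lower_end_mono[OF assms(2) tw t(2)], simp)
      have "t \<le> (\<^bold>\<forall>p'. (L p' \<^bold>\<and> M p') \<^bold>\<longrightarrow> \<langle>max a b < p' + d\<rangle>)"
      proof (rule boundedI)
        fix p s assume s: "s \<le> t" "s \<le> (L p \<^bold>\<and> M p)"
        then have "s \<le> L p" "s \<le> M p" by simp_all
        have "s \<le> \<langle>a < p + d\<rangle>"
          using u(3) order_trans[OF s(1) t(1)] \<open>s \<le> L p\<close> by (rule boundedD)
        moreover have "s \<le> \<langle>b < p + d\<rangle>"
          using t(3) s(1) \<open>s \<le> M p\<close> by (rule boundedD)
        ultimately show "s \<le> \<langle>max a b < p + d\<rangle>" by (auto simp: le_decided_iff)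
      qed
      with LM show "t \<le> (\<^bold>\<exists>p. (L p \<^bold>\<and> M p) \<^bold>\<and> (\<^bold>\<forall>p'. (L p' \<^bold>\<and> M p') \<^bold>\<longrightarrow> \<langle>p < p' + d\<rangle>))"
        by - (rule hexI[of _ _ "max a b"], simp)
    qed
  qed
qed

definition between :: "(rat \<Rightarrow> 'o::complete_heyting_algebra) \<Rightarrow> (rat \<Rightarrow> 'o) \<Rightarrow> 'o real_set" where
  "between L M = (\<lambda>z. (\<^bold>\<exists>p. L p \<^bold>\<and> low p z) \<^bold>\<and> (\<^bold>\<exists>q. M (- q) \<^bold>\<and> upp z q))"

lemma betweenI: "w \<le> L p \<Longrightarrow> w \<le> low p z \<Longrightarrow> w \<le> M (- q) \<Longrightarrow> w \<le> upp z q \<Longrightarrow> w \<le> between L M z"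
  unfolding between_def by (rule hconjI; rule hexI, rule hconjI)

lemma betweenE:
  assumes "w \<le> between L M z"
    and "\<And>v p q. v \<le> w \<Longrightarrow> v \<le> L p \<Longrightarrow> v \<le> low p z \<Longrightarrow> v \<le> M (- q) \<Longrightarrow> v \<le> upp z q \<Longrightarrow> v \<le> \<psi>"
  shows "w \<le> \<psi>"
proof -
  have *: "w \<le> (\<^bold>\<exists>p. L p \<^bold>\<and> low p z)" "w \<le> (\<^bold>\<exists>q. M (- q) \<^bold>\<and> upp z q)"
    using assms(1) by (simp_all only: between_def le_inf_iff)
  show ?thesis
  proof (rule hexE[OF *(1)])
    fix p v assume v: "v \<le> w" "v \<le> (L p \<^bold>\<and> low p z)"
    show "v \<le> \<psi>"
    proof (rule hexE[OF order_trans[OF v(1) *(2)]])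
      fix q u assume u: "u \<le> v" "u \<le> (M (- q) \<^bold>\<and> upp z q)"
      show "u \<le> \<psi>"
        using order_trans[OF u(1) v(1)] order_trans[OF u(1) v(2)] u(2)
        by - (rule assms(2)[of u p q], simp_all)
    qed
  qed
qed

text \<open>
  The interval is exhausted by closed rational intervals, whose ends are within \<open>1 / 2 ^ n\<close> of the true
  ends; on each of them compactness applies.
\<close>

lemma between_in_ideal:
  fixes w :: "'o::complete_heyting_algebra"
  assumes fan: "\<Turnstile> fan_theorem TYPE('o)"
    and J: "sigma_ideal w J"
    and L: "lower_end w L" and M: "lower_end w M"
    and loc: "w \<le> (between L M \<^bold>\<subseteq> locally J)"
  shows "w \<le> J (between L M)"
proof -
  define Q where "Q n p q = ((L p \<^bold>\<and> (\<^bold>\<forall>p'. L p' \<^bold>\<longrightarrow> \<langle>p < p' + 1 / 2 ^ n\<rangle>)) \<^bold>\<and>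
      (M (- q) \<^bold>\<and> (\<^bold>\<forall>q'. M q' \<^bold>\<longrightarrow> \<langle>- q < q' + 1 / 2 ^ n\<rangle>)))" for n :: nat and p q :: rat
  \<comment> \<open>Approximate ends exist only locally. The intersection over all of them is one global set, and it
    is contained in whichever interval is locally available, so it belongs to \<open>J\<close>.\<close>
  define S where "S n = (\<lambda>z. \<^bold>\<forall>p q. Q n p q \<^bold>\<longrightarrow> ivl p q z)" for n
  have SD: "v \<le> S n z \<Longrightarrow> v \<le> Q n p q \<Longrightarrow> v \<le> ivl p q z" for v n z p q
    unfolding S_def by (drule hallD[of _ _ p], drule hallD[of _ _ q], erule himpD)
  have JS: "w \<le> J (S n)" for n
  proof (rule lower_end_locatedE[OF L order_refl, of "1 / 2 ^ n"])
    fix v p assume v: "v \<le> w" "v \<le> L p" "v \<le> (\<^bold>\<forall>p'. L p' \<^bold>\<longrightarrow> \<langle>p < p' + 1 / 2 ^ n\<rangle>)"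
    show "v \<le> J (S n)"
    proof (rule lower_end_locatedE[OF M v(1), of "1 / 2 ^ n"])
      fix u q assume u: "u \<le> v" "u \<le> M q" "u \<le> (\<^bold>\<forall>q'. M q' \<^bold>\<longrightarrow> \<langle>q < q' + 1 / 2 ^ n\<rangle>)"
      have uw: "u \<le> w" using u(1) v(1) by (rule order_trans)
      have Q: "u \<le> Q n p (- q)"
        using u order_trans[OF u(1) v(2)] order_trans[OF u(1) v(3)] by (simp only: Q_def le_inf_iff) simp
      have "u \<le> (cl p (- q) \<^bold>\<subseteq> locally J)"
      proof (rule subset_ofI)
        fix t z assume t: "t \<le> u" "t \<le> is_real z" "t \<le> cl p (- q) z"
        have tw: "t \<le> w" using t(1) uw by (rule order_trans)
        note LM = order_trans[OF t(1) order_trans[OF u(1) v(2)]] order_trans[OF t(1) u(2)]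
        show "t \<le> locally J z"
        proof (rule lower_end_openE[OF L tw LM(1)])
          fix s p' assume s: "s \<le> t" "s \<le> L p'" "p' < p"
          have sw: "s \<le> w" using s(1) tw by (rule order_trans)
          show "s \<le> locally J z"
          proof (rule lower_end_openE[OF M sw order_trans[OF s(1) LM(2)]])
            fix r q' assume r: "r \<le> s" "r \<le> M q'" "q' < q"
            have rt: "r \<le> t" using r(1) s(1) by (rule order_trans)
            note z = order_trans[OF rt t(2)] order_trans[OF rt t(3)]
            have "r \<le> between L M z"
            proof (rule betweenI)
              show "r \<le> L p'" using r(1) s(2) by (rule order_trans)
              show "r \<le> low p' z" using z s(3) by (rule cl_low)
              show "r \<le> M (- (- q'))" using r(2) by simp
              show "r \<le> upp z (- q')" using z by (rule cl_upp) (use r(3) in simp)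
            qed
            with loc order_trans[OF r(1) sw] z(1) show "r \<le> locally J z" by (rule subset_ofD)
          qed
        qed
      qed
      with fan sigma_ideal_le[OF J uw] have "u \<le> J (ivl p (- q))" by (rule compactness)
      then show "u \<le> J (S n)"
      proof (rule sigma_ideal_mono[OF J uw])
        show "u \<le> (S n \<^bold>\<subseteq> ivl p (- q))"
        proof (rule subset_ofI)
          fix t z assume "t \<le> u" "t \<le> S n z"
          from SD[OF this(2) order_trans[OF this(1) Q]] show "t \<le> ivl p (- q) z" .
        qed
      qed
    qed simp
  qed simp
  from sigma_ideal_Union[OF J order_refl, OF JS] show ?thesis
  proof (rule sigma_ideal_mono[OF J order_refl])
    show "w \<le> (between L M \<^bold>\<subseteq> Union_seq S)"
    proof (rule subset_ofI)
      fix v z assume v: "v \<le> w" "v \<le> is_real z" "v \<le> between L M z"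
      from v(3) show "v \<le> Union_seq S z"
      proof (rule betweenE)
        fix u p q assume u: "u \<le> v" "u \<le> L p" "u \<le> low p z" "u \<le> M (- q)" "u \<le> upp z q"
        from ivlI[OF u(3,5)] show "u \<le> Union_seq S z"
        proof (rule ivl_openE)
          fix t p' q' assume t: "t \<le> u" "t \<le> ivl p' q' z" "p < p'" "q' < q"
          have "0 < min (p' - p) (q - q')" using t(3,4) by simp
          from rat_arch_pow_inv[OF this, of "1 / 2"] obtain n where
            n: "1 / 2 ^ n < p' - p" "1 / 2 ^ n < q - q'" by (auto simp: power_one_over)
          have "t \<le> S n z"
            unfolding S_def
          proof (rule hallI, rule boundedI)
            fix a b s assume s: "s \<le> t" "s \<le> Q n a b"
            have su: "s \<le> u" using s(1) t(1) by (rule order_trans)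
            have Q: "s \<le> (\<^bold>\<forall>p'. L p' \<^bold>\<longrightarrow> \<langle>a < p' + 1 / 2 ^ n\<rangle>)"
              "s \<le> (\<^bold>\<forall>q'. M q' \<^bold>\<longrightarrow> \<langle>- b < q' + 1 / 2 ^ n\<rangle>)"
              using s(2) by (simp_all only: Q_def le_inf_iff)
            have "s \<le> \<langle>a < p + 1 / 2 ^ n\<rangle>"
              using Q(1) order_refl order_trans[OF su u(2)] by (rule boundedD)
            then show "s \<le> ivl a b z"
            proof (rule decidedE)
              assume a: "a < p + 1 / 2 ^ n"
              have "s \<le> \<langle>- b < - q + 1 / 2 ^ n\<rangle>"
                using Q(2) order_refl order_trans[OF su u(4)] by (rule boundedD)
              then show ?thesis
              proof (rule decidedE)
                assume "- b < - q + 1 / 2 ^ n"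
                then show ?thesis
                  by - (rule ivl_mono[OF order_trans[OF s(1) t(2)]], use a n in simp_all)
              qed
            qed
          qed
          then show "t \<le> Union_seq S z" unfolding Union_seq_def by (rule hexI)
        qed
      qed
    qed
  qed
qed

lemma open_interval_in_ideal:
  fixes w :: "'o::complete_heyting_algebra"
  assumes fan: "\<Turnstile> fan_theorem TYPE('o)"
    and J: "sigma_ideal w J"
    and a: "w \<le> is_real a" and b: "w \<le> is_real b"
    and loc: "w \<le> (open_interval a b \<^bold>\<subseteq> locally J)"
  shows "w \<le> J (open_interval a b)"
proof -
  define L where "L = (\<lambda>p. upp a (p + 0))"
  define M where "M = (\<lambda>p. low (- p - 0) b)"
  have "w \<le> J (between L M)"
  proof (rule between_in_ideal[OF fan J])
    show "lower_end w L" "lower_end w M"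
      unfolding L_def M_def by (rule lower_end_upp[OF a] lower_end_low[OF b])+
    show "w \<le> (between L M \<^bold>\<subseteq> locally J)"
    proof (rule subset_ofI)
      fix v z assume v: "v \<le> w" "v \<le> is_real z" "v \<le> between L M z"
      have "v \<le> open_interval a b z"
      proof (rule betweenE[OF v(3)])
        fix u p q assume u: "u \<le> v" "u \<le> L p" "u \<le> low p z" "u \<le> M (- q)" "u \<le> upp z q"
        have uw: "u \<le> w" using u(1) v(1) by (rule order_trans)
        show "u \<le> open_interval a b z"
          using rlessI[OF order_trans[OF uw a] order_trans[OF u(1) v(2)], of p]
            rlessI[OF order_trans[OF u(1) v(2)] order_trans[OF uw b], of q] u
          by (simp add: open_interval_def L_def M_def)
      qed
      with loc v(1,2) show "v \<le> locally J z" by (rule subset_ofD)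
    qed
  qed
  then show ?thesis
  proof (rule sigma_ideal_mono[OF J order_refl])
    show "w \<le> (open_interval a b \<^bold>\<subseteq> between L M)"
    proof (rule subset_ofI)
      fix v z assume "v \<le> open_interval a b z"
      then have *: "v \<le> (a \<^bold>< z)" "v \<le> (z \<^bold>< b)" by (simp_all add: open_interval_def)
      show "v \<le> between L M z"
      proof (rule rlessE[OF *(1)])
        fix u p assume u: "u \<le> v" "u \<le> upp a p" "u \<le> low p z"
        show "u \<le> between L M z"
        proof (rule rlessE[OF order_trans[OF u(1) *(2)]])
          fix t q assume t: "t \<le> u" "t \<le> upp z q" "t \<le> low q b"
          show "t \<le> between L M z"
            by (rule betweenI[of t L p z M q])
              (use t order_trans[OF t(1) u(2)] order_trans[OF t(1) u(3)] in \<open>simp_all add: L_def M_def\<close>)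
        qed
      qed
    qed
  qed
qed

text \<open>
  A point apart from \<open>y\<close> lies on one definite side of \<open>y\<close>, so a punctured ball is the union of two
  intervals. Their ends combine those of the ball with \<open>y\<close>.
\<close>

lemma punctured_in_ideal:
  fixes w :: "'o::complete_heyting_algebra"
  assumes fan: "\<Turnstile> fan_theorem TYPE('o)"
    and J: "sigma_ideal w J"
    and x: "w \<le> is_real x" and y: "w \<le> is_real y"
    and loc: "w \<le> ((\<lambda>z. near x z e \<^bold>\<and> (z \<^bold># y)) \<^bold>\<subseteq> locally J)"
  shows "w \<le> J (\<lambda>z. near x z e \<^bold>\<and> (z \<^bold># y))"
proof -
  define X where "X = (\<lambda>p. upp x (p + e))"
  define X' where "X' = (\<lambda>p. low (- p - e) x)"
  define Y where "Y = (\<lambda>p. upp y (p + 0))"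
  define Y' where "Y' = (\<lambda>p. low (- p - 0) y)"
  have ends: "lower_end w X" "lower_end w Y" "lower_end w X'" "lower_end w Y'"
    unfolding X_def X'_def Y_def Y'_def
    by (rule lower_end_upp[OF x] lower_end_upp[OF y] lower_end_low[OF x] lower_end_low[OF y])+
  have near: "v \<le> near x z e" if v: "v \<le> w" "v \<le> X p" "v \<le> low p z" "v \<le> X' (- q)" "v \<le> upp z q" for v z p q
  proof (rule upp_openE)
    show "v \<le> upp x (p + e)" using v(2) by (simp add: X_def)
    fix u r assume u: "u \<le> v" "u \<le> upp x r" "r < p + e"
    have "u \<le> low (q - e) x" using order_trans[OF u(1) v(4)] by (simp add: X'_def)
    then show "u \<le> near x z e"
    proof (rule low_openE)
      fix t s assume t: "t \<le> u" "t \<le> low s x" "q - e < s"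
      have tv: "t \<le> v" using t(1) u(1) by (rule order_trans)
      show "t \<le> near x z e"
        by (rule nearI[of t s r x p q])
          (use t u(3) order_trans[OF t(1) u(2)] order_trans[OF tv v(3)] order_trans[OF tv v(5)]
            in \<open>simp_all add: ivlI\<close>)
    qed
  qed
  have right: "w \<le> J (between (\<lambda>p. X p \<^bold>\<and> Y p) X')"
  proof (rule between_in_ideal[OF fan J lower_end_conj[OF ends(1,2)] ends(3)], rule subset_ofI)
    fix v z assume v: "v \<le> w" "v \<le> is_real z" "v \<le> between (\<lambda>p. X p \<^bold>\<and> Y p) X' z"
    show "v \<le> locally J z"
    proof (rule betweenE[OF v(3)])
      fix u p q assume u: "u \<le> v" "u \<le> (X p \<^bold>\<and> Y p)" "u \<le> low p z" "u \<le> X' (- q)" "u \<le> upp z q"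
      have uw: "u \<le> w" using u(1) v(1) by (rule order_trans)
      note z = order_trans[OF u(1) v(2)]
      have "u \<le> near x z e" using u by (intro near[OF uw, of p z q]) simp_all
      moreover have "u \<le> (z \<^bold># y)"
        using z order_trans[OF uw y] by (rule apartI2[of _ _ _ p]) (use u in \<open>simp_all add: Y_def\<close>)
      ultimately have "u \<le> (near x z e \<^bold>\<and> (z \<^bold># y))" by simp
      with loc uw z show "u \<le> locally J z" by (rule subset_ofD)
    qed
  qed
  have left: "w \<le> J (between X (\<lambda>p. X' p \<^bold>\<and> Y' p))"
  proof (rule between_in_ideal[OF fan J ends(1) lower_end_conj[OF ends(3,4)]], rule subset_ofI)
    fix v z assume v: "v \<le> w" "v \<le> is_real z" "v \<le> between X (\<lambda>p. X' p \<^bold>\<and> Y' p) z"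
    show "v \<le> locally J z"
    proof (rule betweenE[OF v(3)])
      fix u p q assume u: "u \<le> v" "u \<le> X p" "u \<le> low p z" "u \<le> (X' (- q) \<^bold>\<and> Y' (- q))" "u \<le> upp z q"
      have uw: "u \<le> w" using u(1) v(1) by (rule order_trans)
      note z = order_trans[OF u(1) v(2)]
      have "u \<le> near x z e" using u by (intro near[OF uw, of p z q]) simp_all
      moreover have "u \<le> (z \<^bold># y)"
        using z order_trans[OF uw y] by (rule apartI1[of _ _ _ q]) (use u in \<open>simp_all add: Y'_def\<close>)
      ultimately have "u \<le> (near x z e \<^bold>\<and> (z \<^bold># y))" by simp
      with loc uw z show "u \<le> locally J z" by (rule subset_ofD)
    qed
  qed
  show ?thesis
  proof (rule sigma_ideal_mono[OF J order_refl, OF sigma_ideal_Un[OF J order_refl, OF left right]], rule subset_ofI)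
    fix v z assume v: "v \<le> w" "v \<le> is_real z" "v \<le> (near x z e \<^bold>\<and> (z \<^bold># y))"
    then have nz: "v \<le> near x z e" and az: "v \<le> (z \<^bold># y)" by simp_all
    show "v \<le> (between X (\<lambda>p. X' p \<^bold>\<and> Y' p) \<^bold>\<union> between (\<lambda>p. X p \<^bold>\<and> Y p) X') z"
      (is "v \<le> ?T")
    proof (rule nearE[OF nz])
      fix u a b c d assume u: "u \<le> v" "u \<le> ivl a b x" "u \<le> ivl c d z" "b - c < e" "d - a < e"
      have X: "u \<le> X c" "u \<le> X' (- d)"
        unfolding X_def X'_def
        by (rule upp_mono[OF ivlD(2)[OF u(2)]], use u(4) in simp)
          (rule low_mono[OF ivlD(1)[OF u(2)]], use u(5) in simp)
      note cd = ivlD[OF u(3)]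
      from order_trans[OF u(1) az] show "u \<le> ?T"
      proof (rule apartE)
        fix t r assume t: "t \<le> u" "t \<le> upp z r" "t \<le> low r y"
        note tu = order_trans[OF t(1) X(1)] order_trans[OF t(1) X(2)] order_trans[OF t(1) cd(1)] order_trans[OF t(1) cd(2)]
        have "t \<le> upp z (min d r)" "t \<le> X' (- min d r)" "t \<le> Y' (- min d r)"
          using t tu by (auto simp: min_def X'_def Y'_def elim!: low_mono)
        then show "t \<le> ?T"
          unfolding set_union_def
          using tu by - (rule hdisjI1, rule betweenI[of _ _ c _ _ "min d r"], simp_all)
      next
        fix t r assume t: "t \<le> u" "t \<le> upp y r" "t \<le> low r z"
        note tu = order_trans[OF t(1) X(1)] order_trans[OF t(1) X(2)] order_trans[OF t(1) cd(1)] order_trans[OF t(1) cd(2)]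
        have "t \<le> low (max c r) z" "t \<le> X (max c r)" "t \<le> Y (max c r)"
          using t tu by (auto simp: max_def X_def Y_def elim!: upp_mono)
        then show "t \<le> ?T"
          unfolding set_union_def
          using tu by - (rule hdisjI2, rule betweenI[of _ _ "max c r" _ _ d], simp_all)
      qed
    qed
  qed
qed

section \<open>Open sets in terms of rational intervals\<close>

lemmas all_realD = boundedD[where D = is_real]

lemma is_setI:
  assumes "\<And>v x y. v \<le> w \<Longrightarrow> v \<le> is_real x \<Longrightarrow> v \<le> is_real y \<Longrightarrow> v \<le> same_seq x y \<Longrightarrow> v \<le> X x \<Longrightarrow> v \<le> X y"
  shows "w \<le> is_set X"
  unfolding is_set_def
proof (rule boundedI, rule boundedI, rule himpI)
  fix x v y u t assume *: "v \<le> w" "v \<le> is_real x" "u \<le> v" "u \<le> is_real y" "t \<le> u" "t \<le> (same_seq x y \<^bold>\<and> X x)"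
  have tv: "t \<le> v" using *(5,3) by (rule order_trans)
  show "t \<le> X y"
    by (rule assms[of t x])
      (use order_trans[OF tv *(1)] order_trans[OF tv *(2)] order_trans[OF *(5,4)] *(6) in simp_all)
qed

lemma is_setD:
  assumes "w \<le> is_set X" and "w \<le> is_real x" and "w \<le> is_real y" and "w \<le> same_seq x y" and "w \<le> X x"
  shows "w \<le> X y"
proof -
  have "w \<le> (\<^bold>\<forall>\<^sub>R y. (same_seq x y \<^bold>\<and> X x) \<^bold>\<longrightarrow> X y)"
    using all_realD[OF assms(1)[unfolded is_set_def] order_refl assms(2)] .
  from all_realD[OF this order_refl assms(3)] show ?thesis by (rule himpD) (simp add: assms(4,5))
qed

lemma subset_of_trans: "w \<le> (X \<^bold>\<subseteq> Y) \<Longrightarrow> w \<le> (Y \<^bold>\<subseteq> Z) \<Longrightarrow> w \<le> (X \<^bold>\<subseteq> Z)"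
  by (rule subset_ofI, erule subset_ofD, assumption, assumption, erule subset_ofD)

lemma set_eqD:
  assumes "w \<le> (X \<^bold>= Y)"
  shows "w \<le> (X \<^bold>\<subseteq> Y)" and "w \<le> (Y \<^bold>\<subseteq> X)"
proof -
  have iff: "v \<le> (X x \<^bold>\<longleftrightarrow> Y x)" if "v \<le> w" "v \<le> is_real x" for v x
    using all_realD[OF assms[unfolded set_eq_def] that] .
  show "w \<le> (X \<^bold>\<subseteq> Y)"
  proof (rule subset_ofI)
    fix v x assume v: "v \<le> w" "v \<le> is_real x" "v \<le> X x"
    from iff[OF v(1,2)] have "v \<le> (X x \<^bold>\<longrightarrow> Y x)" by (simp add: hiff_def)
    then show "v \<le> Y x" using v(3) by (rule himpD)
  qed
  show "w \<le> (Y \<^bold>\<subseteq> X)"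
  proof (rule subset_ofI)
    fix v x assume v: "v \<le> w" "v \<le> is_real x" "v \<le> Y x"
    from iff[OF v(1,2)] have "v \<le> (Y x \<^bold>\<longrightarrow> X x)" by (simp add: hiff_def)
    then show "v \<le> X x" using v(3) by (rule himpD)
  qed
qed

lemma set_eqI:
  assumes "w \<le> (X \<^bold>\<subseteq> Y)" and "w \<le> (Y \<^bold>\<subseteq> X)"
  shows "w \<le> (X \<^bold>= Y)"
  unfolding set_eq_def
proof (rule boundedI, rule hiffI)
  fix x v u assume *: "v \<le> w" "v \<le> is_real x" "u \<le> v"
  note u = order_trans[OF *(3,1)] order_trans[OF *(3,2)]
  show "u \<le> Y x" if "u \<le> X x" using assms(1) u that by (rule subset_ofD)
  show "u \<le> X x" if "u \<le> Y x" using assms(2) u that by (rule subset_ofD)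
qed

lemma subset_locally_mono:
  assumes "w \<le> (H \<^bold>\<subseteq> locally J)" and "\<And>v S. v \<le> w \<Longrightarrow> v \<le> J S \<Longrightarrow> v \<le> K S"
  shows "w \<le> (H \<^bold>\<subseteq> locally K)"
proof (rule subset_ofI)
  fix v x assume v: "v \<le> w" "v \<le> is_real x" "v \<le> H x"
  from subset_ofD[OF assms(1) v] show "v \<le> locally K x"
  proof (rule locallyE)
    fix u a b assume u: "u \<le> v" "u \<le> ivl a b x" "u \<le> J (ivl a b)"
    show "u \<le> locally K x"
      using u(2) assms(2)[OF order_trans[OF u(1) v(1)] u(3)] by (rule locallyI)
  qed
qed

abbreviation cut_open :: "'o::complete_heyting_algebra real_set \<Rightarrow> 'o" where
  "cut_open H \<equiv> H \<^bold>\<subseteq> locally (\<lambda>S. S \<^bold>\<subseteq> H)"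

lemma is_open_cut_open:
  assumes "w \<le> is_open G"
  shows "w \<le> cut_open G"
proof (rule subset_ofI)
  fix v x assume v: "v \<le> w" "v \<le> is_real x" "v \<le> G x"
  have "v \<le> (G x \<^bold>\<longrightarrow> (\<^bold>\<exists>n. open_interval (x \<^bold>- dyadic n) (x \<^bold>+ dyadic n) \<^bold>\<subseteq> G))"
    using all_realD[OF assms[unfolded is_open_def] v(1,2)] .
  from himpD[OF this v(3)] show "v \<le> locally (\<lambda>S. S \<^bold>\<subseteq> G) x"
  proof (rule hexE)
    fix n u assume u: "u \<le> v" "u \<le> (open_interval (x \<^bold>- dyadic n) (x \<^bold>+ dyadic n) \<^bold>\<subseteq> G)"
    note x = order_trans[OF u(1) v(2)]
    from x show "u \<le> locally (\<lambda>S. S \<^bold>\<subseteq> G) x"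
    proof (rule locatedE[of _ _ "1 / 2 ^ n"])
      fix t p q assume t: "t \<le> u" "t \<le> ivl p q x" "q - p < 1 / 2 ^ n"
      have "t \<le> (ivl p q \<^bold>\<subseteq> G)"
      proof (rule subset_ofI)
        fix s z assume s: "s \<le> t" "s \<le> is_real z" "s \<le> ivl p q z"
        have su: "s \<le> u" using s(1) t(1) by (rule order_trans)
        have "s \<le> near x z (1 / 2 ^ n)"
          using order_trans[OF s(1) t(2)] s(3) t(3) by (rule near_ivl)
        with order_trans[OF su x] s(2) have "s \<le> open_interval (x \<^bold>- dyadic n) (x \<^bold>+ dyadic n) z"
          by (rule ball_near)
        with u(2) su s(2) show "s \<le> G z" by (rule subset_ofD)
      qed
      with t(2) show "t \<le> locally (\<lambda>S. S \<^bold>\<subseteq> G) x" by (rule locallyI)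
    qed simp
  qed
qed

section \<open>Co-derivative extensions\<close>

lemma coderivI:
  assumes "w \<le> is_real x" and "w \<le> is_real y" and "w \<le> near x y (1 / 2 ^ n)"
    and "w \<le> ((\<lambda>z. near x z (1 / 2 ^ n) \<^bold>\<and> (z \<^bold># y)) \<^bold>\<subseteq> H)"
  shows "w \<le> coderiv H x"
  unfolding coderiv_def
proof (rule hexI[of _ _ n], rule hexI[of _ _ y], intro hconjI)
  show "w \<le> is_real y" by fact
  show "w \<le> (rabs (x \<^bold>- y) \<^bold>< dyadic n)" using assms by (simp add: near_iff)
  show "w \<le> (\<^bold>\<forall>\<^sub>R z. ((rabs (x \<^bold>- z) \<^bold>< dyadic n) \<^bold>\<and> (z \<^bold># y)) \<^bold>\<longrightarrow> H z)"
  proof (rule boundedI, rule himpI)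
    fix z v u assume *: "v \<le> w" "v \<le> is_real z" "u \<le> v" "u \<le> ((rabs (x \<^bold>- z) \<^bold>< dyadic n) \<^bold>\<and> (z \<^bold># y))"
    have uw: "u \<le> w" using *(3,1) by (rule order_trans)
    note z = order_trans[OF *(3,2)]
    have "u \<le> (near x z (1 / 2 ^ n) \<^bold>\<and> (z \<^bold># y))"
      using *(4) near_iff[OF order_trans[OF uw assms(1)] z, of n] by simp
    with assms(4) uw z show "u \<le> H z" by (rule subset_ofD)
  qed
qed

lemma coderivE:
  assumes "w \<le> is_real x" and "w \<le> coderiv H x"
    and "\<And>v n y. v \<le> w \<Longrightarrow> v \<le> is_real y \<Longrightarrow> v \<le> near x y (1 / 2 ^ n) \<Longrightarrow>
      v \<le> ((\<lambda>z. near x z (1 / 2 ^ n) \<^bold>\<and> (z \<^bold># y)) \<^bold>\<subseteq> H) \<Longrightarrow> v \<le> \<psi>"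
  shows "w \<le> \<psi>"
proof (rule hexE[OF assms(2)[unfolded coderiv_def]], erule hexE, simp only: le_inf_iff, elim conjE)
  fix n v y u
  assume *: "v \<le> w" "u \<le> v" "u \<le> is_real y" "u \<le> (rabs (x \<^bold>- y) \<^bold>< dyadic n)"
    "u \<le> (\<^bold>\<forall>\<^sub>R z. ((rabs (x \<^bold>- z) \<^bold>< dyadic n) \<^bold>\<and> (z \<^bold># y)) \<^bold>\<longrightarrow> H z)"
  have uw: "u \<le> w" using *(2,1) by (rule order_trans)
  note x = order_trans[OF uw assms(1)]
  from uw *(3) show "u \<le> \<psi>"
  proof (rule assms(3))
    show "u \<le> near x y (1 / 2 ^ n)" using *(4) near_iff[OF x *(3)] by simp
    show "u \<le> ((\<lambda>z. near x z (1 / 2 ^ n) \<^bold>\<and> (z \<^bold># y)) \<^bold>\<subseteq> H)"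
    proof (rule subset_ofI)
      fix t z assume t: "t \<le> u" "t \<le> is_real z" "t \<le> (near x z (1 / 2 ^ n) \<^bold>\<and> (z \<^bold># y))"
      have "t \<le> (((rabs (x \<^bold>- z) \<^bold>< dyadic n) \<^bold>\<and> (z \<^bold># y)) \<^bold>\<longrightarrow> H z)"
        using all_realD[OF *(5) t(1,2)] .
      then show "t \<le> H z"
        by (rule himpD) (use t(3) near_iff[OF order_trans[OF t(1) x] t(2), of n] in simp)
    qed
  qed
qed

lemma is_set_coderiv: "w \<le> is_set (coderiv H)"
proof (rule is_setI)
  fix v x x' assume v: "v \<le> is_real x" "v \<le> is_real x'" "v \<le> same_seq x x'" "v \<le> coderiv H x"
  have rev_seq: "v \<le> same_seq x' x"
    using v(3) unfolding same_seq_def hiff_def by (simp add: inf_commute)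
  from v(1,4) show "v \<le> coderiv H x'"
  proof (rule coderivE)
    fix u n y assume u: "u \<le> v" "u \<le> is_real y" "u \<le> near x y (1 / 2 ^ n)"
      "u \<le> ((\<lambda>z. near x z (1 / 2 ^ n) \<^bold>\<and> (z \<^bold># y)) \<^bold>\<subseteq> H)"
    from order_trans[OF u(1) v(2)] u(2) show "u \<le> coderiv H x'"
    proof (rule coderivI)
      show "u \<le> near x' y (1 / 2 ^ n)"
        using order_trans[OF u(1) v(3)] u(3) by (rule same_seq_near)
      show "u \<le> ((\<lambda>z. near x' z (1 / 2 ^ n) \<^bold>\<and> (z \<^bold># y)) \<^bold>\<subseteq> H)"
      proof (rule subset_ofI)
        fix t z assume t: "t \<le> u" "t \<le> is_real z" "t \<le> (near x' z (1 / 2 ^ n) \<^bold>\<and> (z \<^bold># y))"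
        have "t \<le> near x z (1 / 2 ^ n)"
          using order_trans[OF t(1) order_trans[OF u(1) rev_seq]] by (rule same_seq_near) (use t(3) in simp)
        then have "t \<le> (near x z (1 / 2 ^ n) \<^bold>\<and> (z \<^bold># y))" using t(3) by simp
        with u(4) t(1,2) show "t \<le> H z" by (rule subset_ofD)
      qed
    qed
  qed
qed

lemma near_in_ivl:
  assumes "w \<le> is_real x" and "w \<le> ivl p q x" and "w \<le> near x z e" and "p' + e \<le> p" and "q + e \<le> q'"
  shows "w \<le> ivl p' q' z"
proof (rule nearE[OF assms(3)])
  fix v a b c d assume v: "v \<le> w" "v \<le> ivl a b x" "v \<le> ivl c d z" "b - c < e" "d - a < e"
  note x = order_trans[OF v(1) assms(1)]
  note pq = order_trans[OF v(1) ivlD(1)[OF assms(2)]] order_trans[OF v(1) ivlD(2)[OF assms(2)]]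
  from x pq(1) ivlD(2)[OF v(2)] show "v \<le> ivl p' q' z"
  proof (rule low_uppE)
    assume pb: "p < b"
    from x ivlD(1)[OF v(2)] pq(2) show ?thesis
      by (rule low_uppE) (rule ivl_mono[OF v(3)], use pb v(4,5) assms(4,5) in simp_all)
  qed
qed

text \<open>
  At an inner point \<open>x\<close> the exceptional point can be \<open>x\<close> itself.
\<close>

lemma subset_coderiv:
  assumes "w \<le> cut_open H"
  shows "w \<le> (H \<^bold>\<subseteq> coderiv H)"
proof (rule subset_ofI)
  fix v x assume v: "v \<le> w" "v \<le> is_real x" "v \<le> H x"
  from subset_ofD[OF assms v] show "v \<le> coderiv H x"
  proof (rule locallyE)
    fix u p q assume u: "u \<le> v" "u \<le> ivl p q x" "u \<le> (ivl p q \<^bold>\<subseteq> H)"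
    from u(2) show "u \<le> coderiv H x"
    proof (rule ivl_openE)
      fix t p' q' assume t: "t \<le> u" "t \<le> ivl p' q' x" "p < p'" "q' < q"
      have "0 < min (p' - p) (q - q')" using t(3,4) by simp
      from rat_arch_pow_inv[OF this, of "1 / 2"] obtain n where
        n: "1 / 2 ^ n < p' - p" "1 / 2 ^ n < q - q'" by (auto simp: power_one_over)
      note x = order_trans[OF t(1) order_trans[OF u(1) v(2)]]
      from x x near_refl[OF x] show "t \<le> coderiv H x"
      proof (rule coderivI)
        show "t \<le> ((\<lambda>z. near x z (1 / 2 ^ n) \<^bold>\<and> (z \<^bold># x)) \<^bold>\<subseteq> H)"
        proof (rule subset_ofI)
          fix s z assume s: "s \<le> t" "s \<le> is_real z" "s \<le> (near x z (1 / 2 ^ n) \<^bold>\<and> (z \<^bold># x))"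
          then have "s \<le> near x z (1 / 2 ^ n)" by simp
          from near_in_ivl[OF order_trans[OF s(1) x] order_trans[OF s(1) t(2)] this]
          have "s \<le> ivl p q z" using n by simp
          with u(3) order_trans[OF s(1) t(1)] s(2) show "s \<le> H z" by (rule subset_ofD)
        qed
      qed simp
    qed
  qed
qed

text \<open>
  Let \<open>y\<close> be the exceptional point of the ball of radius \<open>e\<close> around \<open>x\<close>. If \<open>y\<close> is closer to \<open>x\<close>
  than \<open>e / 4\<close>, then the ball of radius \<open>e / 2\<close> around any \<open>x'\<close> near \<open>x\<close> still contains \<open>y\<close> and is
  contained in the original ball. Otherwise \<open>x\<close> is apart from \<open>y\<close> and hence already an element of the
  open set \<open>H\<close>.
\<close>

lemma cut_open_coderiv:
  assumes "w \<le> cut_open H"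
  shows "w \<le> cut_open (coderiv H)"
proof (rule subset_ofI)
  fix v x assume v: "v \<le> w" "v \<le> is_real x" "v \<le> coderiv H x"
  from v(2,3) show "v \<le> locally (\<lambda>S. S \<^bold>\<subseteq> coderiv H) x"
  proof (rule coderivE)
    fix u n y
    define e :: rat where "e = 1 / 2 ^ n"
    have e: "0 < e" by (simp add: e_def)
    assume u: "u \<le> v" "u \<le> is_real y" "u \<le> near x y (1 / 2 ^ n)"
      "u \<le> ((\<lambda>z. near x z (1 / 2 ^ n) \<^bold>\<and> (z \<^bold># y)) \<^bold>\<subseteq> H)"
    have uw: "u \<le> w" using u(1) v(1) by (rule order_trans)
    note x = order_trans[OF u(1) v(2)]
    from x u(2) show "u \<le> locally (\<lambda>S. S \<^bold>\<subseteq> coderiv H) x"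
    proof (rule near_or_apartE[of _ _ _ "e / 4"])
      fix t assume t: "t \<le> u" "t \<le> near x y (e / 4)"
      note tx = order_trans[OF t(1) x]
      from tx show "t \<le> locally (\<lambda>S. S \<^bold>\<subseteq> coderiv H) x"
      proof (rule locatedE[of _ _ "e / 8"])
        fix s p q assume s: "s \<le> t" "s \<le> ivl p q x" "q - p < e / 8"
        have su: "s \<le> u" using s(1) t(1) by (rule order_trans)
        have "s \<le> (ivl p q \<^bold>\<subseteq> coderiv H)"
        proof (rule subset_ofI)
          fix r x' assume r: "r \<le> s" "r \<le> is_real x'" "r \<le> ivl p q x'"
          have ru: "r \<le> u" using r(1) su by (rule order_trans)
          have rx: "r \<le> is_real x" using ru x by (rule order_trans)
          have y: "r \<le> is_real y" using ru u(2) by (rule order_trans)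
          have "r \<le> near x' y (e / 4 + e / 8)"
            using rx order_trans[OF r(1) order_trans[OF s(1) t(2)]] order_trans[OF r(1) s(2)] r(3)
            by (rule near_shift) (use s(3) in simp)
          then have near: "r \<le> near x' y (1 / 2 ^ Suc n)" by (rule near_mono) (simp add: e_def field_simps)
          from r(2) y near show "r \<le> coderiv H x'"
          proof (rule coderivI)
            show "r \<le> ((\<lambda>z. near x' z (1 / 2 ^ Suc n) \<^bold>\<and> (z \<^bold># y)) \<^bold>\<subseteq> H)"
            proof (rule subset_ofI)
              fix r' z assume z: "r' \<le> r" "r' \<le> is_real z" "r' \<le> (near x' z (1 / 2 ^ Suc n) \<^bold>\<and> (z \<^bold># y))"
              then have "r' \<le> near x' z (e / 2)" by (simp add: e_def mult.commute)
              with order_trans[OF z(1) r(2)] have "r' \<le> near x z (e / 2 + e / 8)"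
                using order_trans[OF z(1) r(3)] order_trans[OF z(1) order_trans[OF r(1) s(2)]]
                by (rule near_shift) (use s(3) in simp)
              then have "r' \<le> near x z (1 / 2 ^ n)" by (rule near_mono) (simp add: e_def field_simps)
              then have "r' \<le> (near x z (1 / 2 ^ n) \<^bold>\<and> (z \<^bold># y))" using z(3) by simp
              with u(4) order_trans[OF z(1) ru] z(2) show "r' \<le> H z" by (rule subset_ofD)
            qed
          qed
        qed
        with s(2) show "s \<le> locally (\<lambda>S. S \<^bold>\<subseteq> coderiv H) x" by (rule locallyI)
      qed (use e in simp)
    next
      fix t assume t: "t \<le> u" "t \<le> (x \<^bold># y)"
      note tx = order_trans[OF t(1) x] and tw = order_trans[OF t(1) uw]
      have "t \<le> (near x x (1 / 2 ^ n) \<^bold>\<and> (x \<^bold># y))" using near_refl[OF tx] t(2) by simp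
      with u(4) t(1) tx have H: "t \<le> H x" by (rule subset_ofD)
      have "t \<le> (H \<^bold>\<subseteq> locally (\<lambda>S. S \<^bold>\<subseteq> coderiv H))"
      proof (rule subset_locally_mono[OF order_trans[OF tw assms]])
        fix s S assume s: "s \<le> t" "s \<le> (S \<^bold>\<subseteq> H)"
        show "s \<le> (S \<^bold>\<subseteq> coderiv H)"
          using s(2) order_trans[OF order_trans[OF s(1) tw] subset_coderiv[OF assms]] by (rule subset_of_trans)
      qed
      then show "t \<le> locally (\<lambda>S. S \<^bold>\<subseteq> coderiv H) x" using order_refl tx H by (rule subset_ofD)
    qed (use e in simp)
  qed
qed

lemma rational_apartE:
  assumes "w \<le> is_real y" and "r < s"
    and "\<And>v t. v \<le> w \<Longrightarrow> r \<le> t \<Longrightarrow> t \<le> s \<Longrightarrow> v \<le> (rconst t \<^bold># y) \<Longrightarrow> v \<le> \<psi>"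
  shows "w \<le> \<psi>"
proof -
  obtain m where m: "r < m" "m < s" using dense[OF assms(2)] by blast
  obtain m' where m': "m < m'" "m' < s" using dense[OF m(2)] by blast
  from assms(1) m'(1) show ?thesis
  proof (rule cotransE)
    fix v assume v: "v \<le> w" "v \<le> low m y"
    have "v \<le> upp (rconst r) m" by (rule ivlD(2)[OF ivl_rconst[of "r - 1"]]) (use m in simp_all)
    then have "v \<le> (rconst r \<^bold># y)"
      by (rule apartI1[OF is_real_rconst order_trans[OF v(1) assms(1)] _ v(2)])
    with v(1) show "v \<le> \<psi>" by - (rule assms(3)[of v r], use assms(2) in simp_all)
  next
    fix v assume v: "v \<le> w" "v \<le> upp y m'"
    have "v \<le> low m' (rconst s)" by (rule ivlD(1)[OF ivl_rconst[of _ _ "s + 1"]]) (use m' in simp_all)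
    then have "v \<le> (rconst s \<^bold># y)"
      by (rule apartI2[OF is_real_rconst order_trans[OF v(1) assms(1)] v(2)])
    with v(1) show "v \<le> \<psi>" by - (rule assms(3)[of v s], use assms(2) in simp_all)
  qed
qed

lemma rless_rconst:
  assumes "w \<le> is_real a" and "w \<le> is_real x" and "w \<le> (a \<^bold>< rconst t)" and "w \<le> low t x"
  shows "w \<le> (a \<^bold>< x)"
proof (rule rlessE[OF assms(3)])
  fix v r assume v: "v \<le> w" "v \<le> upp a r" "v \<le> low r (rconst t)"
  have "v \<le> low r x"
  proof (rule low_openE[OF order_trans[OF v(1) assms(4)]])
    fix u s assume u: "u \<le> v" "u \<le> low s x" "t < s"
    have "u \<le> upp (rconst t) s" by (rule ivlD(2)[OF ivl_rconst[of "t - 1"]]) (use u(3) in simp_all)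
    with is_real_rconst order_trans[OF u(1) v(3)] show "u \<le> low r x"
      by (rule low_uppE) (rule low_mono[OF u(2)], simp)
  qed
  with order_trans[OF v(1) assms(1)] order_trans[OF v(1) assms(2)] v(2) show "v \<le> (a \<^bold>< x)" by (rule rlessI)
qed

lemma rconst_rless:
  assumes "w \<le> is_real b" and "w \<le> is_real x" and "w \<le> (rconst t \<^bold>< b)" and "w \<le> upp x t"
  shows "w \<le> (x \<^bold>< b)"
proof (rule rlessE[OF assms(3)])
  fix v r assume v: "v \<le> w" "v \<le> upp (rconst t) r" "v \<le> low r b"
  have "v \<le> upp x r"
  proof (rule upp_openE[OF order_trans[OF v(1) assms(4)]])
    fix u s assume u: "u \<le> v" "u \<le> upp x s" "s < t"
    have "u \<le> low s (rconst t)" by (rule ivlD(1)[OF ivl_rconst[of _ _ "t + 1"]]) (use u(3) in simp_all)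
    from is_real_rconst this order_trans[OF u(1) v(2)] show "u \<le> upp x r"
      by (rule low_uppE) (rule upp_mono[OF u(2)], simp)
  qed
  with order_trans[OF v(1) assms(2)] order_trans[OF v(1) assms(1)] show "v \<le> (x \<^bold>< b)"
    by (rule rlessI) (rule v(3))
qed

text \<open>
  On either side of \<open>x\<close> the punctured ball contains a rational, since of two rationals on that side at
  least one is apart from the exceptional point. Both rationals lie in the interval, hence so does
  \<open>x\<close>.
\<close>

lemma coderiv_bounded:
  assumes a: "w \<le> is_real a" and b: "w \<le> is_real b" and H: "w \<le> (H \<^bold>\<subseteq> open_interval a b)"
  shows "w \<le> (coderiv H \<^bold>\<subseteq> open_interval a b)"
proof (rule subset_ofI)
  fix v x assume v: "v \<le> w" "v \<le> is_real x" "v \<le> coderiv H x"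
  from v(2,3) show "v \<le> open_interval a b x"
  proof (rule coderivE)
    fix u n y
    define e :: rat where "e = 1 / 2 ^ n"
    have e: "0 < e" by (simp add: e_def)
    assume u: "u \<le> v" "u \<le> is_real y" "u \<le> near x y (1 / 2 ^ n)"
      "u \<le> ((\<lambda>z. near x z (1 / 2 ^ n) \<^bold>\<and> (z \<^bold># y)) \<^bold>\<subseteq> H)"
    have uw: "u \<le> w" using u(1) v(1) by (rule order_trans)
    have x: "u \<le> is_real x" using u(1) v(2) by (rule order_trans)
    from x show "u \<le> open_interval a b x"
    proof (rule locatedE[of _ _ "e / 2"])
      fix t p q assume t: "t \<le> u" "t \<le> ivl p q x" "q - p < e / 2"
      have tw: "t \<le> w" using t(1) uw by (rule order_trans)
      have y: "t \<le> is_real y" using t(1) u(2) by (rule order_trans)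
      have bounds: "s \<le> open_interval a b (rconst r)"
        if "s \<le> t" "p - e / 4 \<le> r" "r \<le> q + e / 4" "s \<le> (rconst r \<^bold># y)" for s r
      proof -
        have "s \<le> ivl (r - e / 8) (r + e / 8) (rconst r)" using e by (intro ivl_rconst) simp_all
        with order_trans[OF that(1) t(2)] have "s \<le> near x (rconst r) (1 / 2 ^ n)"
          by (rule nearI) (use that(2,3) t(3) in \<open>simp_all flip: e_def\<close>)
        then have "s \<le> (near x (rconst r) (1 / 2 ^ n) \<^bold>\<and> (rconst r \<^bold># y))" using that(4) by simp
        with u(4) order_trans[OF that(1) t(1)] is_real_rconst have "s \<le> H (rconst r)"
          by (rule subset_ofD)
        with H order_trans[OF that(1) tw] is_real_rconst show ?thesis by (rule subset_ofD)
      qed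
      have "t \<le> (a \<^bold>< x)"
        using y
      proof (rule rational_apartE[of _ _ "p - e / 4" p])
        fix s r assume s: "s \<le> t" "p - e / 4 \<le> r" "r \<le> p" "s \<le> (rconst r \<^bold># y)"
        have sw: "s \<le> w" using s(1) tw by (rule order_trans)
        have low: "s \<le> low r x" using order_trans[OF s(1) ivlD(1)[OF t(2)]] s(3) by (rule low_mono)
        from order_trans[OF order_trans[OF s(1) t(1)] x] low order_trans[OF s(1) ivlD(2)[OF t(2)]]
        show "s \<le> (a \<^bold>< x)"
        proof (rule low_uppE)
          assume "r < q"
          then have "s \<le> open_interval a b (rconst r)" using s e by (intro bounds) simp_all
          then have "s \<le> (a \<^bold>< rconst r)" by (simp add: open_interval_def)
          with order_trans[OF sw a] order_trans[OF order_trans[OF s(1) t(1)] x] show ?thesis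
            using low by (rule rless_rconst)
        qed
      qed (use e in simp)
      moreover have "t \<le> (x \<^bold>< b)"
        using y
      proof (rule rational_apartE[of _ _ q "q + e / 4"])
        fix s r assume s: "s \<le> t" "q \<le> r" "r \<le> q + e / 4" "s \<le> (rconst r \<^bold># y)"
        have sw: "s \<le> w" using s(1) tw by (rule order_trans)
        have upp: "s \<le> upp x r" using order_trans[OF s(1) ivlD(2)[OF t(2)]] s(2) by (rule upp_mono)
        from order_trans[OF order_trans[OF s(1) t(1)] x] order_trans[OF s(1) ivlD(1)[OF t(2)]] upp
        show "s \<le> (x \<^bold>< b)"
        proof (rule low_uppE)
          assume "p < r"
          then have "s \<le> open_interval a b (rconst r)" using s e by (intro bounds) simp_all
          then have "s \<le> (rconst r \<^bold>< b)" by (simp add: open_interval_def)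
          with order_trans[OF sw b] order_trans[OF order_trans[OF s(1) t(1)] x] show ?thesis
            using upp by (rule rconst_rless)
        qed
      qed (use e in simp)
      ultimately show "t \<le> open_interval a b x" by (simp add: open_interval_def)
    qed (use e in simp)
  qed
qed

section \<open>Generation of the extensions\<close>

lemma Ext_least:
  assumes "w \<le> Ext G H" and "w \<le> is_collection E" and "w \<le> ext_closed G E"
  shows "w \<le> E H"
proof -
  have "w \<le> ((is_collection E \<^bold>\<and> ext_closed G E) \<^bold>\<longrightarrow> E H)"
    using hallD[OF assms(1)[unfolded Ext_def], of E] .
  then show ?thesis by (rule himpD) (simp add: assms(2,3))
qed

lemma ExtI:
  assumes "\<And>v E. v \<le> w \<Longrightarrow> v \<le> is_collection E \<Longrightarrow> v \<le> ext_closed G E \<Longrightarrow> v \<le> E H"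
  shows "w \<le> Ext G H"
  unfolding Ext_def
proof (rule boundedI)
  fix E v assume "v \<le> w" "v \<le> (is_collection E \<^bold>\<and> ext_closed G E)"
  then show "v \<le> E H" using assms[of v E] by simp
qed

lemma Ext_base: "w \<le> Ext G G"
  by (rule ExtI) (simp add: ext_closed_def)

lemma Ext_coderiv:
  assumes "w \<le> is_set H" and "w \<le> Ext G H"
  shows "w \<le> Ext G (coderiv H)"
proof (rule ExtI)
  fix v E assume v: "v \<le> w" "v \<le> is_collection E" "v \<le> ext_closed G E"
  have "v \<le> (\<^bold>\<forall>\<^sub>S H. E H \<^bold>\<longrightarrow> E (coderiv H))" using v(3) by (simp only: ext_closed_def le_inf_iff)
  from boundedD[where D = is_set, OF this order_refl order_trans[OF v(1) assms(1)]]
  show "v \<le> E (coderiv H)"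
    by (rule himpD) (rule Ext_least[OF order_trans[OF v(1) assms(2)] v(2,3)])
qed

lemma Ext_Union:
  assumes "\<And>n. w \<le> is_set (H n)" and "\<And>n. w \<le> Ext G (H n)"
  shows "w \<le> Ext G (Union_seq H)"
proof (rule ExtI)
  fix v E assume v: "v \<le> w" "v \<le> is_collection E" "v \<le> ext_closed G E"
  have "v \<le> (\<^bold>\<forall>H. (\<^bold>\<forall>n. is_set (H n) \<^bold>\<and> E (H n)) \<^bold>\<longrightarrow> E (Union_seq H))"
    using v(3) by (simp only: ext_closed_def le_inf_iff)
  from hallD[OF this, of H] show "v \<le> E (Union_seq H)"
  proof (rule himpD, intro hallI hconjI)
    fix n
    show "v \<le> is_set (H n)" using v(1) assms(1) by (rule order_trans)
    show "v \<le> E (H n)" by (rule Ext_least[OF order_trans[OF v(1) assms(2)] v(2,3)])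
  qed
qed

lemma is_collectionD:
  assumes "w \<le> is_collection E" and "w \<le> is_set X" and "w \<le> is_set Y" and "w \<le> (X \<^bold>= Y)" and "w \<le> E X"
  shows "w \<le> E Y"
proof -
  have "w \<le> (\<^bold>\<forall>\<^sub>S Y. ((X \<^bold>= Y) \<^bold>\<and> E X) \<^bold>\<longrightarrow> E Y)"
    using boundedD[where D = is_set, OF assms(1)[unfolded is_collection_def] order_refl assms(2)] .
  from boundedD[where D = is_set, OF this order_refl assms(3)] show ?thesis
    by (rule himpD) (simp add: assms(4,5))
qed

lemma is_collectionI:
  assumes "\<And>v X Y. v \<le> w \<Longrightarrow> v \<le> (X \<^bold>= Y) \<Longrightarrow> v \<le> E X \<Longrightarrow> v \<le> E Y"
  shows "w \<le> is_collection E"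
  unfolding is_collection_def
proof (rule boundedI, rule boundedI, rule himpI)
  fix X v Y u t assume *: "v \<le> w" "u \<le> v" "t \<le> u" "t \<le> ((X \<^bold>= Y) \<^bold>\<and> E X)"
  have "t \<le> w" using *(3,2,1) by order
  then show "t \<le> E Y" by (rule assms[of t X]) (use *(4) in simp_all)
qed

lemma Ext_cong:
  assumes "w \<le> is_set X" and "w \<le> is_set Y" and "w \<le> (X \<^bold>= Y)" and "w \<le> Ext G X"
  shows "w \<le> Ext G Y"
proof (rule ExtI)
  fix v E assume v: "v \<le> w" "v \<le> is_collection E" "v \<le> ext_closed G E"
  note X = order_trans[OF v(1) assms(1)] order_trans[OF v(1) assms(2)] order_trans[OF v(1) assms(3)]
  show "v \<le> E Y"
    using Ext_least[OF order_trans[OF v(1) assms(4)] v(2,3)] by (rule is_collectionD[OF v(2) X])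
qed

lemma ext_closedI:
  assumes "w \<le> E G"
    and "\<And>v H. v \<le> w \<Longrightarrow> v \<le> E H \<Longrightarrow> v \<le> E (coderiv H)"
    and "\<And>v H. v \<le> w \<Longrightarrow> (\<And>n. v \<le> E (H n)) \<Longrightarrow> v \<le> E (Union_seq H)"
  shows "w \<le> ext_closed G E"
  unfolding ext_closed_def
proof (intro hconjI)
  show "w \<le> E G" by fact
  show "w \<le> (\<^bold>\<forall>\<^sub>S H. E H \<^bold>\<longrightarrow> E (coderiv H))"
  proof (rule boundedI, rule himpI)
    fix H v u assume "v \<le> w" "u \<le> v" "u \<le> E H"
    then show "u \<le> E (coderiv H)" by - (rule assms(2)[OF order_trans])
  qed
  show "w \<le> (\<^bold>\<forall>H. (\<^bold>\<forall>n. is_set (H n) \<^bold>\<and> E (H n)) \<^bold>\<longrightarrow> E (Union_seq H))"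
  proof (rule boundedI)
    fix H :: "nat \<Rightarrow> _" and v assume v: "v \<le> w" "v \<le> (\<^bold>\<forall>n. is_set (H n) \<^bold>\<and> E (H n))"
    have "v \<le> E (H n)" for n using hallD[OF v(2), of n] by simp
    with v(1) show "v \<le> E (Union_seq H)" by (rule assms(3))
  qed
qed

lemma is_set_Union_seq:
  assumes "\<And>n. w \<le> is_set (H n)"
  shows "w \<le> is_set (Union_seq H)"
proof (rule is_setI)
  fix v x y assume v: "v \<le> w" "v \<le> is_real x" "v \<le> is_real y" "v \<le> same_seq x y" "v \<le> Union_seq H x"
  from v(5) show "v \<le> Union_seq H y"
    unfolding Union_seq_def
  proof (rule hexE)
    fix n u assume u: "u \<le> v" "u \<le> H n x"
    have "u \<le> w" using u(1) v(1) by (rule order_trans)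
    from is_setD[OF order_trans[OF this assms[of n]] order_trans[OF u(1) v(2)] order_trans[OF u(1) v(3)]
        order_trans[OF u(1) v(4)] u(2)]
    show "u \<le> (\<^bold>\<exists>n. H n y)" by (rule hexI)
  qed
qed

lemma Union_seq_upper: "w \<le> (H n \<^bold>\<subseteq> Union_seq H)"
  unfolding Union_seq_def by (rule subset_ofI) (rule hexI)

lemma Union_seq_least:
  assumes "\<And>n. w \<le> (H n \<^bold>\<subseteq> K)"
  shows "w \<le> (Union_seq H \<^bold>\<subseteq> K)"
proof (rule subset_ofI)
  fix v x assume v: "v \<le> w" "v \<le> is_real x" "v \<le> Union_seq H x"
  from v(3) show "v \<le> K x" unfolding Union_seq_def
  proof (rule hexE)
    fix n u assume u: "u \<le> v" "u \<le> H n x"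
    show "u \<le> K x"
      using assms[of n] order_trans[OF u(1) v(1)] order_trans[OF u(1) v(2)] u(2) by (rule subset_ofD)
  qed
qed

lemma Ext_open_bounded:
  assumes G: "w \<le> cut_open G" "w \<le> (G \<^bold>\<subseteq> open_interval a b)"
    and ab: "w \<le> is_real a" "w \<le> is_real b"
    and H: "w \<le> Ext G H"
  shows "w \<le> cut_open H" and "w \<le> (H \<^bold>\<subseteq> open_interval a b)"
proof -
  have "w \<le> (\<lambda>H. (cut_open H) \<^bold>\<and> (H \<^bold>\<subseteq> open_interval a b)) H"
    using H
  proof (rule Ext_least)
    show "w \<le> is_collection (\<lambda>H. (cut_open H) \<^bold>\<and> (H \<^bold>\<subseteq> open_interval a b))"
    proof (rule is_collectionI)
      fix v X Y assume v: "v \<le> w" "v \<le> (X \<^bold>= Y)" "v \<le> ((cut_open X) \<^bold>\<and> (X \<^bold>\<subseteq> open_interval a b))"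
      then have X: "v \<le> cut_open X" "v \<le> (X \<^bold>\<subseteq> open_interval a b)" by simp_all
      note XY = set_eqD[OF v(2)]
      have "v \<le> (X \<^bold>\<subseteq> locally (\<lambda>S. S \<^bold>\<subseteq> Y))"
        using X(1) by (rule subset_locally_mono) (erule subset_of_trans, erule order_trans, rule XY(1))
      with XY(2) have "v \<le> cut_open Y" by (rule subset_of_trans)
      moreover have "v \<le> (Y \<^bold>\<subseteq> open_interval a b)" using XY(2) X(2) by (rule subset_of_trans)
      ultimately show "v \<le> ((cut_open Y) \<^bold>\<and> (Y \<^bold>\<subseteq> open_interval a b))" by (rule hconjI)
    qed
    show "w \<le> ext_closed G (\<lambda>H. (cut_open H) \<^bold>\<and> (H \<^bold>\<subseteq> open_interval a b))"
    proof (rule ext_closedI)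
      show "w \<le> ((cut_open G) \<^bold>\<and> (G \<^bold>\<subseteq> open_interval a b))" using G by (rule hconjI)
    next
      fix v H assume v: "v \<le> w" "v \<le> ((cut_open H) \<^bold>\<and> (H \<^bold>\<subseteq> open_interval a b))"
      then have "v \<le> cut_open H" "v \<le> (H \<^bold>\<subseteq> open_interval a b)" by simp_all
      then show "v \<le> ((cut_open (coderiv H)) \<^bold>\<and> (coderiv H \<^bold>\<subseteq> open_interval a b))"
        using order_trans[OF v(1) ab(1)] order_trans[OF v(1) ab(2)]
        by - (rule hconjI, rule cut_open_coderiv, assumption, rule coderiv_bounded)
    next
      fix v and H :: "nat \<Rightarrow> _" assume v: "v \<le> w" "\<And>n. v \<le> ((cut_open (H n)) \<^bold>\<and> (H n \<^bold>\<subseteq> open_interval a b))"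
      then have H: "v \<le> cut_open (H n)" "v \<le> (H n \<^bold>\<subseteq> open_interval a b)" for n by simp_all
      show "v \<le> ((cut_open (Union_seq H)) \<^bold>\<and> (Union_seq H \<^bold>\<subseteq> open_interval a b))"
      proof (rule hconjI)
        show "v \<le> cut_open (Union_seq H)"
          by (rule Union_seq_least, rule subset_locally_mono[OF H(1)])
            (erule subset_of_trans, rule Union_seq_upper)
        show "v \<le> (Union_seq H \<^bold>\<subseteq> open_interval a b)" using H(2) by (rule Union_seq_least)
      qed
    qed
  qed
  then show "w \<le> cut_open H" "w \<le> (H \<^bold>\<subseteq> open_interval a b)" by simp_all
qed

section \<open>The ideal of sets inside an extension\<close>

lemma choiceE:
  fixes R :: "nat \<Rightarrow> 'a \<Rightarrow> 'o::complete_heyting_algebra"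
  assumes "\<Turnstile> countable_choice D I"
    and "\<And>v n a b. v \<le> w \<Longrightarrow> v \<le> D a \<Longrightarrow> v \<le> D b \<Longrightarrow> v \<le> I a b \<Longrightarrow> v \<le> R n a \<Longrightarrow> v \<le> R n b"
    and "\<And>n. w \<le> (\<^bold>\<exists>a. D a \<^bold>\<and> R n a)"
    and "\<And>v f. v \<le> w \<Longrightarrow> (\<And>n. v \<le> D (f n)) \<Longrightarrow> (\<And>n. v \<le> R n (f n)) \<Longrightarrow> v \<le> \<psi>"
  shows "w \<le> \<psi>"
proof -
  have "w \<le> countable_choice D I" using assms(1) by (simp add: valid_def)
  from hallD[OF this[unfolded countable_choice_def], of R]
  have "w \<le> (\<^bold>\<exists>f. \<^bold>\<forall>n. D (f n) \<^bold>\<and> R n (f n))"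
  proof (rule himpD, intro hconjI)
    show "w \<le> (\<^bold>\<forall>n a b. (D a \<^bold>\<and> D b \<^bold>\<and> I a b \<^bold>\<and> R n a) \<^bold>\<longrightarrow> R n b)"
    proof (rule hallI, rule hallI, rule boundedI)
      fix n a b v assume v: "v \<le> w" "v \<le> (D a \<^bold>\<and> D b \<^bold>\<and> I a b \<^bold>\<and> R n a)"
      show "v \<le> R n b" by (rule assms(2)[of v a b]) (use v in simp_all)
    qed
    show "w \<le> (\<^bold>\<forall>n. \<^bold>\<exists>a. D a \<^bold>\<and> R n a)" using assms(3) by (rule hallI)
  qed
  then show ?thesis
  proof (rule hexE)
    fix f v assume v: "v \<le> w" "v \<le> (\<^bold>\<forall>n. D (f n) \<^bold>\<and> R n (f n))"
    have "v \<le> D (f n)" "v \<le> R n (f n)" for n using hallD[OF v(2), of n] by simp_all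
    with v(1) show "v \<le> \<psi>" by (rule assms(4))
  qed
qed

text \<open>
  The sets contained in a single extension. This is the passage from the hull, where the extension may
  depend on the point, to an extension that serves a whole set.
\<close>

definition covered :: "'o::complete_heyting_algebra real_set \<Rightarrow> 'o real_set \<Rightarrow> 'o" where
  "covered G S = (\<^bold>\<exists>\<^sub>S H. Ext G H \<^bold>\<and> (S \<^bold>\<subseteq> H))"

lemma coveredI: "w \<le> is_set H \<Longrightarrow> w \<le> Ext G H \<Longrightarrow> w \<le> (S \<^bold>\<subseteq> H) \<Longrightarrow> w \<le> covered G S"
  unfolding covered_def by (rule hexI[of _ _ H]) simp

lemma coveredE:
  assumes "w \<le> covered G S"
    and "\<And>v H. v \<le> w \<Longrightarrow> v \<le> is_set H \<Longrightarrow> v \<le> Ext G H \<Longrightarrow> v \<le> (S \<^bold>\<subseteq> H) \<Longrightarrow> v \<le> \<psi>"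
  shows "w \<le> \<psi>"
  by (rule hexE[OF assms(1)[unfolded covered_def]], simp only: le_inf_iff, elim conjE, rule assms(2))

text \<open>
  Countable choice selects the extensions that cover the members of a sequence of sets, and the union of
  the selected extensions is an extension.
\<close>

lemma sigma_ideal_covered:
  fixes w :: "'o::complete_heyting_algebra"
  assumes choice: "\<Turnstile> countable_choice_sets TYPE('o)" and G: "w \<le> is_set G"
  shows "sigma_ideal w (covered G)"
  unfolding sigma_ideal_def
proof (intro conjI allI impI)
  show "w \<le> covered G (\<lambda>_. bot)"
    using G Ext_base
  proof (rule coveredI)
    show "w \<le> ((\<lambda>_. bot) \<^bold>\<subseteq> G)" by (rule subset_ofI) (erule order_trans, rule bot_least)
  qed
next
  fix v S T assume v: "v \<le> w" "v \<le> (S \<^bold>\<subseteq> T)" "v \<le> covered G T"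
  from v(3) show "v \<le> covered G S"
  proof (rule coveredE)
    fix u H assume u: "u \<le> v" "u \<le> is_set H" "u \<le> Ext G H" "u \<le> (T \<^bold>\<subseteq> H)"
    from u(2,3) subset_of_trans[OF order_trans[OF u(1) v(2)] u(4)] show "u \<le> covered G S" by (rule coveredI)
  qed
next
  fix v and S :: "nat \<Rightarrow> 'o real_set" assume v: "v \<le> w" "\<forall>n. v \<le> covered G (S n)"
  show "v \<le> covered G (Union_seq S)"
  proof (rule choiceE[OF choice[unfolded countable_choice_sets_def], where w = v and R = "\<lambda>n H. Ext G H \<^bold>\<and> (S n \<^bold>\<subseteq> H)"])
    fix u n X Y assume u: "u \<le> is_set X" "u \<le> is_set Y" "u \<le> (X \<^bold>= Y)" "u \<le> (Ext G X \<^bold>\<and> (S n \<^bold>\<subseteq> X))"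
    then have X: "u \<le> Ext G X" "u \<le> (S n \<^bold>\<subseteq> X)" by simp_all
    from Ext_cong[OF u(1-3) X(1)] subset_of_trans[OF X(2) set_eqD(1)[OF u(3)]]
    show "u \<le> (Ext G Y \<^bold>\<and> (S n \<^bold>\<subseteq> Y))" by (rule hconjI)
  next
    fix n show "v \<le> (\<^bold>\<exists>\<^sub>S H. Ext G H \<^bold>\<and> (S n \<^bold>\<subseteq> H))" using v(2) by (simp only: covered_def)
  next
    fix u H assume u: "\<And>n. u \<le> is_set (H n)" "\<And>n. u \<le> (Ext G (H n) \<^bold>\<and> (S n \<^bold>\<subseteq> H n))"
    then have H: "u \<le> Ext G (H n)" "u \<le> (S n \<^bold>\<subseteq> H n)" for n by (simp_all only: le_inf_iff)
    show "u \<le> covered G (Union_seq S)"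
      using is_set_Union_seq[OF u(1)] Ext_Union[OF u(1) H(1)]
    proof (rule coveredI)
      show "u \<le> (Union_seq S \<^bold>\<subseteq> Union_seq H)"
        by (rule Union_seq_least, rule subset_of_trans[OF H(2)], rule Union_seq_upper)
    qed
  qed
qed

section \<open>The ideal of almost-enumerable sets\<close>

definition almost_enumerates :: "(nat \<Rightarrow> 'o::complete_heyting_algebra real_name) \<Rightarrow> 'o real_set \<Rightarrow> 'o" where
  "almost_enumerates f X = (\<^bold>\<forall>\<^sub>R x. X x \<^bold>\<longrightarrow>
    (\<^bold>\<forall>\<gamma>. is_seq \<gamma> \<^bold>\<longrightarrow> (\<^bold>\<exists>n k. \<gamma> n k \<^bold>\<and> (rabs (f n \<^bold>- x) \<^bold>< dyadic k))))"

lemma almost_enumerable_alt: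
  "almost_enumerable X = (\<^bold>\<exists>f. is_real_seq f \<^bold>\<and> almost_enumerates f X)"
  by (simp only: almost_enumerable_def almost_enumerates_def)

lemma almost_enumeratesI:
  assumes f: "\<And>n. w \<le> is_real (f n)"
    and "\<And>v x \<gamma>. v \<le> w \<Longrightarrow> v \<le> is_real x \<Longrightarrow> v \<le> X x \<Longrightarrow> v \<le> is_seq \<gamma> \<Longrightarrow>
      v \<le> (\<^bold>\<exists>n k. \<gamma> n k \<^bold>\<and> near (f n) x (1 / 2 ^ k))"
  shows "w \<le> almost_enumerates f X"
  unfolding almost_enumerates_def
proof (rule boundedI, rule himpI, rule boundedI)
  fix x v u t and \<gamma> :: "(_, nat) seq_name" assume *: "v \<le> w" "v \<le> is_real x" "u \<le> v" "u \<le> X x" "t \<le> u" "t \<le> is_seq \<gamma>"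
  have tw: "t \<le> w" using *(5,3,1) by order
  have x: "t \<le> is_real x" using *(5,3,2) by order
  from assms(2)[OF tw x order_trans[OF *(5,4)] *(6)]
  show "t \<le> (\<^bold>\<exists>n k. \<gamma> n k \<^bold>\<and> (rabs (f n \<^bold>- x) \<^bold>< dyadic k))"
  proof (rule hexE, elim hexE)
    fix n s k r assume r: "s \<le> t" "r \<le> s" "r \<le> (\<gamma> n k \<^bold>\<and> near (f n) x (1 / 2 ^ k))"
    have rt: "r \<le> t" using r(2,1) by (rule order_trans)
    have "r \<le> (\<gamma> n k \<^bold>\<and> (rabs (f n \<^bold>- x) \<^bold>< dyadic k))"
      using r(3) near_iff[OF order_trans[OF order_trans[OF rt tw] f] order_trans[OF rt x]] by simp
    then show "r \<le> (\<^bold>\<exists>n k. \<gamma> n k \<^bold>\<and> (rabs (f n \<^bold>- x) \<^bold>< dyadic k))"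
      by - (rule hexI[of _ _ n], rule hexI[of _ _ k])
  qed
qed

lemma almost_enumeratesE:
  assumes f: "\<And>n. w \<le> is_real (f n)" and "w \<le> almost_enumerates f X"
    and x: "w \<le> is_real x" and "w \<le> X x" and "w \<le> is_seq \<gamma>"
    and "\<And>v n k. v \<le> w \<Longrightarrow> v \<le> \<gamma> n k \<Longrightarrow> v \<le> near (f n) x (1 / 2 ^ k) \<Longrightarrow> v \<le> \<psi>"
  shows "w \<le> \<psi>"
proof -
  from himpD[OF all_realD[OF assms(2)[unfolded almost_enumerates_def] order_refl x] assms(4)]
  have "w \<le> (\<^bold>\<forall>\<gamma>. is_seq \<gamma> \<^bold>\<longrightarrow> (\<^bold>\<exists>n k. \<gamma> n k \<^bold>\<and> (rabs (f n \<^bold>- x) \<^bold>< dyadic k)))" .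
  from boundedD[where D = is_seq, OF this order_refl assms(5)] show ?thesis
  proof (rule hexE, elim hexE)
    fix n s k r assume r: "s \<le> w" "r \<le> s" "r \<le> (\<gamma> n k \<^bold>\<and> (rabs (f n \<^bold>- x) \<^bold>< dyadic k))"
    have rw: "r \<le> w" using r(2,1) by (rule order_trans)
    from rw show "r \<le> \<psi>"
      by (rule assms(6)[of r n k])
        (use r(3) near_iff[OF order_trans[OF rw f] order_trans[OF rw x], of n k] in simp_all)
  qed
qed

definition enumerable_off :: "'o::complete_heyting_algebra real_set \<Rightarrow> 'o real_set \<Rightarrow> 'o" where
  "enumerable_off G S = almost_enumerable (S \<^bold>\<setminus> G)"

lemma enumerable_offI:
  assumes "\<And>n. w \<le> is_real (f n)" and "w \<le> almost_enumerates f (S \<^bold>\<setminus> G)"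
  shows "w \<le> enumerable_off G S"
  unfolding enumerable_off_def almost_enumerable_alt is_real_seq_def
  by (rule hexI[of _ _ f], rule hconjI, rule hallI, rule assms(1), rule assms(2))

lemma enumerable_offE:
  assumes "w \<le> enumerable_off G S"
    and "\<And>v f. v \<le> w \<Longrightarrow> (\<And>n. v \<le> is_real (f n)) \<Longrightarrow> v \<le> almost_enumerates f (S \<^bold>\<setminus> G) \<Longrightarrow> v \<le> \<psi>"
  shows "w \<le> \<psi>"
proof (rule hexE[OF assms(1)[unfolded enumerable_off_def almost_enumerable_alt is_real_seq_def]])
  fix f v assume v: "v \<le> w" "v \<le> ((\<^bold>\<forall>n. is_real (f n)) \<^bold>\<and> almost_enumerates f (S \<^bold>\<setminus> G))"
  then have f: "v \<le> (\<^bold>\<forall>n. is_real (f n))" "v \<le> almost_enumerates f (S \<^bold>\<setminus> G)" by (simp_all only: le_inf_iff)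
  from v(1) hallD[OF f(1)] f(2) show "v \<le> \<psi>" by (rule assms(2))
qed

lemma enumerable_off_subset:
  assumes "w \<le> (S \<^bold>\<subseteq> G)"
  shows "w \<le> enumerable_off G S"
proof (rule enumerable_offI[OF is_real_rconst], rule almost_enumeratesI[OF is_real_rconst])
  fix v x and \<gamma> :: "(_, nat) seq_name" assume v: "v \<le> w" "v \<le> is_real x" "v \<le> (S \<^bold>\<setminus> G) x"
  then have "v \<le> S x" "v \<le> (\<^bold>\<not> G x)" by (simp_all add: set_minus_def)
  from hnegE[OF this(2) subset_ofD[OF assms v(1,2) this(1)]]
  show "v \<le> (\<^bold>\<exists>n k. \<gamma> n k \<^bold>\<and> near (rconst 0) x (1 / 2 ^ k))" .
qed

lemma almost_enumerates_cong:
  assumes f: "\<And>n. w \<le> is_real (f n)" and g: "\<And>n. w \<le> is_real (g n)"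
    and "\<And>n. w \<le> same_seq (f n) (g n)" and "w \<le> almost_enumerates f X"
  shows "w \<le> almost_enumerates g X"
  using g
proof (rule almost_enumeratesI)
  fix v x and \<gamma> :: "(_, nat) seq_name" assume v: "v \<le> w" "v \<le> is_real x" "v \<le> X x" "v \<le> is_seq \<gamma>"
  from order_trans[OF v(1) f] order_trans[OF v(1) assms(4)] v(2-4)
  show "v \<le> (\<^bold>\<exists>n k. \<gamma> n k \<^bold>\<and> near (g n) x (1 / 2 ^ k))"
  proof (rule almost_enumeratesE)
    fix u n k assume u: "u \<le> v" "u \<le> \<gamma> n k" "u \<le> near (f n) x (1 / 2 ^ k)"
    have "u \<le> near (g n) x (1 / 2 ^ k)"
      using order_trans[OF order_trans[OF u(1) v(1)] assms(3)] u(3) by (rule same_seq_near)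
    with u(2) show "u \<le> (\<^bold>\<exists>n k. \<gamma> n k \<^bold>\<and> near (g n) x (1 / 2 ^ k))"
      by - (rule hexI[of _ _ n], rule hexI[of _ _ k], rule hconjI)
  qed
qed

lemma is_seq_reindex:
  assumes "w \<le> is_seq \<gamma>"
  shows "w \<le> is_seq (\<lambda>n. \<gamma> (h n))"
proof (rule is_seqI)
  fix n show "w \<le> (\<^bold>\<exists>a. \<gamma> (h n) a)" using assms by (rule is_seq_total)
next
  fix n a b v assume "v \<le> w" "v \<le> \<gamma> (h n) a" "v \<le> \<gamma> (h n) b"
  then show "v \<le> \<langle>a = b\<rangle>" using is_seq_unique[of v \<gamma> "h n" a b] order_trans[OF _ assms] by blast
qed

lemma almost_enumerates_mono:
  assumes f: "\<And>n. w \<le> is_real (f n)" and "w \<le> almost_enumerates f X"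
    and "\<And>v x. v \<le> w \<Longrightarrow> v \<le> is_real x \<Longrightarrow> v \<le> Y x \<Longrightarrow> v \<le> X x"
  shows "w \<le> almost_enumerates f Y"
  using f
proof (rule almost_enumeratesI)
  fix v x and \<gamma> :: "(_, nat) seq_name" assume v: "v \<le> w" "v \<le> is_real x" "v \<le> Y x" "v \<le> is_seq \<gamma>"
  from order_trans[OF v(1) f] order_trans[OF v(1) assms(2)] v(2) assms(3)[OF v(1-3)] v(4)
  show "v \<le> (\<^bold>\<exists>n k. \<gamma> n k \<^bold>\<and> near (f n) x (1 / 2 ^ k))"
    by (rule almost_enumeratesE) (rule hexI, rule hexI, rule hconjI)
qed

text \<open>
  For a countable union, countable choice selects enumerations \<open>F n\<close>, and \<open>f\<close> runs through all of them.
  A given \<open>\<gamma>\<close> prescribes precisions along \<open>f\<close>, and hence along each \<open>F n\<close>.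
\<close>

lemma sigma_ideal_enumerable_off:
  fixes w :: "'o::complete_heyting_algebra"
  assumes choice: "\<Turnstile> countable_choice_real_seqs TYPE('o)"
  shows "sigma_ideal w (enumerable_off G)"
  unfolding sigma_ideal_def
proof (intro conjI allI impI)
  show "w \<le> enumerable_off G (\<lambda>_. bot)"
    by (rule enumerable_off_subset, rule subset_ofI) (erule order_trans, rule bot_least)
next
  fix v S T assume v: "v \<le> w" "v \<le> (S \<^bold>\<subseteq> T)" "v \<le> enumerable_off G T"
  from v(3) show "v \<le> enumerable_off G S"
  proof (rule enumerable_offE)
    fix u f assume u: "u \<le> v" "\<And>n. u \<le> is_real (f n)" "u \<le> almost_enumerates f (T \<^bold>\<setminus> G)"
    have "u \<le> almost_enumerates f (S \<^bold>\<setminus> G)"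
      using u(2,3)
    proof (rule almost_enumerates_mono)
      fix t x assume t: "t \<le> u" "t \<le> is_real x" "t \<le> (S \<^bold>\<setminus> G) x"
      then have "t \<le> S x" by (simp add: set_minus_def)
      with v(2) order_trans[OF t(1) u(1)] t(2) have "t \<le> T x" by (rule subset_ofD)
      then show "t \<le> (T \<^bold>\<setminus> G) x" using t(3) by (simp add: set_minus_def)
    qed
    with u(2) show "u \<le> enumerable_off G S" by (rule enumerable_offI)
  qed
next
  fix v and S :: "nat \<Rightarrow> 'o real_set" assume v: "v \<le> w" "\<forall>n. v \<le> enumerable_off G (S n)"
  show "v \<le> enumerable_off G (Union_seq S)"
  proof (rule choiceE[OF choice[unfolded countable_choice_real_seqs_def], where w = v
        and R = "\<lambda>n f. almost_enumerates f (S n \<^bold>\<setminus> G)"])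
    fix u n f g assume u: "u \<le> is_real_seq f" "u \<le> is_real_seq g" "u \<le> (\<^bold>\<forall>n. same_seq (f n) (g n))"
      "u \<le> almost_enumerates f (S n \<^bold>\<setminus> G)"
    from hallD[OF u(1)[unfolded is_real_seq_def]] hallD[OF u(2)[unfolded is_real_seq_def]] hallD[OF u(3)] u(4)
    show "u \<le> almost_enumerates g (S n \<^bold>\<setminus> G)" by (rule almost_enumerates_cong)
  next
    fix n show "v \<le> (\<^bold>\<exists>f. is_real_seq f \<^bold>\<and> almost_enumerates f (S n \<^bold>\<setminus> G))"
      using v(2) by (simp only: enumerable_off_def almost_enumerable_alt)
  next
    fix u and F :: "nat \<Rightarrow> nat \<Rightarrow> 'o real_name"
    assume u: "u \<le> v" "\<And>n. u \<le> is_real_seq (F n)" "\<And>n. u \<le> almost_enumerates (F n) (S n \<^bold>\<setminus> G)"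
    have F: "u \<le> is_real (F n k)" for n k using hallD[OF u(2)[of n, unfolded is_real_seq_def], of k] .
    define f where "f m = F (fst (prod_decode m)) (snd (prod_decode m))" for m :: nat
    have f: "u \<le> is_real (f m)" for m unfolding f_def by (rule F)
    have "u \<le> almost_enumerates f (Union_seq S \<^bold>\<setminus> G)"
      using f
    proof (rule almost_enumeratesI)
      fix t x and \<gamma> :: "(_, nat) seq_name" assume t: "t \<le> u" "t \<le> is_real x" "t \<le> (Union_seq S \<^bold>\<setminus> G) x" "t \<le> is_seq \<gamma>"
      then have *: "t \<le> (\<^bold>\<exists>n. S n x)" "t \<le> (\<^bold>\<not> G x)" by (simp_all add: set_minus_def Union_seq_def)
      from *(1) show "t \<le> (\<^bold>\<exists>n k. \<gamma> n k \<^bold>\<and> near (f n) x (1 / 2 ^ k))"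
      proof (rule hexE)
        fix n s assume s: "s \<le> t" "s \<le> S n x"
        have su: "s \<le> u" using s(1) t(1) by (rule order_trans)
        have "s \<le> (S n \<^bold>\<setminus> G) x" using s order_trans[OF s(1) *(2)] by (simp add: set_minus_def)
        with order_trans[OF su F] order_trans[OF su u(3)] order_trans[OF s(1) t(2)]
        show "s \<le> (\<^bold>\<exists>n k. \<gamma> n k \<^bold>\<and> near (f n) x (1 / 2 ^ k))"
          using is_seq_reindex[OF order_trans[OF s(1) t(4)], of "\<lambda>k. prod_encode (n, k)"]
        proof (rule almost_enumeratesE)
          fix r m k assume r: "r \<le> \<gamma> (prod_encode (n, m)) k" "r \<le> near (F n m) x (1 / 2 ^ k)"
          then show "r \<le> (\<^bold>\<exists>n k. \<gamma> n k \<^bold>\<and> near (f n) x (1 / 2 ^ k))"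
            by - (rule hexI[of _ _ "prod_encode (n, m)"], rule hexI[of _ _ k], simp add: f_def)
        qed
      qed
    qed
    with f show "u \<le> enumerable_off G (Union_seq S)" by (rule enumerable_offI)
  qed
qed

text \<open>
  Enumerate \<open>y\<close> first. A point either is within the precision prescribed for index 0 or is apart from
  \<open>y\<close>, and then the old enumeration finds it.
\<close>

lemma enumerable_off_add_point:
  assumes S: "w \<le> enumerable_off G S" and y: "w \<le> is_real y"
    and T: "\<And>v z. v \<le> w \<Longrightarrow> v \<le> is_real z \<Longrightarrow> v \<le> T z \<Longrightarrow> v \<le> (z \<^bold># y) \<Longrightarrow> v \<le> S z"
  shows "w \<le> enumerable_off G T"
  using S
proof (rule enumerable_offE)
  fix v f assume v: "v \<le> w" "\<And>n. v \<le> is_real (f n)" "v \<le> almost_enumerates f (S \<^bold>\<setminus> G)"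
  define g where "g = case_nat y f"
  have g: "v \<le> is_real (g n)" for n
    using v(2) order_trans[OF v(1) y] by (cases n) (simp_all add: g_def)
  have "v \<le> almost_enumerates g (T \<^bold>\<setminus> G)"
    using g
  proof (rule almost_enumeratesI)
    fix u x and \<gamma> :: "(_, nat) seq_name" assume u: "u \<le> v" "u \<le> is_real x" "u \<le> (T \<^bold>\<setminus> G) x" "u \<le> is_seq \<gamma>"
    let ?goal = "\<^bold>\<exists>n k. \<gamma> n k \<^bold>\<and> near (g n) x (1 / 2 ^ k)"
    from is_seq_total[OF u(4), of 0] show "u \<le> ?goal"
    proof (rule hexE)
      fix k t assume t: "t \<le> u" "t \<le> \<gamma> 0 k"
      note x = order_trans[OF t(1) u(2)]
      have tv: "t \<le> v" using t(1) u(1) by (rule order_trans)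
      have tw: "t \<le> w" using tv v(1) by (rule order_trans)
      from x order_trans[OF tw y] show "t \<le> ?goal"
      proof (rule near_or_apartE[of _ _ _ "1 / 2 ^ k"])
        fix s assume s: "s \<le> t" "s \<le> near x y (1 / 2 ^ k)"
        have "s \<le> near (g 0) x (1 / 2 ^ k)" using near_sym[OF s(2)] by (simp add: g_def)
        with order_trans[OF s(1) t(2)] show "s \<le> ?goal"
          by - (rule hexI[of _ _ 0], rule hexI[of _ _ k], rule hconjI)
      next
        fix s assume s: "s \<le> t" "s \<le> (x \<^bold># y)"
        note sx = order_trans[OF s(1) x]
        have sv: "s \<le> v" using s(1) tv by (rule order_trans)
        have "s \<le> (T \<^bold>\<setminus> G) x" using order_trans[OF order_trans[OF s(1) t(1)] u(3)] .
        then have TG: "s \<le> T x" "s \<le> (\<^bold>\<not> G x)" by (simp_all add: set_minus_def)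
        from T[OF order_trans[OF s(1) tw] sx TG(1) s(2)] TG(2)
        have "s \<le> (S \<^bold>\<setminus> G) x" by (simp add: set_minus_def)
        with order_trans[OF sv v(2)] order_trans[OF sv v(3)] sx show "s \<le> ?goal"
          using is_seq_reindex[OF order_trans[OF order_trans[OF s(1) t(1)] u(4)], of Suc]
        proof (rule almost_enumeratesE)
          fix r n k assume "r \<le> \<gamma> (Suc n) k" "r \<le> near (f n) x (1 / 2 ^ k)"
          then show "r \<le> ?goal"
            by - (rule hexI[of _ _ "Suc n"], rule hexI[of _ _ k], simp add: g_def)
        qed
      qed simp
    qed
  qed
  with g show "v \<le> enumerable_off G T" by (rule enumerable_offI)
qed

text \<open>
  The exceptional points of a co-derivative extension cannot be listed, since it is not decidable which
  intervals have one. The induction hypothesis is therefore local: every point of \<open>H\<close> has a neighbourhood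
  whose part outside \<open>G\<close> is almost-enumerable. Only one exceptional point \<open>y\<close> is then relevant at a time,
  and the hypothesis for \<open>H\<close> extends from the points of a punctured ball to the whole punctured ball.
\<close>

lemma Ext_locally_enumerable:
  fixes w :: "'o::complete_heyting_algebra"
  assumes choice: "\<Turnstile> countable_choice_real_seqs TYPE('o)" and fan: "\<Turnstile> fan_theorem TYPE('o)"
    and G: "w \<le> cut_open G" and H: "w \<le> Ext G H"
  shows "w \<le> (H \<^bold>\<subseteq> locally (enumerable_off G))"
proof -
  have "w \<le> (\<lambda>H. H \<^bold>\<subseteq> locally (enumerable_off G)) H"
    using H
  proof (rule Ext_least)
    show "w \<le> is_collection (\<lambda>H. H \<^bold>\<subseteq> locally (enumerable_off G))"
      by (rule is_collectionI) (rule subset_of_trans[OF set_eqD(2)])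
    show "w \<le> ext_closed G (\<lambda>H. H \<^bold>\<subseteq> locally (enumerable_off G))"
    proof (rule ext_closedI)
      show "w \<le> (G \<^bold>\<subseteq> locally (enumerable_off G))"
        using G by (rule subset_locally_mono) (rule enumerable_off_subset)
    next
      fix v H assume v: "v \<le> w" "v \<le> (H \<^bold>\<subseteq> locally (enumerable_off G))"
      show "v \<le> (coderiv H \<^bold>\<subseteq> locally (enumerable_off G))"
      proof (rule subset_ofI)
        fix u x assume u: "u \<le> v" "u \<le> is_real x" "u \<le> coderiv H x"
        from u(2,3) show "u \<le> locally (enumerable_off G) x"
        proof (rule coderivE)
          fix t n y
          let ?P = "\<lambda>z. near x z (1 / 2 ^ n) \<^bold>\<and> (z \<^bold># y)"
          assume t: "t \<le> u" "t \<le> is_real y" "t \<le> near x y (1 / 2 ^ n)" "t \<le> (?P \<^bold>\<subseteq> H)"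
          have tv: "t \<le> v" using t(1) u(1) by (rule order_trans)
          note x = order_trans[OF t(1) u(2)]
          have P: "t \<le> enumerable_off G ?P"
            by (rule punctured_in_ideal[OF fan sigma_ideal_enumerable_off[OF choice] x t(2)],
                rule subset_of_trans[OF t(4) order_trans[OF tv v(2)]])
          from x show "t \<le> locally (enumerable_off G) x"
          proof (rule locatedE[of _ _ "1 / 2 ^ n"])
            fix s p q assume s: "s \<le> t" "s \<le> ivl p q x" "q - p < 1 / 2 ^ n"
            have "s \<le> enumerable_off G (ivl p q)"
              using order_trans[OF s(1) P] order_trans[OF s(1) t(2)]
            proof (rule enumerable_off_add_point)
              fix r z assume r: "r \<le> s" "r \<le> ivl p q z" "r \<le> (z \<^bold># y)"
              have "r \<le> near x z (1 / 2 ^ n)" using order_trans[OF r(1) s(2)] r(2) s(3) by (rule near_ivl)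
              with r(3) show "r \<le> ?P z" by simp
            qed
            with s(2) show "s \<le> locally (enumerable_off G) x" by (rule locallyI)
          qed simp
        qed
      qed
    next
      fix v and H :: "nat \<Rightarrow> _" assume "\<And>n. v \<le> (H n \<^bold>\<subseteq> locally (enumerable_off G))"
      then show "v \<le> (Union_seq H \<^bold>\<subseteq> locally (enumerable_off G))" by (rule Union_seq_least)
    qed
  qed
  then show ?thesis .
qed

section \<open>The co-perfect hull\<close>

lemma hull_subset_covered:
  assumes G: "w \<le> cut_open G" "w \<le> (G \<^bold>\<subseteq> open_interval (rneg rpi) rpi)"
  shows "w \<le> (coperfect_hull G \<^bold>\<subseteq> locally (covered G))"
proof (rule subset_ofI)
  fix v x assume v: "v \<le> w" "v \<le> is_real x" "v \<le> coperfect_hull G x"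
  then have "v \<le> (\<^bold>\<exists>\<^sub>S H. Ext G H \<^bold>\<and> H x)" by (simp add: coperfect_hull_def)
  then show "v \<le> locally (covered G) x"
  proof (rule hexE, simp only: le_inf_iff, elim conjE)
    fix H u assume u: "u \<le> v" "u \<le> is_set H" "u \<le> Ext G H" "u \<le> H x"
    have uw: "u \<le> w" using u(1) v(1) by (rule order_trans)
    note x = order_trans[OF u(1) v(2)]
    have "u \<le> cut_open H"
      using order_trans[OF uw G(1)] order_trans[OF uw G(2)] is_real_rneg[OF is_real_rpi] is_real_rpi u(3)
      by (rule Ext_open_bounded)
    then have "u \<le> (H \<^bold>\<subseteq> locally (covered G))"
    proof (rule subset_locally_mono)
      fix t S assume t: "t \<le> u" "t \<le> (S \<^bold>\<subseteq> H)"
      from order_trans[OF t(1) u(2)] order_trans[OF t(1) u(3)] t(2) show "t \<le> covered G S" by (rule coveredI)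
    qed
    then show "u \<le> locally (covered G) x" using order_refl x u(4) by (rule subset_ofD)
  qed
qed

lemma Ext_subset_hull:
  assumes G: "w \<le> cut_open G" "w \<le> (G \<^bold>\<subseteq> open_interval (rneg rpi) rpi)"
    and H: "w \<le> is_set H" "w \<le> Ext G H"
  shows "w \<le> (H \<^bold>\<subseteq> coperfect_hull G)"
proof (rule subset_ofI)
  fix v x assume v: "v \<le> w" "v \<le> is_real x" "v \<le> H x"
  have "w \<le> (H \<^bold>\<subseteq> open_interval (rneg rpi) rpi)"
    using G is_real_rneg[OF is_real_rpi] is_real_rpi H(2) by (rule Ext_open_bounded)
  then have "v \<le> open_interval (rneg rpi) rpi x" using v by (rule subset_ofD)
  moreover have "v \<le> (\<^bold>\<exists>\<^sub>S H. Ext G H \<^bold>\<and> H x)"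
    using order_trans[OF v(1) H(1)] order_trans[OF v(1) H(2)] v(3) by - (rule hexI[of _ _ H], simp)
  ultimately show "v \<le> coperfect_hull G x" by (simp add: coperfect_hull_def)
qed

text \<open>
  Here the fan theorem and choice do their work: the elements of a punctured ball in the hull belong to
  various extensions, but a single extension \<open>H\<close> contains the ball, so that its centre is in the
  co-derivative extension of \<open>H\<close>.
\<close>

lemma coderiv_hull_subset:
  fixes w :: "'o::complete_heyting_algebra"
  assumes choice: "\<Turnstile> countable_choice_sets TYPE('o)" and fan: "\<Turnstile> fan_theorem TYPE('o)"
    and set: "w \<le> is_set G"
    and G: "w \<le> cut_open G" "w \<le> (G \<^bold>\<subseteq> open_interval (rneg rpi) rpi)"
  shows "w \<le> (coderiv (coperfect_hull G) \<^bold>\<subseteq> coperfect_hull G)"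
proof (rule subset_ofI)
  fix v x assume v: "v \<le> w" "v \<le> is_real x" "v \<le> coderiv (coperfect_hull G) x"
  from v(2,3) show "v \<le> coperfect_hull G x"
  proof (rule coderivE)
    fix u n y
    let ?P = "\<lambda>z. near x z (1 / 2 ^ n) \<^bold>\<and> (z \<^bold># y)"
    assume u: "u \<le> v" "u \<le> is_real y" "u \<le> near x y (1 / 2 ^ n)" "u \<le> (?P \<^bold>\<subseteq> coperfect_hull G)"
    have uw: "u \<le> w" using u(1) v(1) by (rule order_trans)
    note x = order_trans[OF u(1) v(2)]
    note uG = order_trans[OF uw G(1)] order_trans[OF uw G(2)]
    have "u \<le> covered G ?P"
      by (rule punctured_in_ideal[OF fan sigma_ideal_covered[OF choice order_trans[OF uw set]] x u(2)],
          rule subset_of_trans[OF u(4) hull_subset_covered[OF uG]])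
    then show "u \<le> coperfect_hull G x"
    proof (rule coveredE)
      fix t H assume t: "t \<le> u" "t \<le> is_set H" "t \<le> Ext G H" "t \<le> (?P \<^bold>\<subseteq> H)"
      have "t \<le> coderiv H x"
        using order_trans[OF t(1) x] order_trans[OF t(1) u(2)] order_trans[OF t(1) u(3)] t(4) by (rule coderivI)
      moreover have "t \<le> (coderiv H \<^bold>\<subseteq> coperfect_hull G)"
        using order_trans[OF t(1) uG(1)] order_trans[OF t(1) uG(2)] is_set_coderiv Ext_coderiv[OF t(2,3)]
        by (rule Ext_subset_hull)
      ultimately show "t \<le> coperfect_hull G x"
        using order_trans[OF t(1) x] by - (rule subset_ofD[OF _ order_refl])
    qed
  qed
qed

lemma cut_open_hull:
  assumes G: "w \<le> cut_open G" "w \<le> (G \<^bold>\<subseteq> open_interval (rneg rpi) rpi)"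
  shows "w \<le> cut_open (coperfect_hull G)"
  using hull_subset_covered[OF G]
proof (rule subset_locally_mono)
  fix v S assume v: "v \<le> w" "v \<le> covered G S"
  from v(2) show "v \<le> (S \<^bold>\<subseteq> coperfect_hull G)"
  proof (rule coveredE)
    fix u H assume u: "u \<le> v" "u \<le> is_set H" "u \<le> Ext G H" "u \<le> (S \<^bold>\<subseteq> H)"
    have uw: "u \<le> w" using u(1) v(1) by (rule order_trans)
    from u(4) Ext_subset_hull[OF order_trans[OF uw G(1)] order_trans[OF uw G(2)] u(2,3)]
    show "u \<le> (S \<^bold>\<subseteq> coperfect_hull G)" by (rule subset_of_trans)
  qed
qed

lemma is_set_open_interval: "w \<le> is_set (open_interval a b)"
proof (rule is_setI)
  fix v x y assume *: "v \<le> same_seq x y" "v \<le> open_interval a b x"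
  have 1: "v \<le> (a \<^bold>< x)" and 2: "v \<le> (x \<^bold>< b)" using *(2) by (simp_all add: open_interval_def)
  have "v \<le> (a \<^bold>< y)"
    using 1 unfolding rless_def
  proof (rule hexE, elim hexE, simp only: le_inf_iff, elim conjE decidedE)
    fix n u p t q s assume s: "u \<le> v" "t \<le> u" "s \<le> t" "s \<le> a n p" "s \<le> x n q" "snd p < fst q"
    have "s \<le> v" using s(3,2,1) by order
    from same_seqD[OF order_trans[OF this *(1)] s(5)] s(4,6)
    show "s \<le> (\<^bold>\<exists>n p q. a n p \<^bold>\<and> y n q \<^bold>\<and> \<langle>snd p < fst q\<rangle>)"
      by - (rule hexI[of _ _ n], rule hexI[of _ _ p], rule hexI[of _ _ q], simp add: le_decided)
  qed
  moreover have "v \<le> (y \<^bold>< b)"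
    using 2 unfolding rless_def
  proof (rule hexE, elim hexE, simp only: le_inf_iff, elim conjE decidedE)
    fix n u p t q s assume s: "u \<le> v" "t \<le> u" "s \<le> t" "s \<le> x n p" "s \<le> b n q" "snd p < fst q"
    have "s \<le> v" using s(3,2,1) by order
    from same_seqD[OF order_trans[OF this *(1)] s(4)] s(5,6)
    show "s \<le> (\<^bold>\<exists>n p q. y n p \<^bold>\<and> b n q \<^bold>\<and> \<langle>snd p < fst q\<rangle>)"
      by - (rule hexI[of _ _ n], rule hexI[of _ _ p], rule hexI[of _ _ q], simp add: le_decided)
  qed
  ultimately show "v \<le> open_interval a b y" by (simp add: open_interval_def)
qed

lemma interval_in_Ext:
  fixes w :: "'o::complete_heyting_algebra"
  assumes choice: "\<Turnstile> countable_choice_sets TYPE('o)" and fan: "\<Turnstile> fan_theorem TYPE('o)"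
    and set: "w \<le> is_set G"
    and G: "w \<le> cut_open G" "w \<le> (G \<^bold>\<subseteq> open_interval (rneg rpi) rpi)"
    and full: "w \<le> (open_interval (rneg rpi) rpi \<^bold>\<subseteq> coperfect_hull G)"
  shows "w \<le> Ext G (open_interval (rneg rpi) rpi)"
proof -
  note pi = is_real_rneg[OF is_real_rpi] is_real_rpi
  have "w \<le> covered G (open_interval (rneg rpi) rpi)"
    by (rule open_interval_in_ideal[OF fan sigma_ideal_covered[OF choice set] pi],
        rule subset_of_trans[OF full hull_subset_covered[OF G]])
  then show ?thesis
  proof (rule coveredE)
    fix v H assume v: "v \<le> w" "v \<le> is_set H" "v \<le> Ext G H" "v \<le> (open_interval (rneg rpi) rpi \<^bold>\<subseteq> H)"
    have "v \<le> (H \<^bold>\<subseteq> open_interval (rneg rpi) rpi)"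
      using order_trans[OF v(1) G(1)] order_trans[OF v(1) G(2)] pi v(3) by (rule Ext_open_bounded)
    from v(2) is_set_open_interval set_eqI[OF this v(4)] v(3)
    show "v \<le> Ext G (open_interval (rneg rpi) rpi)" by (rule Ext_cong)
  qed
qed

text \<open>
  The two end points are added one after the other; a point of the closed interval that is apart from both
  is in the open interval.
\<close>

lemma closed_interval_enumerable:
  assumes a: "w \<le> is_real a" and b: "w \<le> is_real b"
    and open_int: "w \<le> enumerable_off G (open_interval a b)"
  shows "w \<le> enumerable_off G (closed_interval a b)"
proof -
  have "w \<le> enumerable_off G (\<lambda>z. (a \<^bold>\<le> z) \<^bold>\<and> (z \<^bold>< b))"
    using open_int a
  proof (rule enumerable_off_add_point)
    fix v z assume v: "v \<le> ((a \<^bold>\<le> z) \<^bold>\<and> (z \<^bold>< b))" "v \<le> (z \<^bold># a)"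
    from v(2) have "v \<le> (a \<^bold>< z)"
      unfolding apart_def
    proof (rule hdisjE)
      fix u assume u: "u \<le> v" "u \<le> (z \<^bold>< a)"
      have "u \<le> (\<^bold>\<not> (z \<^bold>< a))" using order_trans[OF u(1) v(1)] by (simp add: rle_def)
      then show "u \<le> (a \<^bold>< z)" using u(2) by (rule hnegE)
    qed
    then show "v \<le> open_interval a b z" using v(1) by (simp add: open_interval_def)
  qed
  then show ?thesis
    using b
  proof (rule enumerable_off_add_point)
    fix v z assume v: "v \<le> closed_interval a b z" "v \<le> (z \<^bold># b)"
    from v(2) have "v \<le> (z \<^bold>< b)"
      unfolding apart_def
    proof (rule hdisjE)
      fix u assume u: "u \<le> v" "u \<le> (b \<^bold>< z)"
      have "u \<le> (\<^bold>\<not> (b \<^bold>< z))" using order_trans[OF u(1) v(1)] by (simp add: closed_interval_def rle_def)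
      then show "u \<le> (z \<^bold>< b)" using u(2) by (rule hnegE)
    qed
    then show "v \<le> ((a \<^bold>\<le> z) \<^bold>\<and> (z \<^bold>< b))" using v(1) by (simp add: closed_interval_def)
  qed
qed

theorem mainTheorem16:
  assumes "\<Turnstile> countable_choice_sets TYPE('o::complete_heyting_algebra)"
    and "\<Turnstile> countable_choice_real_seqs TYPE('o)"
    and "\<Turnstile> fan_theorem TYPE('o)"
  shows "\<Turnstile> (\<^bold>\<forall>\<^sub>S G :: 'o real_set.
    (is_open G \<^bold>\<and> (G \<^bold>\<subseteq> open_interval (rneg rpi) rpi)) \<^bold>\<longrightarrow>
      (coderiv (coperfect_hull G) \<^bold>= coperfect_hull G)
      \<^bold>\<and> ((open_interval (rneg rpi) rpi \<^bold>\<subseteq> coperfect_hull G) \<^bold>\<longrightarrow>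
            eventually_full (rneg rpi) rpi G
            \<^bold>\<and> almost_enumerable (closed_interval (rneg rpi) rpi \<^bold>\<setminus> G))
      \<^bold>\<and> (\<^bold>\<forall>\<^sub>R x. open_interval (rneg rpi) rpi x \<^bold>\<longrightarrow> (\<^bold>\<not> coperfect_hull G x) \<^bold>\<longrightarrow>
            (\<^bold>\<forall>n. \<^bold>\<not> (\<^bold>\<forall>\<^sub>R z.
              (open_interval (x \<^bold>- dyadic n) x \<^bold>\<union> open_interval x (x \<^bold>+ dyadic n)) z
                \<^bold>\<longrightarrow> coperfect_hull G z))))"
  unfolding valid_def
proof (rule top_le, rule boundedI, rule himpI)
  fix G :: "'o real_set" and w' w
  assume w': "w' \<le> is_set G" and w: "w \<le> w'" and hyp: "w \<le> (is_open G \<^bold>\<and> (G \<^bold>\<subseteq> open_interval (rneg rpi) rpi))"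
  let ?I = "open_interval (rneg rpi) rpi :: 'o real_set"
  let ?hull = "coperfect_hull G"
  note pi = is_real_rneg[OF is_real_rpi] is_real_rpi
  have set: "w \<le> is_set G" using w w' by (rule order_trans)
  have op: "w \<le> is_open G" and sub: "w \<le> (G \<^bold>\<subseteq> ?I)" using hyp by simp_all
  note G = is_open_cut_open[OF op] sub
  note hull_closed = coderiv_hull_subset[OF assms(1,3) set G]
  show "w \<le> ((coderiv ?hull \<^bold>= ?hull)
      \<^bold>\<and> ((?I \<^bold>\<subseteq> ?hull) \<^bold>\<longrightarrow>
            eventually_full (rneg rpi) rpi G
            \<^bold>\<and> almost_enumerable (closed_interval (rneg rpi) rpi \<^bold>\<setminus> G))
      \<^bold>\<and> (\<^bold>\<forall>\<^sub>R x. ?I x \<^bold>\<longrightarrow> (\<^bold>\<not> ?hull x) \<^bold>\<longrightarrow>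
            (\<^bold>\<forall>n. \<^bold>\<not> (\<^bold>\<forall>\<^sub>R z.
              (open_interval (x \<^bold>- dyadic n) x \<^bold>\<union> open_interval x (x \<^bold>+ dyadic n)) z
                \<^bold>\<longrightarrow> ?hull z))))"
  proof (intro hconjI)
    show "w \<le> (coderiv ?hull \<^bold>= ?hull)"
      using hull_closed subset_coderiv[OF cut_open_hull[OF G]] by (rule set_eqI)
  next
    show "w \<le> ((?I \<^bold>\<subseteq> ?hull) \<^bold>\<longrightarrow>
            eventually_full (rneg rpi) rpi G
            \<^bold>\<and> almost_enumerable (closed_interval (rneg rpi) rpi \<^bold>\<setminus> G))"
    proof (rule himpI)
      fix v assume v: "v \<le> w" "v \<le> (?I \<^bold>\<subseteq> ?hull)"
      note vG = order_trans[OF v(1) G(1)] order_trans[OF v(1) G(2)]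
      have Ext: "v \<le> Ext G ?I"
        using assms(1,3) order_trans[OF v(1) set] vG v(2) by (rule interval_in_Ext)
      have "v \<le> eventually_full (rneg rpi) rpi G"
        using Ext order_trans[OF v(1) op] vG(2) by (simp add: eventually_full_def)
      moreover have "v \<le> enumerable_off G ?I"
        by (rule open_interval_in_ideal[OF assms(3) sigma_ideal_enumerable_off[OF assms(2)] pi],
            rule Ext_locally_enumerable[OF assms(2,3) vG(1) Ext])
      then have "v \<le> almost_enumerable (closed_interval (rneg rpi) rpi \<^bold>\<setminus> G)"
        unfolding enumerable_off_def[symmetric] by (rule closed_interval_enumerable[OF pi])
      ultimately show "v \<le> (eventually_full (rneg rpi) rpi G
          \<^bold>\<and> almost_enumerable (closed_interval (rneg rpi) rpi \<^bold>\<setminus> G))" by (rule hconjI)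
    qed
  next
    show "w \<le> (\<^bold>\<forall>\<^sub>R x. ?I x \<^bold>\<longrightarrow> (\<^bold>\<not> ?hull x) \<^bold>\<longrightarrow>
            (\<^bold>\<forall>n. \<^bold>\<not> (\<^bold>\<forall>\<^sub>R z.
              (open_interval (x \<^bold>- dyadic n) x \<^bold>\<union> open_interval x (x \<^bold>+ dyadic n)) z
                \<^bold>\<longrightarrow> ?hull z)))"
    proof (rule boundedI, rule himpI, rule himpI, rule hallI, rule hnegI)
      fix x u1 u2 u3 n v
      assume u: "u1 \<le> w" "u1 \<le> is_real x" "u2 \<le> u1" "u3 \<le> u2" "u3 \<le> (\<^bold>\<not> ?hull x)"
        and v: "v \<le> u3" "v \<le> (\<^bold>\<forall>\<^sub>R z.
              (open_interval (x \<^bold>- dyadic n) x \<^bold>\<union> open_interval x (x \<^bold>+ dyadic n)) z \<^bold>\<longrightarrow> ?hull z)"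
      have vw: "v \<le> w" using v(1) u(4,3,1) by order
      have x: "v \<le> is_real x" using v(1) u(4,3,2) by order
      \<comment> \<open>If the hull contained a punctured ball around \<open>x\<close>, then \<open>x\<close> would be in its co-derivative
        extension, with \<open>x\<close> as the exceptional point, and hence in the hull.\<close>
      have "v \<le> ((\<lambda>z. near x z (1 / 2 ^ n) \<^bold>\<and> (z \<^bold># x)) \<^bold>\<subseteq> ?hull)"
      proof (rule subset_ofI)
        fix t z assume t: "t \<le> v" "t \<le> is_real z" "t \<le> (near x z (1 / 2 ^ n) \<^bold>\<and> (z \<^bold># x))"
        then have z: "t \<le> near x z (1 / 2 ^ n)" "t \<le> ((z \<^bold>< x) \<^bold>\<or> (x \<^bold>< z))" by (simp_all add: apart_def)
        have ball: "t \<le> ((x \<^bold>- dyadic n) \<^bold>< z)" "t \<le> (z \<^bold>< (x \<^bold>+ dyadic n))"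
          using ball_near[OF order_trans[OF t(1) x] t(2) z(1)] by (simp_all add: open_interval_def)
        from z(2) have "t \<le> (open_interval (x \<^bold>- dyadic n) x \<^bold>\<union> open_interval x (x \<^bold>+ dyadic n)) z"
          unfolding set_union_def open_interval_def
          by (rule hdisjE)
            (rule hdisjI1, rule hconjI[OF order_trans[OF _ ball(1)]], assumption+,
              rule hdisjI2, rule hconjI[OF _ order_trans[OF _ ball(2)]], assumption+)
        then show "t \<le> ?hull z" by (rule himpD[OF all_realD[OF v(2) t(1,2)]])
      qed
      with x x near_refl[OF x] have "v \<le> coderiv ?hull x" by (rule coderivI) simp
      with hull_closed vw x have "v \<le> ?hull x" by (rule subset_ofD)
      with order_trans[OF v(1) u(5)] show "v \<le> bot" by (rule hnegE)
    qed
  qed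
qed

end
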